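(* Consider the setting and definitions given in the context, let $p\in\mathbb{N}_0$, and suppose that $f\in H^{p+1}(\Omega)$. Let $z\in V$ denote the unique solution of $$\mathfrak{a}(z,\varphi)=(f,A:D\varphi+b\cdot\varphi)_{L^2(\Omega)}\quad\text{for all }\varphi\in V,$$ let $\tilde z_H\in\tilde V_H$ be the unique solution of $$\mathfrak{a}(\tilde z_H,\tilde v_H)=(f,A:D\tilde v_H+b\cdot\tilde v_H)_{L^2(\Omega)}\quad\text{for all }\tilde v_H\in\tilde V_H,$$ and let $\hat z_H:=\tilde z_H+\mathcal{Q}(\Pi_Hf)$. Then $$\|D(z-\hat z_H)\|_{L^2(\Omega)}\le\alpha^{-1}\left(\|A\|_{L^\infty}+C_{\mathrm P}^{-1}\|b\|_{L^\infty}\right)C_\Pi H^{p+1}|f|_{H^{p+1}(\Omega)},$$ $$\|z-\hat z_H\|_{L^2(\Omega)}\le c_{\mathrm p}H\,\|D(z-\hat z_H)\|_{L^2(\Omega)}.$$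
   Context: **Domain and space $V$.** $d\in\{2,3\}$; $\Omega\subset\mathbb{R}^d$ is a bounded convex polyhedral domain with exterior unit normal $n$; $V:=\{\varphi\in H^1(\Omega;\mathbb{R}^d):\varphi-(\varphi\cdot n)n=0\text{ on }\partial\Omega\}$; $C_{\mathrm P}:=\inf_{\varphi\in V\setminus\{0\}}\|D\varphi\|_{L^2(\Omega)}/\|\varphi\|_{L^2(\Omega)}>0$ with $D\varphi$ the Jacobian. Write $X:Y=\mathrm{tr}(X^{\mathrm T}Y)$; pointwise matrix norms are Frobenius norms. **Coefficients.** $A\in L^\infty(\Omega;\mathbb{R}^{d\times d}_{\mathrm{sym}})$ and $b\in L^\infty(\Omega;\mathbb{R}^d)$. There are $\nu_1,\nu_2>0$ with $\nu_1|\xi|^2\le(A\xi)\cdot\xi\le\nu_2|\xi|^2$ a.e. in $\Omega$ for all $\xi\in\mathbb{R}^d$. Cordes-type condition: with $\eta:=1$ if $\|b\|_{L^\infty}\ne0$, $\eta:=0$ otherwise, and $\delta_0:=\eta/(1+C_{\mathrm P}^2)$, there is $\delta\in(\delta_0,1]$ such that $\frac{A:A+b\cdot b}{(\mathrm{tr}A)^2}\le\frac1{d-1+\delta}$ a.e. in $\Omega$. **Bilinear form.** For a fixed $\sigma>0$, $\mathfrak{a}(\psi,\varphi):=(A:D\psi+b\cdot\psi,A:D\varphi+b\cdot\varphi)_{L^2(\Omega)}+\sigma(\mathrm{rot}\,\psi,\mathrm{rot}\,\varphi)_{L^2(\Omega)}$ on $V\times V$, with $\mathrm{rot}\,\psi=\partial_2\psi_1-\partial_1\psi_2$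 if $d=2$ and the usual curl if $d=3$. It is known that $\mathfrak{a}$ is bounded and coercive; $\alpha>0$ denotes a coercivity constant: $\mathfrak{a}(\varphi,\varphi)\ge\alpha\|D\varphi\|_{L^2(\Omega)}^2$ for all $\varphi\in V$. **Meshes.** $\mathcal{T}_H$ belongs to a shape-regular, quasi-uniform family of geometrically conformal meshes of $\overline\Omega$ into closed simplices or quadrilaterals/hexahedra, $H=\max_{T\in\mathcal T_H}\mathrm{diam}\,T$. $\mathcal{F}_H$ is the set of all closed facets (interior and boundary), each with a fixed unit normal $n_F$. **Fine-scale and multiscale spaces.** $\langle q_F,\varphi\rangle:=\int_F\varphi\cdot n_F\,\mathrm ds$ for $F\in\mathcal{F}_H$, $\varphi\in V$; $W:=\bigcap_{F\in\mathcal{F}_H}\ker q_F\subset V$; $\tilde V_H:=\{v\in V:\mathfrak{a}(v,w)=0\text{ for all }w\in W\}$. It is known that there is a constant $c_{\mathrm p}>0$ independent of $H$ with $\|w\|_{L^2(T)}\le c_{\mathrm p}H\|Dw\|_{L^2(T)}$ for all $w\in W$ and $T\in\mathcal{T}_H$; $c_{\mathrm p}$ denotes such a constant. **Correction.** $Y_H$ is a scalar-valued finite element space on $\mathcal{T}_H$ and $\Pi_H:H^1(\Omega)\to Y_H$ an interpolation operator with $\|v-\Pi_Hv\|_{L^2(\Omega)}\le C_\Pi H^k|v|_{H^k(\Omega)}$ for all $k\in\{0,\dots,p+1\}$ and $v\in H^k(\Omega)$ (for $k=0$: $v\in H^1(\Omega)$), with $C_\Pi>0$ independent of $H$. For $y_H\in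 Y_H$, $\mathcal{Q}y_H\in W$ is the unique element of $W$ with $\mathfrak{a}(\mathcal{Q}y_H,w)=(y_H,A:Dw+b\cdot w)_{L^2(\Omega)}$ for all $w\in W$. *)

theory Defs
  imports "HOL-Analysis.Analysis" "HOL-Probability.Essential_Supremum"
begin

type_synonym 'd region = "(real, 'd) vec set"
type_synonym 'd mesh = "(real, 'd) vec set set"
type_synonym 'd scalar_field = "(real, 'd) vec \<Rightarrow> real"
type_synonym 'd vector_field = "(real, 'd) vec \<Rightarrow> (real, 'd) vec"
type_synonym 'd matrix_field = "(real, 'd) vec \<Rightarrow> ((real, 'd) vec, 'd) vec"

section \<open>Lebesgue spaces\<close>

text \<open>Functions on \<open>S\<close> are represented by total functions whose values outside \<open>S\<close> are
  irrelevant; classes modulo null sets are represented by their members. On \<^typ>\<open>real^'n^'m\<close> the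
  norm is the Frobenius norm.\<close>

definition L2_space :: "(real^'d) set \<Rightarrow> ((real^'d) \<Rightarrow> 'b::euclidean_space) set" where
  "L2_space S = {u. u \<in> borel_measurable (lebesgue_on S) \<and>
                    integrable (lebesgue_on S) (\<lambda>x. (norm (u x))\<^sup>2)}"

definition L2_norm :: "(real^'d) set \<Rightarrow> ((real^'d) \<Rightarrow> 'b::euclidean_space) \<Rightarrow> real" where
  "L2_norm S u = sqrt (\<integral>x. (norm (u x))\<^sup>2 \<partial>lebesgue_on S)"

definition L2_inner ::
  "(real^'d) set \<Rightarrow> ((real^'d) \<Rightarrow> 'b::euclidean_space) \<Rightarrow> ((real^'d) \<Rightarrow> 'b) \<Rightarrow> real" where
  "L2_inner S u v = (\<integral>x. u x \<bullet> v x \<partial>lebesgue_on S)"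

definition Linf_space :: "(real^'d) set \<Rightarrow> ((real^'d) \<Rightarrow> 'b::euclidean_space) set" where
  "Linf_space S = {u. u \<in> borel_measurable (lebesgue_on S) \<and>
                      (\<exists>c. AE x in lebesgue_on S. norm (u x) \<le> c)}"

definition Linf_norm :: "(real^'d) set \<Rightarrow> ((real^'d) \<Rightarrow> 'b::euclidean_space) \<Rightarrow> real" where
  "Linf_norm S u = real_of_ereal (esssup (lebesgue_on S) (\<lambda>x. ereal (norm (u x))))"

section \<open>Smooth functions and weak derivatives\<close>

definition partial :: "'d \<Rightarrow> ((real^'d) \<Rightarrow> real) \<Rightarrow> (real^'d) \<Rightarrow> real" where
  "partial i f x = frechet_derivative f (at x) (axis i 1)"

text \<open>\<open>iter_partial [i\<^sub>1, \<dots>, i\<^sub>k] f\<close> is the partial derivative of order \<open>k\<close> in the coordinate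
  directions \<open>i\<^sub>1, \<dots>, i\<^sub>k\<close>.\<close>

fun iter_partial :: "'d list \<Rightarrow> ((real^'d) \<Rightarrow> real) \<Rightarrow> (real^'d) \<Rightarrow> real" where
  "iter_partial [] f = f"
| "iter_partial (i # is) f = partial i (iter_partial is f)"

text \<open>Every derivative is differentiable, hence continuous.\<close>

definition smooth :: "((real^'d) \<Rightarrow> real) \<Rightarrow> bool" where
  "smooth f \<longleftrightarrow> (\<forall>is x. iter_partial is f differentiable (at x))"

definition test_functions :: "(real^'d) set \<Rightarrow> ((real^'d) \<Rightarrow> real) set" where
  "test_functions \<Omega> = {\<phi>. smooth \<phi> \<and> compact (closure {x. \<phi> x \<noteq> 0}) \<and> closure {x. \<phi> x \<noteq> 0} \<subseteq> \<Omega>}"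

definition has_weak_deriv ::
  "(real^'d) set \<Rightarrow> 'd list \<Rightarrow> ((real^'d) \<Rightarrow> real) \<Rightarrow> ((real^'d) \<Rightarrow> real) \<Rightarrow> bool" where
  "has_weak_deriv \<Omega> is u g \<longleftrightarrow>
     g \<in> L2_space \<Omega> \<and>
     (\<forall>\<phi>\<in>test_functions \<Omega>.
        (\<integral>x. u x * iter_partial is \<phi> x \<partial>lebesgue_on \<Omega>) =
        (-1) ^ length is * (\<integral>x. g x * \<phi> x \<partial>lebesgue_on \<Omega>))"

definition weak_deriv :: "(real^'d) set \<Rightarrow> 'd list \<Rightarrow> ((real^'d) \<Rightarrow> real) \<Rightarrow> (real^'d) \<Rightarrow> real" where
  "weak_deriv \<Omega> is u = (SOME g. has_weak_deriv \<Omega> is u g)"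

definition Hk_space :: "(real^'d) set \<Rightarrow> nat \<Rightarrow> ((real^'d) \<Rightarrow> real) set" where
  "Hk_space \<Omega> k = {u \<in> L2_space \<Omega>. \<forall>is. length is \<le> k \<longrightarrow> (\<exists>g. has_weak_deriv \<Omega> is u g)}"

text \<open>The \<open>L\<^sup>2\<close> norm of the pointwise Frobenius norm of the tensor of all derivatives of order
  \<open>k\<close>, i.e. mixed derivatives are counted with multiplicity.\<close>

definition Hk_seminorm :: "(real^'d) set \<Rightarrow> nat \<Rightarrow> ((real^'d) \<Rightarrow> real) \<Rightarrow> real" where
  "Hk_seminorm \<Omega> k u = sqrt (\<Sum>is | length is = k. (L2_norm \<Omega> (weak_deriv \<Omega> is u))\<^sup>2)"

definition H1_vec :: "(real^'d) set \<Rightarrow> ((real^'d) \<Rightarrow> (real^'d)) set" where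
  "H1_vec \<Omega> = {\<phi>. \<forall>i. (\<lambda>x. \<phi> x $ i) \<in> Hk_space \<Omega> 1}"

definition Jac :: "(real^'d) set \<Rightarrow> ((real^'d) \<Rightarrow> (real^'d)) \<Rightarrow> (real^'d) \<Rightarrow> (real^'d^'d)" where
  "Jac \<Omega> \<phi> x = (\<chi> i j. weak_deriv \<Omega> [j] (\<lambda>y. \<phi> y $ i) x)"

definition H1_norm :: "(real^'d) set \<Rightarrow> ((real^'d) \<Rightarrow> (real^'d)) \<Rightarrow> real" where
  "H1_norm \<Omega> \<phi> = sqrt ((L2_norm \<Omega> \<phi>)\<^sup>2 + (L2_norm \<Omega> (Jac \<Omega> \<phi>))\<^sup>2)"

section \<open>Traces on flat facets\<close>

text \<open>The \<open>(d-1)\<close>-dimensional surface measure of a closed subset \<open>F\<close> of a hyperplane: the measure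
  of \<open>B \<subseteq> F\<close> is the Lebesgue measure of the right cylinder of height 1 over \<open>B\<close>, centred at the
  hyperplane \<open>affine hull F\<close>; \<open>closest_point\<close> is the orthogonal projection onto that
  hyperplane.\<close>

definition surface_measure :: "(real^'d) set \<Rightarrow> (real^'d) measure" where
  "surface_measure F =
     distr (restrict_space lborel
              {x. closest_point (affine hull F) x \<in> F \<and> infdist x (affine hull F) \<le> 1/2})
           borel (closest_point (affine hull F))"

text \<open>The trace as the \<open>L\<^sup>2(F)\<close> limit of the restrictions to \<open>F\<close> of functions smooth up to the
  boundary which converge in \<open>H\<^sup>1(\<Omega>)\<close>; here \<open>F\<close> is a facet contained in the closure of
  \<open>\<Omega>\<close>, either in the interior or on the boundary.\<close>

definition has_trace ::
  "(real^'d) set \<Rightarrow> (real^'d) set \<Rightarrow> ((real^'d) \<Rightarrow> (real^'d)) \<Rightarrow> ((real^'d) \<Rightarrow> (real^'d)) \<Rightarrow> bool" where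
  "has_trace \<Omega> F \<phi> g \<longleftrightarrow>
     g \<in> borel_measurable (surface_measure F) \<and>
     integrable (surface_measure F) (\<lambda>x. (norm (g x))\<^sup>2) \<and>
     (\<exists>\<psi>. (\<forall>m i. smooth (\<lambda>x. \<psi> m x $ i)) \<and>
          (\<lambda>m::nat. H1_norm \<Omega> (\<lambda>x. \<psi> m x - \<phi> x)) \<longlonglongrightarrow> 0 \<and>
          (\<lambda>m. \<integral>x. (norm (\<psi> m x - g x))\<^sup>2 \<partial>surface_measure F) \<longlonglongrightarrow> 0)"

definition trace_on ::
  "(real^'d) set \<Rightarrow> (real^'d) set \<Rightarrow> ((real^'d) \<Rightarrow> (real^'d)) \<Rightarrow> (real^'d) \<Rightarrow> (real^'d)" where
  "trace_on \<Omega> F \<phi> = (SOME g. has_trace \<Omega> F \<phi> g)"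

section \<open>The domain and the space V\<close>

definition convex_polyhedral_domain :: "(real^'d) set \<Rightarrow> bool" where
  "convex_polyhedral_domain \<Omega> \<longleftrightarrow> open \<Omega> \<and> \<Omega> \<noteq> {} \<and> convex \<Omega> \<and> polytope (closure \<Omega>)"

definition outer_normal :: "(real^'d) set \<Rightarrow> (real^'d) set \<Rightarrow> real^'d" where
  "outer_normal \<Omega> G = (THE n. norm n = 1 \<and> (\<forall>x\<in>G. \<forall>y\<in>\<Omega>. n \<bullet> (y - x) < 0))"

definition V_space :: "(real^'d) set \<Rightarrow> ((real^'d) \<Rightarrow> (real^'d)) set" where
  "V_space \<Omega> = {\<phi> \<in> H1_vec \<Omega>. \<forall>G. G facet_of closure \<Omega> \<longrightarrow>
     (\<exists>g. has_trace \<Omega> G \<phi> g \<and>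
          (AE x in surface_measure G. g x - (g x \<bullet> outer_normal \<Omega> G) *\<^sub>R outer_normal \<Omega> G = 0))}"

definition C_P :: "(real^'d) set \<Rightarrow> real" where
  "C_P \<Omega> = (INF \<phi>\<in>{\<phi> \<in> V_space \<Omega>. \<not> (AE x in lebesgue_on \<Omega>. \<phi> x = 0)}.
              L2_norm \<Omega> (Jac \<Omega> \<phi>) / L2_norm \<Omega> \<phi>)"

section \<open>Coefficients and the bilinear form\<close>

definition frob :: "real^'d^'d \<Rightarrow> real^'d^'d \<Rightarrow> real" where
  "frob X Y = trace (transpose X ** Y)"

definition cordes_threshold :: "(real^'d) set \<Rightarrow> ((real^'d) \<Rightarrow> (real^'d)) \<Rightarrow> real" where
  "cordes_threshold \<Omega> b = (if Linf_norm \<Omega> b \<noteq> 0 then 1 else 0) / (1 + (C_P \<Omega>)\<^sup>2)"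

definition admissible_coeffs ::
  "(real^'d) set \<Rightarrow> ((real^'d) \<Rightarrow> (real^'d^'d)) \<Rightarrow> ((real^'d) \<Rightarrow> (real^'d)) \<Rightarrow> bool" where
  "admissible_coeffs \<Omega> A b \<longleftrightarrow>
     A \<in> Linf_space \<Omega> \<and> b \<in> Linf_space \<Omega> \<and>
     (AE x in lebesgue_on \<Omega>. transpose (A x) = A x) \<and>
     (\<exists>\<nu>\<^sub>1 > 0. \<exists>\<nu>\<^sub>2 > 0. AE x in lebesgue_on \<Omega>. \<forall>\<xi>.
        \<nu>\<^sub>1 * (norm \<xi>)\<^sup>2 \<le> (A x *v \<xi>) \<bullet> \<xi> \<and> (A x *v \<xi>) \<bullet> \<xi> \<le> \<nu>\<^sub>2 * (norm \<xi>)\<^sup>2) \<and>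
     (\<exists>\<delta>. cordes_threshold \<Omega> b < \<delta> \<and> \<delta> \<le> 1 \<and>
        (AE x in lebesgue_on \<Omega>.
           (frob (A x) (A x) + b x \<bullet> b x) / (trace (A x))\<^sup>2 \<le> 1 / (real CARD('d) - 1 + \<delta>)))"

definition L_op ::
  "(real^'d) set \<Rightarrow> ((real^'d) \<Rightarrow> (real^'d^'d)) \<Rightarrow> ((real^'d) \<Rightarrow> (real^'d)) \<Rightarrow>
   ((real^'d) \<Rightarrow> (real^'d)) \<Rightarrow> (real^'d) \<Rightarrow> real" where
  "L_op \<Omega> A b \<phi> x = frob (A x) (Jac \<Omega> \<phi> x) + b x \<bullet> \<phi> x"

text \<open>A ring with two or three elements is \<open>\<int>/2\<close> or \<open>\<int>/3\<close>, so with the index type in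
  \<^class>\<open>comm_ring_1\<close> (as for the types \<open>2\<close> and \<open>3\<close>) the coordinates are numbered by the
  numerals \<open>1, 2\<close> and \<open>1, 2, 3\<close> respectively.\<close>

definition rot2 ::
  "'d::{finite,comm_ring_1} region \<Rightarrow> 'd vector_field \<Rightarrow> 'd scalar_field" where
  "rot2 \<Omega> \<psi> x = Jac \<Omega> \<psi> x $ 1 $ 2 - Jac \<Omega> \<psi> x $ 2 $ 1"

definition rot3 ::
  "'d::{finite,comm_ring_1} region \<Rightarrow> 'd vector_field \<Rightarrow> (real,'d) vec \<Rightarrow> real^3" where
  "rot3 \<Omega> \<psi> x = vector [Jac \<Omega> \<psi> x $ 3 $ 2 - Jac \<Omega> \<psi> x $ 2 $ 3,
                        Jac \<Omega> \<psi> x $ 1 $ 3 - Jac \<Omega> \<psi> x $ 3 $ 1,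
                        Jac \<Omega> \<psi> x $ 2 $ 1 - Jac \<Omega> \<psi> x $ 1 $ 2]"

definition rot_inner ::
  "'d::{finite,comm_ring_1} region \<Rightarrow> 'd vector_field \<Rightarrow> 'd vector_field \<Rightarrow> real" where
  "rot_inner \<Omega> \<psi> \<phi> = (if CARD('d) = 2 then L2_inner \<Omega> (rot2 \<Omega> \<psi>) (rot2 \<Omega> \<phi>)
                        else L2_inner \<Omega> (rot3 \<Omega> \<psi>) (rot3 \<Omega> \<phi>))"

definition a_form ::
  "'d::{finite,comm_ring_1} region \<Rightarrow> 'd matrix_field \<Rightarrow> 'd vector_field \<Rightarrow>
   real \<Rightarrow> 'd vector_field \<Rightarrow> 'd vector_field \<Rightarrow> real" where
  "a_form \<Omega> A b \<sigma> \<psi> \<phi> =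
     L2_inner \<Omega> (L_op \<Omega> A b \<psi>) (L_op \<Omega> A b \<phi>) + \<sigma> * rot_inner \<Omega> \<psi> \<phi>"

section \<open>Meshes\<close>

text \<open>The multilinear map from the unit cube sending the cube vertex \<open>\<epsilon>\<close> to \<open>v \<epsilon>\<close>.\<close>

definition multilinear_map :: "(bool^'d \<Rightarrow> real^'d) \<Rightarrow> real^'d \<Rightarrow> real^'d" where
  "multilinear_map v s =
     (\<Sum>\<epsilon>\<in>UNIV. (\<Prod>i\<in>UNIV. if \<epsilon> $ i then s $ i else 1 - s $ i) *\<^sub>R v \<epsilon>)"

text \<open>Convex quadrilaterals (\<open>d = 2\<close>) and convex hexahedra with plane facets (\<open>d = 3\<close>), with
  vertices labelled as those of the unit cube.\<close>

definition cuboid_cell :: "(bool^'d \<Rightarrow> real^'d) \<Rightarrow> (real^'d) set \<Rightarrow> bool" where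
  "cuboid_cell v T \<longleftrightarrow>
     inj v \<and> T = convex hull (range v) \<and> aff_dim T = int CARD('d) \<and>
     {F. F facet_of T} = {convex hull (v ` {\<epsilon>. \<epsilon> $ i = \<beta>}) | i \<beta>. True} \<and>
     inj_on (multilinear_map v) (cbox 0 1) \<and> multilinear_map v ` cbox 0 1 = T"

definition conforming_mesh :: "(real^'d) set \<Rightarrow> (real^'d) set set \<Rightarrow> bool" where
  "conforming_mesh \<Omega> \<T> \<longleftrightarrow>
     finite \<T> \<and> \<Union>\<T> = closure \<Omega> \<and>
     (\<forall>T\<in>\<T>. int CARD('d) simplex T \<or> (\<exists>v. cuboid_cell v T)) \<and>
     (\<forall>T\<in>\<T>. \<forall>T'\<in>\<T>. (T \<inter> T') face_of T \<and> (T \<inter> T') face_of T')"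

definition mesh_size :: "(real^'d) set set \<Rightarrow> real" where
  "mesh_size \<T> = Max (diameter ` \<T>)"

definition shape_regular_family :: "(real^'d) set set set \<Rightarrow> bool" where
  "shape_regular_family \<TT> \<longleftrightarrow>
     (\<exists>\<gamma>. \<forall>\<T>\<in>\<TT>. \<forall>T\<in>\<T>. \<exists>c r. r > 0 \<and> cball c r \<subseteq> T \<and> diameter T \<le> \<gamma> * r)"

definition quasi_uniform_family :: "(real^'d) set set set \<Rightarrow> bool" where
  "quasi_uniform_family \<TT> \<longleftrightarrow>
     (\<exists>\<gamma>. \<forall>\<T>\<in>\<TT>. \<forall>T\<in>\<T>. mesh_size \<T> \<le> \<gamma> * diameter T)"

definition mesh_facets :: "(real^'d) set set \<Rightarrow> (real^'d) set set" where
  "mesh_facets \<T> = {F. \<exists>T\<in>\<T>. F facet_of T}"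

definition unit_normal_to :: "(real^'d) set \<Rightarrow> real^'d \<Rightarrow> bool" where
  "unit_normal_to F n \<longleftrightarrow> norm n = 1 \<and> (\<forall>x\<in>F. \<forall>y\<in>F. n \<bullet> (x - y) = 0)"

section \<open>Fine-scale, multiscale and finite element spaces\<close>

definition q_facet ::
  "(real^'d) set \<Rightarrow> ((real^'d) set \<Rightarrow> real^'d) \<Rightarrow> (real^'d) set \<Rightarrow> ((real^'d) \<Rightarrow> (real^'d)) \<Rightarrow> real" where
  "q_facet \<Omega> nF F \<phi> = (\<integral>x. trace_on \<Omega> F \<phi> x \<bullet> nF F \<partial>surface_measure F)"

definition W_space ::
  "(real^'d) set \<Rightarrow> (real^'d) set set \<Rightarrow> ((real^'d) set \<Rightarrow> real^'d) \<Rightarrow> ((real^'d) \<Rightarrow> (real^'d)) set" where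
  "W_space \<Omega> \<T> nF = {\<phi> \<in> V_space \<Omega>. \<forall>F\<in>mesh_facets \<T>. q_facet \<Omega> nF F \<phi> = 0}"

definition Vms_space ::
  "'d::{finite,comm_ring_1} region \<Rightarrow> 'd matrix_field \<Rightarrow> 'd vector_field \<Rightarrow>
   real \<Rightarrow> 'd mesh \<Rightarrow> ('d region \<Rightarrow> (real,'d) vec) \<Rightarrow> 'd vector_field set" where
  "Vms_space \<Omega> A b \<sigma> \<T> nF = {v \<in> V_space \<Omega>. \<forall>w\<in>W_space \<Omega> \<T> nF. a_form \<Omega> A b \<sigma> v w = 0}"

text \<open>On each element a finite element function is a polynomial, either directly or, on
  quadrilaterals and hexahedra, after pullback to the unit cube by the multilinear map.\<close>

definition fe_shape_function :: "(real^'d) set \<Rightarrow> ((real^'d) \<Rightarrow> real) \<Rightarrow> bool" where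
  "fe_shape_function T y \<longleftrightarrow>
     (\<exists>q. real_polynomial_function q \<and> (AE x in lebesgue_on T. y x = q x)) \<or>
     (\<exists>v q. cuboid_cell v T \<and> real_polynomial_function q \<and>
        (AE x in lebesgue_on T. \<forall>s\<in>cbox 0 1. multilinear_map v s = x \<longrightarrow> y x = q s))"

definition fe_space :: "(real^'d) set \<Rightarrow> (real^'d) set set \<Rightarrow> ((real^'d) \<Rightarrow> real) set \<Rightarrow> bool" where
  "fe_space \<Omega> \<T> Y \<longleftrightarrow>
     Y \<subseteq> L2_space \<Omega> \<and>
     (\<forall>y\<in>Y. \<forall>T\<in>\<T>. fe_shape_function T y) \<and>
     (\<lambda>x. 0) \<in> Y \<and>
     (\<forall>y\<in>Y. \<forall>y'\<in>Y. (\<lambda>x. y x + y' x) \<in> Y) \<and>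
     (\<forall>c. \<forall>y\<in>Y. (\<lambda>x. c * y x) \<in> Y) \<and>
     (\<exists>B. finite B \<and> B \<subseteq> Y \<and>
        (\<forall>y\<in>Y. \<exists>c. AE x in lebesgue_on \<Omega>. y x = (\<Sum>\<beta>\<in>B. c \<beta> * \<beta> x)))"

text \<open>An operator defined on classes modulo null sets.\<close>

definition respects_AE :: "(real^'d) set \<Rightarrow> (((real^'d) \<Rightarrow> real) \<Rightarrow> (real^'d) \<Rightarrow> real) \<Rightarrow> bool" where
  "respects_AE \<Omega> PiH \<longleftrightarrow>
     (\<forall>u\<in>Hk_space \<Omega> 1. \<forall>v\<in>Hk_space \<Omega> 1.
        (AE x in lebesgue_on \<Omega>. u x = v x) \<longrightarrow> (AE x in lebesgue_on \<Omega>. PiH u x = PiH v x))"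

end

(*
  The error e = z - zh lies in V, and Galerkin orthogonality makes it a-orthogonal to the multiscale
  space, which is the a-orthogonal complement of W. Since V is complete and the facet functionals
  are continuous, W is closed, so V is the a-orthogonal sum of W and the multiscale space; hence e
  lies in W. Testing with e itself gives a(e,e) = (f - Pi f, L e), and coercivity yields the first
  bound, the elementwise Poincare inequality on W the second.

  The only hard ingredient is a trace inequality for smooth functions on a facet F of a convex body
  T. The facet is covered by finitely many pieces, each of which can be translated into T along a
  fixed oblique direction; on each piece the one-dimensional fundamental theorem of calculus along
  that direction, Fubini's theorem and translation invariance of Lebesgue measure suffice. The
  density of smooth functions in V is part of the definition of the trace, because the closure of
  the domain has a facet.
*)

theory Submission
  imports Defs
begin

section \<open>Square-integrable functions\<close>

text \<open>What shapes the proof is that functions are not identified modulo null sets and that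
  \<open>weak_deriv\<close> and \<open>trace_on\<close> are arbitrary choices. \<open>Jac\<close> is
  therefore linear only almost everywhere, and V and W have to be shown independent of
  representatives: the error is at last known to agree with an element of W only off a null set. The
  form is a weighted sum of L2 products, so it can be written as the L2 product of
  \<open>B \<phi>\<close> and \<open>B \<theta>\<close> with one bounded linear \<open>B\<close>;
  the a-orthogonal projection onto W is then a least squares problem in L2. The constant
  \<open>C_P \<Omega>\<close> enters twice: it turns control of the Jacobian into control of the
  full H1 norm, which makes minimising sequences converge, and it weights \<open>b\<close> in the
  final bound. The surface measure is defined by volumes of cylinders, so a facet integral is a
  volume integral over a slab, and a trace estimate can be obtained by translating this slab,
  without charts. Membership in V prescribes traces only on boundary facets, whereas W needs them on
  interior facets too; this is why approximation by smooth fields is separated from the traces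
  themselves.\<close>

definition sqint :: "'a measure \<Rightarrow> ('a \<Rightarrow> 'b::euclidean_space) \<Rightarrow> bool" where
  "sqint M u \<longleftrightarrow> u \<in> borel_measurable M \<and> integrable M (\<lambda>x. (norm (u x))\<^sup>2)"

text \<open>\<open>sqint\<close> and \<open>l2\<close> are taken over an arbitrary measure because
  the same estimates serve Lebesgue measure on \<open>\<Omega>\<close> and on single cells, surface
  measures, and the real line.\<close>

definition l2 :: "'a measure \<Rightarrow> ('a \<Rightarrow> 'b::euclidean_space) \<Rightarrow> real" where
  "l2 M u = sqrt (\<integral>x. (norm (u x))\<^sup>2 \<partial>M)"

lemma sqintD: "sqint M u \<Longrightarrow> u \<in> borel_measurable M" "sqint M u \<Longrightarrow> integrable M (\<lambda>x. (norm (u x))\<^sup>2)"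
  by (auto simp: sqint_def)

lemma l2_nonneg [simp]: "0 \<le> l2 M u"
  by (simp add: l2_def)

lemma l2_sq: "(l2 M u)\<^sup>2 = (\<integral>x. (norm (u x))\<^sup>2 \<partial>M)"
  by (simp add: l2_def)

lemma l2_zero [simp]: "l2 M (\<lambda>x. 0) = 0"
  by (simp add: l2_def)

lemma sqint_bound:
  fixes u :: "'a \<Rightarrow> 'b::euclidean_space" and v :: "'a \<Rightarrow> 'c::euclidean_space"
  assumes "u \<in> borel_measurable M" "sqint M v" "AE x in M. norm (u x) \<le> C * norm (v x)"
  shows "sqint M u"
proof -
  have "integrable M (\<lambda>x. (norm (u x))\<^sup>2)"
  proof (rule Bochner_Integration.integrable_bound)
    show "integrable M (\<lambda>x. C\<^sup>2 * (norm (v x))\<^sup>2)" using sqintD[OF assms(2)] by simp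
    show "(\<lambda>x. (norm (u x))\<^sup>2) \<in> borel_measurable M" using assms(1) by measurable
    show "AE x in M. norm ((norm (u x))\<^sup>2) \<le> norm (C\<^sup>2 * (norm (v x))\<^sup>2)"
      using assms(3)
    proof eventually_elim
      case (elim x)
      from power_mono[OF this norm_ge_zero, of 2] show ?case by (simp add: power_mult_distrib)
    qed
  qed
  then show ?thesis using assms(1) by (simp add: sqint_def)
qed

lemma l2_mono:
  fixes u :: "'a \<Rightarrow> 'b::euclidean_space" and v :: "'a \<Rightarrow> 'c::euclidean_space"
  assumes "u \<in> borel_measurable M" "sqint M v" "AE x in M. norm (u x) \<le> C * norm (v x)" "0 \<le> C"
  shows "l2 M u \<le> C * l2 M v"
proof -
  have "(\<integral>x. (norm (u x))\<^sup>2 \<partial>M) \<le> (\<integral>x. C\<^sup>2 * (norm (v x))\<^sup>2 \<partial>M)"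
  proof (rule integral_mono_AE)
    show "integrable M (\<lambda>x. (norm (u x))\<^sup>2)"
      using sqint_bound[OF assms(1-3)] by (rule sqintD)
    show "integrable M (\<lambda>x. C\<^sup>2 * (norm (v x))\<^sup>2)" using sqintD[OF assms(2)] by simp
    show "AE x in M. (norm (u x))\<^sup>2 \<le> C\<^sup>2 * (norm (v x))\<^sup>2"
      using assms(3)
    proof eventually_elim
      case (elim x)
      from power_mono[OF this norm_ge_zero, of 2] show ?case by (simp add: power_mult_distrib)
    qed
  qed
  then have "(l2 M u)\<^sup>2 \<le> (C * l2 M v)\<^sup>2" by (simp add: l2_sq power_mult_distrib)
  then show ?thesis by (rule power2_le_imp_le) (simp add: assms(4))
qed

lemma l2_cong_AE:
  assumes "AE x in M. u x = v x" "u \<in> borel_measurable M" "v \<in> borel_measurable M"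
  shows "l2 M u = l2 M v"
proof -
  have "(\<integral>x. (norm (u x))\<^sup>2 \<partial>M) = (\<integral>x. (norm (v x))\<^sup>2 \<partial>M)"
    by (rule integral_cong_AE) (use assms in auto)
  then show ?thesis by (simp add: l2_def)
qed

lemma l2_norm_cong:
  assumes "\<And>x. x \<in> space M \<Longrightarrow> norm (u x) = norm (v x)"
  shows "l2 M u = l2 M v"
proof -
  have "(\<integral>x. (norm (u x))\<^sup>2 \<partial>M) = (\<integral>x. (norm (v x))\<^sup>2 \<partial>M)"
    by (rule Bochner_Integration.integral_cong) (auto simp: assms)
  then show ?thesis by (simp add: l2_def)
qed

lemma sqint_scaleR:
  assumes "sqint M u" shows "sqint M (\<lambda>x. c *\<^sub>R u x)"
  by (rule sqint_bound[OF _ assms, where C="\<bar>c\<bar>"]) (use assms in \<open>auto simp: sqint_def\<close>)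

lemma sqint_bounded_linear:
  fixes T :: "'b::euclidean_space \<Rightarrow> 'c::euclidean_space"
  assumes "sqint M u" "bounded_linear T" shows "sqint M (\<lambda>x. T (u x))"
proof -
  obtain K where K: "\<And>x. norm (T x) \<le> norm x * K" using bounded_linear.bounded[OF assms(2)] by blast
  have "T \<in> borel_measurable borel"
    by (simp add: assms(2) borel_measurable_continuous_onI linear_continuous_on)
  then have m: "(\<lambda>x. T (u x)) \<in> borel_measurable M"
    using sqintD[OF assms(1)] by measurable
  show ?thesis by (rule sqint_bound[OF m assms(1), where C=K]) (use K in \<open>auto simp: mult.commute\<close>)
qed

text \<open>The constant is a pointwise operator bound, so it depends on neither the measure nor the
  function. This order of quantifiers matters when one linear map is applied to a whole
  sequence.\<close>

lemma l2_bounded_linear: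
  fixes T :: "'b::euclidean_space \<Rightarrow> 'c::euclidean_space"
  assumes "bounded_linear T" shows "\<exists>K\<ge>0. \<forall>M. \<forall>u::'a\<Rightarrow>_. sqint M u \<longrightarrow> l2 M (\<lambda>x. T (u x)) \<le> K * l2 M u"
proof -
  obtain K where K: "\<And>x. norm (T x) \<le> norm x * K" "K \<ge> 0" using bounded_linear.nonneg_bounded[OF assms(1)] by blast
  have "l2 M (\<lambda>x. T (u x)) \<le> K * l2 M u" if "sqint M u" for M and u :: "'a \<Rightarrow> 'b"
    by (rule l2_mono[OF sqintD(1)[OF sqint_bounded_linear[OF that assms]] that])
       (use K in \<open>auto simp: mult.commute\<close>)
  then show ?thesis using K(2) by blast
qed

lemma norm_add_sq_le: "(norm (a + b))\<^sup>2 \<le> 2 * (norm a)\<^sup>2 + 2 * (norm (b::'b::real_normed_vector))\<^sup>2"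
proof -
  have "(norm (a + b))\<^sup>2 \<le> (norm a + norm b)\<^sup>2"
    by (simp add: norm_triangle_ineq power_mono)
  also have "\<dots> \<le> 2 * (norm a)\<^sup>2 + 2 * (norm b)\<^sup>2"
    using sum_squares_bound[of "norm a" "norm b"] by (simp add: power2_sum)
  finally show ?thesis .
qed

lemma sqint_add:
  assumes "sqint M u" "sqint M v" shows "sqint M (\<lambda>x. u x + v x)"
proof -
  have m: "(\<lambda>x. u x + v x) \<in> borel_measurable M"
    using sqintD[OF assms(1)] sqintD[OF assms(2)] by measurable
  have "integrable M (\<lambda>x. (norm (u x + v x))\<^sup>2)"
  proof (rule Bochner_Integration.integrable_bound)
    show "integrable M (\<lambda>x. 2 * (norm (u x))\<^sup>2 + 2 * (norm (v x))\<^sup>2)"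
      using sqintD[OF assms(1)] sqintD[OF assms(2)] by simp
  qed (use m norm_add_sq_le in \<open>auto\<close>)
  then show ?thesis using m by (simp add: sqint_def)
qed

lemma sqint_diff:
  assumes "sqint M u" "sqint M v" shows "sqint M (\<lambda>x. u x - v x)"
  using sqint_add[OF assms(1) sqint_scaleR[OF assms(2), of "-1"]] by simp

lemma sqint_integrable_inner:
  assumes "sqint M u" "sqint M v" shows "integrable M (\<lambda>x. u x \<bullet> v x)"
proof (rule Bochner_Integration.integrable_bound)
  show "integrable M (\<lambda>x. (norm (u x))\<^sup>2 + (norm (v x))\<^sup>2)"
    using sqintD[OF assms(1)] sqintD[OF assms(2)] by simp
  show "(\<lambda>x. u x \<bullet> v x) \<in> borel_measurable M"
    using sqintD[OF assms(1)] sqintD[OF assms(2)] by measurable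
  have "\<bar>u x \<bullet> v x\<bar> \<le> (norm (u x))\<^sup>2 + (norm (v x))\<^sup>2" for x
  proof -
    have "\<bar>u x \<bullet> v x\<bar> \<le> norm (u x) * norm (v x)" by (rule Cauchy_Schwarz_ineq2)
    also have "\<dots> \<le> (norm (u x))\<^sup>2 + (norm (v x))\<^sup>2"
      using sum_squares_bound[of "norm (u x)" "norm (v x)"] mult_nonneg_nonneg[OF norm_ge_zero[of "u x"] norm_ge_zero[of "v x"]] by linarith
    finally show ?thesis .
  qed
  then show "AE x in M. norm (u x \<bullet> v x) \<le> norm ((norm (u x))\<^sup>2 + (norm (v x))\<^sup>2)"
    by auto
qed

text \<open>Used twice: for the Cauchy-Schwarz inequality, and with \<open>p = 0\<close>, where it
  forces \<open>q = 0\<close>, for the vanishing of the first variation at a minimiser. For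
  \<open>r > 0\<close> the vertex \<open>t = -q/r\<close> gives the inequality; the other signs of
  \<open>r\<close> are degenerate or impossible.\<close>

lemma discriminant_nonpos:
  fixes p q r :: real
  assumes "\<And>t. 0 \<le> p + 2 * t * q + t\<^sup>2 * r" shows "q\<^sup>2 \<le> p * r"
proof (cases "r = 0")
  case True
  have "q = 0"
  proof (rule ccontr)
    assume "q \<noteq> 0"
    \<comment> \<open>For \<open>r = 0\<close> the polynomial is affine; this is the point where it
      takes the value -1.\<close>
    then have "p + 2 * (-(p+1)/(2*q)) * q = -1" by (simp add: field_simps)
    then show False using assms[of "-(p+1)/(2*q)"] True by simp
  qed
  then show ?thesis using True by simp
next
  case False
  have "r > 0"
  proof (rule ccontr)
    assume "\<not> r > 0"
    then have r: "r < 0" using False by simp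
    \<comment> \<open>This \<open>t\<close> brings \<open>t * r\<close> below
      \<open>- \<bar>p\<bar> - 2 * \<bar>q\<bar>\<close>, and being at least 1 it allows
      \<open>p \<le> t * \<bar>p\<bar>\<close>; together they make the polynomial negative.\<close>
    define t where "t = (\<bar>p\<bar> + 2 * \<bar>q\<bar> + 1) / (-r) + 1"
    have t1: "t \<ge> 1" using r by (simp add: t_def divide_nonneg_neg)
    have "t * (-r) = (\<bar>p\<bar> + 2 * \<bar>q\<bar> + 1) + (-r)" using r by (simp add: t_def field_simps)
    then have "t * r < - \<bar>p\<bar> - 2 * \<bar>q\<bar> " using r by linarith
    then have "t * (t * r) < t * (- \<bar>p\<bar> - 2 * \<bar>q\<bar>)" using t1 by (simp add: mult_strict_left_mono)
    moreover have "t * q \<le> t * \<bar>q\<bar>" using t1 by (simp add: mult_left_mono)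
    moreover have "p \<le> t * \<bar>p\<bar>" using t1 mult_right_mono[of 1 t "\<bar>p\<bar>"] by simp
    ultimately have "p + 2 * t * q + t\<^sup>2 * r < 0" by (simp add: power2_eq_square algebra_simps)
    then show False using assms[of t] by simp
  qed
  have "0 \<le> p + 2 * (-q/r) * q + (-q/r)\<^sup>2 * r" by (rule assms)
  also have "\<dots> = p - q\<^sup>2 / r" using False by (simp add: power2_eq_square)
  finally show ?thesis using \<open>r > 0\<close> by (simp add: field_simps)
qed

lemma norm_add_scaleR_sq:
  "(norm (a + t *\<^sub>R b))\<^sup>2 = (norm a)\<^sup>2 + 2 * t * (a \<bullet> b) + t\<^sup>2 * (norm (b::'b::real_inner))\<^sup>2"
  unfolding power2_norm_eq_inner
  by (simp add: inner_add_left inner_add_right inner_commute power2_eq_square algebra_simps)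

lemma l2_add_scaleR_sq:
  assumes "sqint M u" "sqint M v"
  shows "(l2 M (\<lambda>x. u x + t *\<^sub>R v x))\<^sup>2 = (l2 M u)\<^sup>2 + 2 * t * (\<integral>x. u x \<bullet> v x \<partial>M) + t\<^sup>2 * (l2 M v)\<^sup>2"
  unfolding l2_sq norm_add_scaleR_sq
  using sqintD(2)[OF assms(1)] sqintD(2)[OF assms(2)] sqint_integrable_inner[OF assms] by simp

lemma l2_Cauchy_Schwarz:
  assumes "sqint M u" "sqint M v"
  shows "\<bar>\<integral>x. u x \<bullet> v x \<partial>M\<bar> \<le> l2 M u * l2 M v"
proof -
  have "(\<integral>x. u x \<bullet> v x \<partial>M)\<^sup>2 \<le> (l2 M u)\<^sup>2 * (l2 M v)\<^sup>2"
    by (rule discriminant_nonpos) (simp flip: l2_add_scaleR_sq[OF assms])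
  then have "\<bar>\<integral>x. u x \<bullet> v x \<partial>M\<bar>\<^sup>2 \<le> (l2 M u * l2 M v)\<^sup>2"
    by (simp add: power_mult_distrib)
  then show ?thesis by (rule power2_le_imp_le) simp
qed

lemma l2_triangle:
  assumes "sqint M u" "sqint M v"
  shows "l2 M (\<lambda>x. u x + v x) \<le> l2 M u + l2 M v"
proof -
  have "(l2 M (\<lambda>x. u x + v x))\<^sup>2 \<le> (l2 M u + l2 M v)\<^sup>2"
    using l2_add_scaleR_sq[OF assms, of 1] l2_Cauchy_Schwarz[OF assms]
    by (simp add: power2_sum)
  then show ?thesis by (rule power2_le_imp_le) simp
qed

lemma l2_scaleR: "l2 M (\<lambda>x. c *\<^sub>R u x) = \<bar>c\<bar> * l2 M u"
  by (simp add: l2_def power_mult_distrib real_sqrt_mult)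

lemma l2_minus_commute: "l2 M (\<lambda>x. u x - v x) = l2 M (\<lambda>x. v x - u x)"
  by (simp add: l2_def norm_minus_commute)

lemma l2_triangle3:
  assumes "sqint M u" "sqint M v" "sqint M w"
  shows "l2 M (\<lambda>x. u x - w x) \<le> l2 M (\<lambda>x. u x - v x) + l2 M (\<lambda>x. v x - w x)"
  using l2_triangle[OF sqint_diff[OF assms(1,2)] sqint_diff[OF assms(2,3)]] by simp

lemma l2_eq_0:
  assumes "sqint M u" "l2 M u = 0" shows "AE x in M. u x = 0"
proof -
  have "(\<integral>x. (norm (u x))\<^sup>2 \<partial>M) = 0" using assms(2) l2_sq[of M u] by simp
  then have "AE x in M. (norm (u x))\<^sup>2 = 0"
    using integral_nonneg_eq_0_iff_AE[OF sqintD(2)[OF assms(1)]] by simp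
  then show ?thesis by simp
qed

section \<open>Square integrability from nonnegative integrals, and completeness\<close>

lemma nn_integral_l2:
  assumes "sqint M u" shows "(\<integral>\<^sup>+x. ennreal ((norm (u x))\<^sup>2) \<partial>M) = ennreal ((l2 M u)\<^sup>2)"
  using nn_integral_eq_integral[OF sqintD(2)[OF assms]] by (simp add: l2_sq)

text \<open>Lets square integrability come out of a bound on a nonnegative integral. Fatou's lemma,
  the trace inequality and the summation over cells all end in this form, before integrability is
  known.\<close>

lemma sqint_nn_integral:
  assumes "u \<in> borel_measurable M" "(\<integral>\<^sup>+x. ennreal ((norm (u x))\<^sup>2) \<partial>M) \<le> ennreal (c\<^sup>2)" "c \<ge> 0"
  shows "sqint M u" "l2 M u \<le> c"
proof -
  have "integrable M (\<lambda>x. (norm (u x))\<^sup>2)"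
  proof (rule integrableI_bounded)
    show "(\<integral>\<^sup>+x. ennreal (norm ((norm (u x))\<^sup>2)) \<partial>M) < \<infinity>"
      using le_less_trans[OF assms(2) ennreal_less_top] by simp
  qed (use assms(1) in measurable)
  then show s: "sqint M u" using assms by (simp add: sqint_def)
  have "ennreal ((l2 M u)\<^sup>2) \<le> ennreal (c\<^sup>2)" using assms nn_integral_l2[OF s] by simp
  then have "(l2 M u)\<^sup>2 \<le> c\<^sup>2" by simp
  then show "l2 M u \<le> c" by (rule power2_le_imp_le) (rule assms(3))
qed

lemma sqint_const: "finite_measure M \<Longrightarrow> sqint M (\<lambda>x. c)"
  by (simp add: sqint_def finite_measure.integrable_const)

text \<open>Riesz-Fischer. Along a rapidly Cauchy subsequence the increments have summable L2 norms;
  on a finite measure space their L1 norms are summable too, so the telescoping series converges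
  absolutely almost everywhere. Fatou's lemma turns the Cauchy estimate into L2 convergence of the
  whole sequence.\<close>

lemma l2_complete:
  fixes u :: "nat \<Rightarrow> 'a \<Rightarrow> 'b::euclidean_space"
  assumes fin: "finite_measure M" and u: "\<And>n. sqint M (u n)"
    and Cauchy: "\<And>e. e > 0 \<Longrightarrow> \<exists>N. \<forall>m\<ge>N. \<forall>n\<ge>N. l2 M (\<lambda>x. u m x - u n x) < e"
  shows "\<exists>v. sqint M v \<and> (\<lambda>n. l2 M (\<lambda>x. u n x - v x)) \<longlonglongrightarrow> 0"
proof -
  have [measurable]: "\<And>n. u n \<in> borel_measurable M" using u by (simp add: sqint_def)
  have "\<exists>N. \<forall>m\<ge>N. \<forall>n\<ge>N. l2 M (\<lambda>x. u m x - u n x) < (1/2)^k" for k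
    by (rule Cauchy) simp
  then obtain N where N: "\<And>k m n. m \<ge> N k \<Longrightarrow> n \<ge> N k \<Longrightarrow> l2 M (\<lambda>x. u m x - u n x) < (1/2)^k"
    by metis
  \<comment> \<open>Partial sums of \<open>N\<close> are used so that \<open>s j\<close> dominates
    \<open>N k\<close> for every \<open>k \<le> j\<close>.\<close>
  define s where "s = (\<lambda>k. \<Sum>i\<le>k. N i)"
  have sN: "N k \<le> s j" if "k \<le> j" for k j
    unfolding s_def using that by (intro member_le_sum) auto
  define d where "d = (\<lambda>k x. u (s (Suc k)) x - u (s k) x)"
  have sd: "sqint M (d k)" for k unfolding d_def by (intro sqint_diff u)
  then have [measurable]: "\<And>n. d n \<in> borel_measurable M" by (simp add: sqint_def)
  have dl: "l2 M (d k) \<le> (1/2)^k" for k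
    unfolding d_def using N[OF sN[of k "Suc k"] sN[of k k]] by simp
  let ?c = "l2 M (\<lambda>x. 1::real)"
  have d1: "integrable M (\<lambda>x. norm (d k x))" "(\<integral>x. norm (d k x) \<partial>M) \<le> ?c * (1/2)^k" for k
  proof -
    have sn: "sqint M (\<lambda>x. norm (d k x))" 
      by (rule sqint_bound[OF _ sd[of k], where C=1]) auto
    have ln: "l2 M (\<lambda>x. norm (d k x)) = l2 M (d k)" by (rule l2_norm_cong) simp
    show "integrable M (\<lambda>x. norm (d k x))"
      using sqint_integrable_inner[OF sqint_const[OF fin, of 1] sn] by simp
    show "(\<integral>x. norm (d k x) \<partial>M) \<le> ?c * (1/2)^k"
      using l2_Cauchy_Schwarz[OF sqint_const[OF fin, of 1] sn] ln dl[of k]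
        mult_left_mono[OF dl[of k] l2_nonneg[of M "\<lambda>x. 1::real"]] by simp
  qed
  have "(\<integral>\<^sup>+x. (\<Sum>k. ennreal (norm (d k x))) \<partial>M) = (\<Sum>k. \<integral>\<^sup>+x. ennreal (norm (d k x)) \<partial>M)"
    by (rule nn_integral_suminf) auto
  also have "\<dots> \<le> (\<Sum>k. ennreal (?c * (1/2)^k))"
    using d1 by (intro suminf_le) (auto simp: nn_integral_eq_integral intro!: ennreal_leI)
  also have "\<dots> = ennreal (\<Sum>k. ?c * (1/2)^k)"
    by (rule suminf_ennreal2) (auto intro!: summable_mult summable_geometric)
  also have "\<dots> < \<infinity>" by simp
  finally have "(\<integral>\<^sup>+x. (\<Sum>k. ennreal (norm (d k x))) \<partial>M) \<noteq> \<infinity>" by simp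
  then have "AE x in M. (\<Sum>k. ennreal (norm (d k x))) \<noteq> \<infinity>"
    by (intro nn_integral_noteq_infinite) auto
  then have conv: "AE x in M. convergent (\<lambda>k. u (s k) x)"
  proof eventually_elim
    case (elim x)
    then have "summable (\<lambda>k. norm (d k x))"
      by (intro summable_suminf_not_top) auto
    then have "summable (\<lambda>k. d k x)" by (rule summable_norm_cancel)
    then have "convergent (\<lambda>n. \<Sum>k<n. d k x)" by (simp add: summable_iff_convergent)
    moreover have "(\<Sum>k<n. d k x) = u (s n) x - u (s 0) x" for n
      unfolding d_def by (induction n) auto
    ultimately have "convergent (\<lambda>n. u (s n) x - u (s 0) x)" by simp
    then obtain L where "(\<lambda>n. u (s n) x - u (s 0) x) \<longlonglongrightarrow> L" by (auto simp: convergent_def)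
    then have "(\<lambda>n. u (s n) x - u (s 0) x + u (s 0) x) \<longlonglongrightarrow> L + u (s 0) x"
      by (intro tendsto_add tendsto_const)
    then show ?case by (auto simp: convergent_def)
  qed
  \<comment> \<open>Where the subsequence diverges, \<open>lim\<close> returns some value that does
    not matter; \<open>v\<close> is measurable all the same.\<close>
  define v where "v = (\<lambda>x. lim (\<lambda>k. u (s k) x))"
  have [measurable]: "v \<in> borel_measurable M" unfolding v_def by measurable
  \<comment> \<open>Here \<open>n\<close> is fixed and the subsequence index tends to infinity:
    Fatou's lemma passes the bound for \<open>u n - u (s k)\<close> on to
    \<open>u n - v\<close>.\<close>
  have key: "sqint M (\<lambda>x. u n x - v x) \<and> l2 M (\<lambda>x. u n x - v x) \<le> (1/2)^K" if "n \<ge> s K" for n K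
  proof -
    have "(\<integral>\<^sup>+x. ennreal ((norm (u n x - v x))\<^sup>2) \<partial>M) \<le>
        (\<integral>\<^sup>+x. liminf (\<lambda>k. ennreal ((norm (u n x - u (s k) x))\<^sup>2)) \<partial>M)"
    proof (rule nn_integral_mono_AE)
      show "AE x in M. ennreal ((norm (u n x - v x))\<^sup>2) \<le> liminf (\<lambda>k. ennreal ((norm (u n x - u (s k) x))\<^sup>2))"
        using conv
      proof eventually_elim
        case (elim x)
        then have "(\<lambda>k. u (s k) x) \<longlonglongrightarrow> v x" by (simp add: v_def convergent_LIMSEQ_iff)
        then have "(\<lambda>k. ennreal ((norm (u n x - u (s k) x))\<^sup>2)) \<longlonglongrightarrow> ennreal ((norm (u n x - v x))\<^sup>2)"
          by (intro tendsto_intros tendsto_ennrealI)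
        from lim_imp_Liminf[OF trivial_limit_sequentially this] show ?case by simp
      qed
    qed
    also have "\<dots> \<le> liminf (\<lambda>k. \<integral>\<^sup>+x. ennreal ((norm (u n x - u (s k) x))\<^sup>2) \<partial>M)"
      by (rule nn_integral_liminf) measurable
    also have "\<dots> = liminf (\<lambda>k. ennreal ((l2 M (\<lambda>x. u n x - u (s k) x))\<^sup>2))"
      by (simp add: nn_integral_l2[OF sqint_diff[OF u u]])
    also have "\<dots> \<le> limsup (\<lambda>k. ennreal ((l2 M (\<lambda>x. u n x - u (s k) x))\<^sup>2))"
      by (intro Liminf_le_Limsup) auto
    also have "\<dots> \<le> ennreal (((1/2)^K)\<^sup>2)"
    proof (rule Limsup_bounded)
      show "\<forall>\<^sub>F k in sequentially. ennreal ((l2 M (\<lambda>x. u n x - u (s k) x))\<^sup>2) \<le> ennreal (((1/2)^K)\<^sup>2)"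
        using eventually_ge_at_top[of K]
      proof eventually_elim
        case (elim k)
        have "l2 M (\<lambda>x. u n x - u (s k) x) < (1/2)^K"
          by (rule N) (use sN[of K K] sN[OF elim] that in auto)
        then show ?case by (intro ennreal_leI power_mono) auto
      qed
    qed
    finally have *: "(\<integral>\<^sup>+x. ennreal ((norm (u n x - v x))\<^sup>2) \<partial>M) \<le> ennreal (((1/2)^K)\<^sup>2)" .
    show ?thesis using sqint_nn_integral[OF _ *] by simp
  qed
  have "sqint M v"
    using sqint_diff[OF u[of "s 0"] conjunct1[OF key[of 0 "s 0"]]] by simp
  moreover have "(\<lambda>n. l2 M (\<lambda>x. u n x - v x)) \<longlonglongrightarrow> 0"
  proof (rule LIMSEQ_I)
    fix r :: real assume "0 < r"
    then obtain K where "(1/2)^K < r" using real_arch_pow_inv[of r "1/2"] by auto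
    then show "\<exists>no. \<forall>n\<ge>no. norm (l2 M (\<lambda>x. u n x - v x) - 0) < r"
      using key by (intro exI[of _ "s K"]) fastforce
  qed
  ultimately show ?thesis by blast
qed

section \<open>Bump functions\<close>

text \<open>Derivatives are asserted to exist rather than computed by an operator, so closure under
  sums, products and affine substitutions is an induction that exhibits the derivative.\<close>

primrec Ck :: "nat \<Rightarrow> (real \<Rightarrow> real) \<Rightarrow> bool" where
  "Ck 0 h = True"
| "Ck (Suc k) h = (\<exists>h'. (\<forall>t. (h has_real_derivative h' t) (at t)) \<and> Ck k h')"

definition Cinf :: "(real \<Rightarrow> real) \<Rightarrow> bool" where "Cinf h \<longleftrightarrow> (\<forall>k. Ck k h)"

lemma Ck_Suc_imp: "Ck (Suc k) h \<Longrightarrow> Ck k h"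
proof (induction k arbitrary: h)
  case (Suc k)
  from Suc.prems obtain h' where "\<forall>t. (h has_real_derivative h' t) (at t)" "Ck (Suc k) h'" by auto
  then show ?case using Suc.IH by auto
qed simp

lemma Ck_add: "Ck k f \<Longrightarrow> Ck k g \<Longrightarrow> Ck k (\<lambda>t. f t + g t)"
proof (induction k arbitrary: f g)
  case (Suc k)
  from Suc.prems obtain f' g' where "\<forall>t. (f has_real_derivative f' t) (at t)" "Ck k f'"
     "\<forall>t. (g has_real_derivative g' t) (at t)" "Ck k g'" by auto
  then show ?case using Suc.IH[of f' g']
    by (auto intro!: exI[of _ "\<lambda>t. f' t + g' t"] derivative_intros)
qed simp

lemma Ck_mult: "Ck k f \<Longrightarrow> Ck k g \<Longrightarrow> Ck k (\<lambda>t. f t * g t)"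
proof (induction k arbitrary: f g)
  case (Suc k)
  from Suc.prems obtain f' g' where d: "\<forall>t. (f has_real_derivative f' t) (at t)" "Ck k f'"
     "\<forall>t. (g has_real_derivative g' t) (at t)" "Ck k g'" by auto
  have "Ck k (\<lambda>t. f' t * g t + f t * g' t)"
    using Suc.IH[of f' g] Suc.IH[of f g'] Ck_Suc_imp[OF Suc.prems(1)] Ck_Suc_imp[OF Suc.prems(2)] d
    by (intro Ck_add) auto
  moreover have "\<forall>t. ((\<lambda>t. f t * g t) has_real_derivative (f' t * g t + f t * g' t)) (at t)"
    using d by (auto intro!: derivative_eq_intros)
  ultimately show ?case by auto
qed simp

lemma Ck_const: "Ck k (\<lambda>t. c)"
proof (induction k arbitrary: c)
  case (Suc k)
  then show ?case by (auto intro!: exI[of _ "\<lambda>t. 0"])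
qed simp

lemma Ck_affine: "Ck k f \<Longrightarrow> Ck k (\<lambda>t. f (c * t + d))"
proof (induction k arbitrary: f)
  case (Suc k)
  from Suc.prems obtain f' where d: "\<And>t. (f has_real_derivative f' t) (at t)" "Ck k f'" by auto
  have "((\<lambda>t. f (c * t + d)) has_real_derivative c * f' (c * t + d)) (at t)" for t
  proof -
    have "((\<lambda>t. c * t + d) has_real_derivative c) (at t)"
      by (auto intro!: derivative_eq_intros)
    from DERIV_chain2[OF d(1) this] show ?thesis by (simp add: mult.commute)
  qed
  moreover have "Ck k (\<lambda>t. c * f' (c * t + d))"
    using Ck_mult[OF Ck_const Suc.IH[OF d(2)]] by simp
  ultimately show ?case by (auto intro!: exI[of _ "\<lambda>t. c * f' (c * t + d)"])
qed simp

text \<open>The functions \<open>flat q\<close> are closed under differentiation, by \<open>q \<mapsto> X\<^sup>2 (q - q')\<close>; the case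
  \<open>q = 1\<close> is the usual flat function \<open>exp (-1/t)\<close>.\<close>

definition flat :: "real poly \<Rightarrow> real \<Rightarrow> real" where
  "flat q t = (if t > 0 then poly q (1/t) * exp (-1/t) else 0)"

lemma poly_div_exp_tendsto_0: "((\<lambda>y. poly q y / exp y) \<longlongrightarrow> (0::real)) at_top"
proof -
  have "((\<lambda>y. \<Sum>i\<le>degree q. coeff q i * (y ^ i / exp y)) \<longlongrightarrow> (\<Sum>i\<le>degree q. coeff q i * 0)) at_top"
    by (intro tendsto_intros tendsto_power_div_exp_0)
  then show ?thesis by (simp add: poly_altdef sum_divide_distrib)
qed

lemma flat_tendsto_0: "(flat q \<longlongrightarrow> 0) (at 0)"
proof -
  have "((\<lambda>t. flat q t) \<longlongrightarrow> 0) (at_left 0)"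
    by (rule tendsto_eventually) (auto simp: flat_def eventually_at_filter)
  moreover have "((\<lambda>t. flat q t) \<longlongrightarrow> 0) (at_right 0)"
  proof -
    have "((\<lambda>t. poly q (inverse t) / exp (inverse t)) \<longlongrightarrow> 0) (at_right (0::real))"
      by (rule filterlim_compose[OF poly_div_exp_tendsto_0 filterlim_inverse_at_top_right])
    moreover have "\<forall>\<^sub>F t in at_right 0. poly q (inverse t) / exp (inverse t) = flat q t"
      by (auto simp: flat_def eventually_at_filter exp_minus field_simps)
    ultimately show ?thesis by (rule Lim_transform_eventually)
  qed
  ultimately show ?thesis by (simp add: filterlim_split_at)
qed

lemma flat_deriv: "(flat q has_real_derivative flat ([:0,0,1:] * (q - pderiv q)) t) (at t)"
proof -
  consider "t > 0" | "t < 0" | "t = 0" by linarith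
  then show ?thesis
  proof cases
    case 1
    have "((\<lambda>t. poly q (1/t) * exp (-1/t)) has_real_derivative
      poly (pderiv q) (1/t) * (-1/t^2) * exp (-1/t) + poly q (1/t) * (exp (-1/t) * (1/t^2))) (at t)"
    proof -
      have a: "((\<lambda>t. 1/t) has_real_derivative (-1/t^2)) (at t)"
        using 1 by (auto intro!: derivative_eq_intros simp: power2_eq_square)
      have b: "((\<lambda>t. exp (-1/t)) has_real_derivative (exp (-1/t) * (1/t^2))) (at t)"
        using 1 by (auto intro!: derivative_eq_intros simp: power2_eq_square)
      show ?thesis
        using DERIV_mult[OF DERIV_chain2[OF poly_DERIV a] b] by (simp add: algebra_simps)
    qed
    moreover have "poly (pderiv q) (1/t) * (-1/t^2) * exp (-1/t) + poly q (1/t) * (exp (-1/t) * (1/t^2))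
      = flat ([:0,0,1:] * (q - pderiv q)) t"
      using 1 by (simp add: flat_def field_simps power2_eq_square)
    ultimately have "((\<lambda>t. poly q (1/t) * exp (-1/t)) has_real_derivative
       flat ([:0,0,1:] * (q - pderiv q)) t) (at t)" by simp
    then show ?thesis
      by (rule has_field_derivative_transform_within_open[of _ _ _ "{0<..}"])
         (use 1 in \<open>auto simp: flat_def\<close>)
  next
    case 2
    have "((\<lambda>t. 0) has_real_derivative flat ([:0,0,1:] * (q - pderiv q)) t) (at t)"
      using 2 by (simp add: flat_def)
    then show ?thesis
      by (rule has_field_derivative_transform_within_open[of _ _ _ "{..<0}"])
         (use 2 in \<open>auto simp: flat_def\<close>)
  next
    case 3
    \<comment> \<open>At 0 the difference quotient of \<open>flat q\<close> is itself a flat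
      function: division by \<open>h\<close> adds one power of \<open>1/h\<close> to the polynomial
      part.\<close>
    have "((\<lambda>h. flat ([:0,1:] * q) h) \<longlongrightarrow> 0) (at 0)" by (rule flat_tendsto_0)
    moreover have "\<forall>\<^sub>F h in at 0. flat ([:0,1:] * q) h = (flat q (0 + h) - flat q 0) / h"
      by (auto simp: flat_def eventually_at_filter field_simps)
    ultimately have "((\<lambda>h. (flat q (0 + h) - flat q 0) / h) \<longlongrightarrow> 0) (at 0)"
      by (rule Lim_transform_eventually)
    then show ?thesis using 3 by (simp add: DERIV_def flat_def)
  qed
qed

lemma Ck_flat: "Ck k (flat q)"
proof (induction k arbitrary: q)
  case (Suc k)
  then show ?case using flat_deriv by auto
qed simp

text \<open>Each order supplies its own derivative; uniqueness of derivatives identifies them, so a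
  single function serves all orders.\<close>

lemma Cinf_deriv:
  assumes "Cinf h"
  shows "\<exists>h'. (\<forall>t. (h has_real_derivative h' t) (at t)) \<and> Cinf h'"
proof -
  have "\<exists>h'. (\<forall>t. (h has_real_derivative h' t) (at t)) \<and> Ck k h'" for k
    using assms unfolding Cinf_def by (metis Ck.simps(2))
  then obtain H where H: "\<And>k t. (h has_real_derivative H k t) (at t)" "\<And>k. Ck k (H k)" by metis
  have "H k = H 0" for k using H(1) DERIV_unique by blast
  then show ?thesis using H unfolding Cinf_def by metis
qed

text \<open>The factor \<open>n\<close> stretches the distance to the endpoints: as \<open>n\<close>
  grows, \<open>flat 1 (n * s)\<close> tends to 1 for positive \<open>s\<close> and stays 0
  otherwise, so the product tends to the indicator of the open interval.\<close>

definition flatbump :: "real \<Rightarrow> real \<Rightarrow> real \<Rightarrow> real \<Rightarrow> real" where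
  "flatbump n a b t = flat 1 (n * (t - a)) * flat 1 (n * (b - t))"

lemma Cinf_flatbump: "Cinf (flatbump n a b)"
proof -
  have eq: "flatbump n a b = (\<lambda>t. flat 1 (n * t + (- n * a)) * flat 1 ((-n) * t + n * b))"
    by (simp add: flatbump_def fun_eq_iff algebra_simps)
  show ?thesis unfolding Cinf_def eq by (intro allI Ck_mult Ck_affine Ck_flat)
qed

lemma flat_one: "flat 1 t = (if t > 0 then exp (-1/t) else 0)" by (simp add: flat_def)

lemma flat_one_bounds: "0 \<le> flat 1 t" "flat 1 t \<le> 1"
  by (auto simp: flat_one divide_nonpos_nonneg)

lemma flatbump_bounds: "0 \<le> flatbump n a b t" "flatbump n a b t \<le> 1"
  using flat_one_bounds by (auto simp: flatbump_def intro: mult_le_one)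

lemma flatbump_eq_0: "0 \<le> n \<Longrightarrow> \<not> (a < t \<and> t < b) \<Longrightarrow> flatbump n a b t = 0"
  by (auto simp: flatbump_def flat_one zero_less_mult_iff)

lemma flatbump_tendsto:
  "(\<lambda>n. flatbump (real n) a b t) \<longlonglongrightarrow> (if a < t \<and> t < b then 1 else 0)"
proof (cases "a < t \<and> t < b")
  case True
  have *: "(\<lambda>n. flat 1 (real n * c)) \<longlonglongrightarrow> 1" if "c > 0" for c
  proof -
    have "(\<lambda>n. exp (- (1/c) * (1 / real n))) \<longlonglongrightarrow> exp (- (1/c) * 0)"
      by (intro tendsto_intros lim_1_over_n)
    moreover have "\<forall>\<^sub>F n in sequentially. exp (- (1/c) * (1 / real n)) = flat 1 (real n * c)"
      using eventually_gt_at_top[of 0]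
      by eventually_elim (use that in \<open>auto simp: flat_one mult.commute\<close>)
    ultimately show ?thesis using Lim_transform_eventually by fastforce
  qed
  show ?thesis unfolding flatbump_def
    using tendsto_mult[OF *[of "t - a"] *[of "b - t"]] True by simp
next
  case False
  then have "flatbump (real n) a b t = 0" for n by (intro flatbump_eq_0) auto
  moreover have "(if a < t \<and> t < b then 1 else 0) = (0::real)" using False by simp
  ultimately show ?thesis by simp
qed

subsection \<open>Iterated partial derivatives\<close>

lemma partial_eqI: "(f has_derivative f') (at x) \<Longrightarrow> partial i f x = f' (axis i 1)"
  unfolding partial_def by (metis frechet_derivative_at)

lemma smooth_differentiable: "smooth f \<Longrightarrow> f differentiable (at x)"
  unfolding smooth_def by (metis iter_partial.simps(1))

lemma iter_partial_append: "iter_partial (xs @ ys) f = iter_partial xs (iter_partial ys f)"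
  by (induction xs) auto

lemma smooth_iter_partial: "smooth f \<Longrightarrow> smooth (iter_partial xs f)"
  unfolding smooth_def by (metis iter_partial_append)

lemma smooth_partial: "smooth f \<Longrightarrow> smooth (partial i f)"
  using smooth_iter_partial[of f "[i]"] by simp

lemma smooth_continuous: "smooth f \<Longrightarrow> continuous_on S f"
  by (meson smooth_differentiable continuous_at_imp_continuous_on differentiable_imp_continuous_within)

lemma smooth_has_derivative: "smooth f \<Longrightarrow> (f has_derivative frechet_derivative f (at x)) (at x)"
  by (meson smooth_differentiable frechet_derivative_works)

lemma partial_lincomb:
  assumes "f differentiable (at x)" "g differentiable (at x)"
  shows "partial i (\<lambda>x. c * f x + d * g x) x = c * partial i f x + d * partial i g x"
proof -
  have f: "(f has_derivative frechet_derivative f (at x)) (at x)"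
    using assms(1) by (simp add: frechet_derivative_works)
  have g: "(g has_derivative frechet_derivative g (at x)) (at x)"
    using assms(2) by (simp add: frechet_derivative_works)
  show ?thesis
    using partial_eqI[OF has_derivative_add[OF has_derivative_mult_right[OF f, of c] has_derivative_mult_right[OF g, of d]], of i]
    by (simp add: partial_def)
qed

lemma iter_partial_lincomb:
  assumes "smooth f" "smooth g"
  shows "iter_partial xs (\<lambda>x. c * f x + d * g x) = (\<lambda>x. c * iter_partial xs f x + d * iter_partial xs g x)"
proof (induction xs)
  case (Cons i xs)
  have "iter_partial xs f differentiable (at x)" "iter_partial xs g differentiable (at x)" for x
    using assms by (auto simp: smooth_def)
  then show ?case
    by (simp only: iter_partial.simps Cons.IH fun_eq_iff partial_lincomb simp_thms)
qed simp

lemma smooth_lincomb: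
  assumes "smooth f" "smooth g" shows "smooth (\<lambda>x. c * f x + d * g x)"
  unfolding smooth_def iter_partial_lincomb[OF assms]
  using assms by (auto simp: smooth_def intro!: differentiable_add differentiable_mult differentiable_const)

text \<open>A partial derivative of a product of one-variable functions replaces one factor by its
  derivative and stays in the class. Induction on the list of directions leaves only the
  differentiability of such products to check.\<close>

lemma smooth_prod_Cinf:
  fixes h :: "'d::finite \<Rightarrow> real \<Rightarrow> real"
  assumes "\<And>i. Cinf (h i)" shows "smooth (\<lambda>x::real^'d. \<Prod>i\<in>UNIV. h i (x $ i))"
proof -
  have der: "((\<lambda>x::real^'d. \<Prod>i\<in>UNIV. g i (x $ i)) has_derivative
         (\<lambda>y. \<Sum>i\<in>UNIV. (g' i (x $ i) * y $ i) * (\<Prod>j\<in>UNIV - {i}. g j (x $ j)))) (at x)"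
    if "\<And>i t. (g i has_real_derivative g' i t) (at t)" for g g' :: "'d \<Rightarrow> real \<Rightarrow> real" and x
  proof (rule has_derivative_prod)
    fix i :: 'd assume "i \<in> UNIV"
    have "((\<lambda>x. x $ i) has_derivative (\<lambda>y. y $ i)) (at x)"
      by (rule bounded_linear.has_derivative[OF bounded_linear_vec_nth has_derivative_ident])
    from has_derivative_compose[OF this that[of i "x $ i", unfolded has_field_derivative_def]]
    show "((\<lambda>x. g i (x $ i)) has_derivative (\<lambda>y. g' i (x $ i) * y $ i)) (at x)" .
  qed
  have it: "\<exists>g. (\<forall>i. Cinf (g i)) \<and> iter_partial xs (\<lambda>x::real^'d. \<Prod>i\<in>UNIV. h i (x $ i)) = (\<lambda>x. \<Prod>i\<in>UNIV. g i (x $ i))" for xs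
  proof (induction xs)
    case Nil
    then show ?case using assms by auto
  next
    case (Cons k xs)
    then obtain g where g: "\<And>i. Cinf (g i)"
      "iter_partial xs (\<lambda>x::real^'d. \<Prod>i\<in>UNIV. h i (x $ i)) = (\<lambda>x. \<Prod>i\<in>UNIV. g i (x $ i))" by auto
    obtain g' where g': "\<And>i t. (g i has_real_derivative g' i t) (at t)" "\<And>i. Cinf (g' i)"
      using Cinf_deriv[OF g(1)] by metis
    have "partial k (\<lambda>x. \<Prod>i\<in>UNIV. g i (x $ i)) x = (\<Prod>i\<in>UNIV. (g(k := g' k)) i (x $ i))" for x
    proof -
      have "partial k (\<lambda>x. \<Prod>i\<in>UNIV. g i (x $ i)) x
        = (\<Sum>i\<in>UNIV. (g' i (x $ i) * axis k 1 $ i) * (\<Prod>j\<in>UNIV - {i}. g j (x $ j)))"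
        by (rule partial_eqI[OF der[of g g', OF g'(1)]])
      also have "\<dots> = (\<Sum>i\<in>UNIV. if i = k then g' k (x $ k) * (\<Prod>j\<in>UNIV - {k}. g j (x $ j)) else 0)"
        by (rule sum.cong) (auto simp: axis_def)
      also have "\<dots> = g' k (x $ k) * (\<Prod>j\<in>UNIV - {k}. g j (x $ j))" by simp
      also have "(\<Prod>j\<in>UNIV - {k}. g j (x $ j)) = (\<Prod>j\<in>UNIV - {k}. (g(k := g' k)) j (x $ j))"
        by (rule prod.cong) auto
      also have "g' k (x $ k) * \<dots> = (\<Prod>i\<in>UNIV. (g(k := g' k)) i (x $ i))"
        by (subst prod.remove[of UNIV k]) auto
      finally show ?thesis .
    qed
    then have "iter_partial (k # xs) (\<lambda>x::real^'d. \<Prod>i\<in>UNIV. h i (x $ i))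
        = (\<lambda>x. \<Prod>i\<in>UNIV. (g(k := g' k)) i (x $ i))"
      by (simp only: iter_partial.simps g(2) fun_eq_iff simp_thms)
    moreover have "\<forall>i. Cinf ((g(k := g' k)) i)" using g(1) g'(2) by simp
    ultimately show ?case by blast
  qed
  have df: "(\<lambda>x::real^'d. \<Prod>i\<in>UNIV. g i (x $ i)) differentiable (at x)"
    if g: "\<And>i. Cinf (g i)" for g x
  proof -
    obtain g' where "\<And>i t. (g i has_real_derivative g' i t) (at t)"
      using Cinf_deriv[OF g] by metis
    from der[of g g', OF this] show ?thesis unfolding differentiable_def by blast
  qed
  show ?thesis unfolding smooth_def
  proof (intro allI)
    fix xs x
    obtain g where g: "\<And>i. Cinf (g i)"
      and eq: "iter_partial xs (\<lambda>x::real^'d. \<Prod>i\<in>UNIV. h i (x $ i)) = (\<lambda>x. \<Prod>i\<in>UNIV. g i (x $ i))"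
      using it by blast
    show "iter_partial xs (\<lambda>x::real^'d. \<Prod>i\<in>UNIV. h i (x $ i)) differentiable (at x)"
      unfolding eq by (rule df) (rule g)
  qed
qed

text \<open>As \<open>n\<close> grows, these bumps converge boundedly to the indicator of the box, so that testing
  against them determines integrals over boxes and no mollification is needed.\<close>

definition bump :: "nat \<Rightarrow> real^'d \<Rightarrow> real^'d \<Rightarrow> real^'d \<Rightarrow> real" where
  "bump n a b x = (\<Prod>i\<in>UNIV. flatbump (real n) (a $ i) (b $ i) (x $ i))"

lemma smooth_bump: "smooth (bump n a b)"
  unfolding bump_def by (rule smooth_prod_Cinf) (rule Cinf_flatbump)

lemma bump_bounds: "0 \<le> bump n a b x" "bump n a b x \<le> 1"
  unfolding bump_def by (auto intro!: prod_nonneg prod_le_1 simp: flatbump_bounds)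

lemma bump_eq_0: "x \<notin> box a b \<Longrightarrow> bump n a b x = 0"
proof -
  assume "x \<notin> box a b"
  then obtain i where "\<not> (a $ i < x $ i \<and> x $ i < b $ i)" by (auto simp: mem_box_cart)
  then have "flatbump (real n) (a $ i) (b $ i) (x $ i) = 0" by (intro flatbump_eq_0) auto
  then show ?thesis unfolding bump_def by (intro prod_zero) auto
qed

lemma bump_tendsto: "(\<lambda>n. bump n a b x) \<longlonglongrightarrow> indicator (box a b) x"
proof -
  have "(\<lambda>n. bump n a b x) \<longlonglongrightarrow> (\<Prod>i\<in>UNIV. if a $ i < x $ i \<and> x $ i < b $ i then 1 else 0)"
    unfolding bump_def by (intro tendsto_prod flatbump_tendsto)
  also have "(\<Prod>i\<in>UNIV. if a $ i < x $ i \<and> x $ i < b $ i then 1 else 0::real) = indicator (box a b) x"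
    by (auto simp: indicator_def mem_box_cart prod_zero_iff)
  finally show ?thesis .
qed

lemma bump_test_function:
  assumes "cbox a b \<subseteq> \<Omega>" shows "bump n a b \<in> test_functions \<Omega>"
proof -
  have "closure {x. bump n a b x \<noteq> 0} \<subseteq> cbox a b"
    using bump_eq_0[of _ a b n] box_subset_cbox[of a b] by (intro closure_minimal) auto
  moreover have "compact (closure {x. bump n a b x \<noteq> 0})"
    using calculation by (meson bounded_cbox bounded_subset closed_closure compact_eq_bounded_closed)
  ultimately show ?thesis using assms smooth_bump by (auto simp: test_functions_def)
qed


subsection \<open>The fundamental lemma of the calculus of variations\<close>

text \<open>The positive and negative parts of \<open>G\<close>, taken as densities, give measures
  that agree on boxes. Boxes are stable under intersection, generate the Borel sets, exhaust the
  space and have finite measure here; hence the measures agree, and so do their densities.\<close>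

lemma AE_eq_0_of_box_integrals:
  fixes G :: "'a::euclidean_space \<Rightarrow> real"
  assumes G: "integrable lebesgue G"
    and box0: "\<And>a b. (\<integral>x. G x * indicator (box a b) x \<partial>lebesgue) = 0"
  shows "AE x in lebesgue. G x = 0"
proof -
  \<comment> \<open>Boxes generate only the Borel sets, so \<open>G\<close> is replaced by a Borel
    function equal to it off a null set.\<close>
  obtain g where g[measurable]: "g \<in> borel_measurable lborel" and ae: "AE x in lborel. G x = g x"
    using completion_ex_borel_measurable_real[of G lborel] G by auto
  have ae': "AE x in lebesgue. G x = g x" using ae by (rule AE_completion)
  have "integrable lebesgue g"
    by (rule integrable_cong_AE_imp[OF G]) (use ae' in \<open>auto intro: measurable_completion\<close>)
  then have gi: "integrable lborel g" by (simp add: integrable_completion)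
  have gb: "(\<integral>x. g x * indicator (box a b) x \<partial>lborel) = 0" for a b
  proof -
    have "(\<integral>x. g x * indicator (box a b) x \<partial>lborel) = (\<integral>x. g x * indicator (box a b) x \<partial>lebesgue)"
      by (rule integral_completion[symmetric]) measurable
    also have "\<dots> = (\<integral>x. G x * indicator (box a b) x \<partial>lebesgue)"
    proof (rule integral_cong_AE)
      show "(\<lambda>x. g x * indicator (box a b) x) \<in> borel_measurable lebesgue"
        by (rule measurable_completion) measurable
      have "(\<lambda>x. indicator (box a b) x :: real) \<in> borel_measurable lebesgue"
        by (rule measurable_completion) measurable
      then show "(\<lambda>x. G x * indicator (box a b) x) \<in> borel_measurable lebesgue"
        using G by measurable
    qed (use ae' in auto)
    finally show ?thesis using box0 by simp
  qed
  let ?M = "density lborel (\<lambda>x. ennreal (max 0 (g x)))"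
  let ?N = "density lborel (\<lambda>x. ennreal (max 0 (- g x)))"
  have int: "integrable lborel (\<lambda>x. max 0 (g x))" "integrable lborel (\<lambda>x. max 0 (- g x))"
    using gi by auto
  have dens: "emeasure (density lborel (\<lambda>x. ennreal (h x))) (box a b)
      = ennreal (\<integral>x. h x * indicator (box a b) x \<partial>lborel)"
    if h: "integrable lborel h" "\<And>x. 0 \<le> h x" for h and a b :: 'a
  proof -
    have "ennreal (\<integral>x. h x * indicator (box a b) x \<partial>lborel) = (\<integral>\<^sup>+x. ennreal (h x * indicator (box a b) x) \<partial>lborel)"
      using h by (intro nn_integral_eq_integral[symmetric] integrable_real_mult_indicator) auto
    also have "\<dots> = (\<integral>\<^sup>+x. ennreal (h x) * indicator (box a b) x \<partial>lborel)"
      by (rule nn_integral_cong) (auto simp: indicator_def)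
    finally show ?thesis using h(1) by (simp add: emeasure_density)
  qed
  note em = dens[OF int(1) max.cobounded1] and en = dens[OF int(2) max.cobounded1]
  have eq: "emeasure ?M (box a b) = emeasure ?N (box a b)" for a b
  proof -
    have "(\<integral>x. max 0 (g x) * indicator (box a b) x \<partial>lborel) - (\<integral>x. max 0 (- g x) * indicator (box a b) x \<partial>lborel)
      = (\<integral>x. max 0 (g x) * indicator (box a b) x - max 0 (- g x) * indicator (box a b) x \<partial>lborel)"
      using int by (intro Bochner_Integration.integral_diff[symmetric] integrable_real_mult_indicator) auto
    also have "\<dots> = (\<integral>x. g x * indicator (box a b) x \<partial>lborel)"
      by (rule Bochner_Integration.integral_cong) (auto simp: indicator_def)
    finally show ?thesis unfolding em en using gb by simp
  qed
  have "?M = ?N"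
  proof (rule measure_eqI_generator_eq)
    let ?E = "range (\<lambda>(a, b). box a b::'a set)"
    show "Int_stable ?E" by (auto simp: Int_stable_def box_Int_box)
    show "?E \<subseteq> Pow UNIV" "sets ?M = sigma_sets UNIV ?E" "sets ?N = sigma_sets UNIV ?E"
      by (simp_all add: borel_eq_box)
    let ?A = "\<lambda>n::nat. box (- (real n *\<^sub>R One)) (real n *\<^sub>R One) :: 'a set"
    show "range ?A \<subseteq> ?E" "(\<Union>i. ?A i) = UNIV"
      unfolding UN_box_eq_UNIV by auto
    show "emeasure ?M (?A i) \<noteq> \<infinity>" for i unfolding em by auto
    show "emeasure ?M X = emeasure ?N X" if "X \<in> ?E" for X using that eq by auto
  qed
  then have "AE x in lborel. ennreal (max 0 (g x)) = ennreal (max 0 (- g x))"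
    by (intro sigma_finite_measure.density_unique[OF sigma_finite_lborel]) auto
  then have "AE x in lborel. g x = 0"
    by eventually_elim (auto simp: max_def split: if_splits)
  then have "AE x in lborel. G x = 0" using ae by eventually_elim simp
  then show ?thesis by (rule AE_completion)
qed

lemma smooth_borel_measurable: "smooth f \<Longrightarrow> f \<in> borel_measurable borel"
  by (intro borel_measurable_continuous_onI smooth_continuous)

lemma borel_measurable_lebesgue_onI: "f \<in> borel_measurable borel \<Longrightarrow> f \<in> borel_measurable (lebesgue_on S)"
  by (intro measurable_restrict_space1 measurable_completion) simp

text \<open>Dominated convergence along the bumps gives zero integrals over all boxes whose closure
  lies in \<open>\<Omega>\<close>. This is localised to one closed box at a time, to which every
  test box can be clipped; countably many such boxes exhaust \<open>\<Omega>\<close>.\<close>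

lemma fundamental_lemma:
  fixes g :: "real^'d \<Rightarrow> real"
  assumes \<Omega>: "open \<Omega>" and g: "integrable (lebesgue_on \<Omega>) g"
    and 0: "\<And>\<phi>. \<phi> \<in> test_functions \<Omega> \<Longrightarrow> (\<integral>x. g x * \<phi> x \<partial>lebesgue_on \<Omega>) = 0"
  shows "AE x in lebesgue_on \<Omega>. g x = 0"
proof -
  have \<Omega>m: "\<Omega> \<in> sets lebesgue" using \<Omega> by (simp add: borel_open)
  let ?g = "\<lambda>x. indicator \<Omega> x *\<^sub>R g x"
  have gi: "integrable lebesgue ?g" using g \<Omega>m by (simp add: integrable_restrict_space)
  have mi: "(\<lambda>x. indicator (box a b) x :: real) \<in> borel_measurable lebesgue" for a b :: "real^'d"
    by (rule measurable_completion) measurable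
  have A: "(\<integral>x. ?g x * indicator (box a b) x \<partial>lebesgue) = 0" if ab: "cbox a b \<subseteq> \<Omega>" for a b
  proof -
    have "(\<lambda>n. \<integral>x. ?g x * bump n a b x \<partial>lebesgue) \<longlonglongrightarrow> (\<integral>x. ?g x * indicator (box a b) x \<partial>lebesgue)"
    proof (rule integral_dominated_convergence)
      show "integrable lebesgue (\<lambda>x. norm (?g x))" using gi by (rule integrable_norm)
      show "(\<lambda>x. ?g x * indicator (box a b) x) \<in> borel_measurable lebesgue"
        using borel_measurable_integrable[OF gi] mi by (rule borel_measurable_times)
      have "bump n a b \<in> borel_measurable lebesgue" for n
        by (rule measurable_completion) (simp add: smooth_borel_measurable smooth_bump)
      then show "(\<lambda>x. ?g x * bump n a b x) \<in> borel_measurable lebesgue" for n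
        using borel_measurable_integrable[OF gi] by (intro borel_measurable_times)
      show "AE x in lebesgue. (\<lambda>n. ?g x * bump n a b x) \<longlonglongrightarrow> ?g x * indicator (box a b) x"
        by (intro AE_I2 tendsto_mult tendsto_const bump_tendsto)
      show "AE x in lebesgue. norm (?g x * bump n a b x) \<le> norm (?g x)" for n
        by (intro AE_I2) (simp add: abs_mult mult_left_le bump_bounds)
    qed
    moreover have "(\<integral>x. ?g x * bump n a b x \<partial>lebesgue) = 0" for n
    proof -
      have "(\<integral>x. ?g x * bump n a b x \<partial>lebesgue) = (\<integral>x. g x * bump n a b x \<partial>lebesgue_on \<Omega>)"
        using \<Omega>m by (simp add: integral_restrict_space mult.assoc)
      then show ?thesis using 0[OF bump_test_function[OF ab]] by simp
    qed
    ultimately show ?thesis by (simp add: LIMSEQ_const_iff)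
  qed
  have B: "AE x in lebesgue. x \<in> cbox c d \<longrightarrow> g x = 0" if cd: "cbox c d \<subseteq> \<Omega>" for c d
  proof -
    let ?G = "\<lambda>x. ?g x * indicator (box c d) x"
    have "AE x in lebesgue. ?G x = 0"
    proof (rule AE_eq_0_of_box_integrals)
      show "integrable lebesgue ?G"
        by (rule integrable_real_mult_indicator) (use gi in auto)
      fix a b :: "real^'d"
      \<comment> \<open>\<open>l\<close> and \<open>u\<close> clip an arbitrary test box to
        \<open>box c d\<close>, so that the closed box between them remains inside
        \<open>\<Omega>\<close>.\<close>
      define l where "l = (\<Sum>i\<in>Basis. max (c\<bullet>i) (a\<bullet>i) *\<^sub>R i)"
      define u where "u = (\<Sum>i\<in>Basis. min (d\<bullet>i) (b\<bullet>i) *\<^sub>R i)"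
      have lu: "box c d \<inter> box a b = box l u" unfolding l_def u_def by (rule box_Int_box)
      have eq: "?G x * indicator (box a b) x = ?g x * indicator (box l u) x" for x
        unfolding lu[symmetric] by (simp add: indicator_inter_arith mult.assoc)
      have "cbox l u \<subseteq> \<Omega>"
        using cd by (auto simp: l_def u_def mem_box subset_iff)
      then show "(\<integral>x. ?G x * indicator (box a b) x \<partial>lebesgue) = 0"
        unfolding eq by (rule A)
    qed
    \<comment> \<open>Only the open box has been dealt with, whereas the countable cover below
      consists of closed ones; the faces form a null set.\<close>
    moreover have "AE x in lebesgue. x \<notin> cbox c d - box c d"
      using negligible_frontier_interval[of c d] unfolding negligible_iff_null_sets by (rule AE_not_in)
    ultimately show ?thesis
      by eventually_elim (use cd in \<open>auto simp: indicator_def split: if_splits\<close>)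
  qed
  obtain D where D: "countable D" "D \<subseteq> Pow \<Omega>" "\<And>X. X \<in> D \<Longrightarrow> \<exists>a b. X = cbox a b" "\<Union>D = \<Omega>"
    using open_countable_Union_open_cbox[OF \<Omega>] by metis
  have "AE x in lebesgue. \<forall>X\<in>D. x \<in> X \<longrightarrow> g x = 0"
    unfolding AE_ball_countable[OF D(1)]
  proof
    fix X assume X: "X \<in> D"
    then obtain a b where "X = cbox a b" using D(3) by blast
    then show "AE x in lebesgue. x \<in> X \<longrightarrow> g x = 0" using B[of a b] X D(2) by auto
  qed
  then have "AE x in lebesgue. x \<in> \<Omega> \<longrightarrow> g x = 0"
    by eventually_elim (use D in auto)
  then show ?thesis using \<Omega>m by (simp add: AE_restrict_space_iff)
qed

section \<open>Weak derivatives and the space of vector fields\<close>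

lemma L2_space_iff: "u \<in> L2_space S \<longleftrightarrow> sqint (lebesgue_on S) u"
  by (simp add: L2_space_def sqint_def)

lemma L2_norm_eq: "L2_norm S u = l2 (lebesgue_on S) u"
  by (simp add: L2_norm_def l2_def)

lemma partial_eq_0_outside:
  assumes "x \<notin> closure {x. f x \<noteq> 0}" shows "partial i f x = 0"
proof -
  have "((\<lambda>x. 0) has_derivative (\<lambda>x. 0)) (at x)" by simp
  then have "(f has_derivative (\<lambda>x. 0)) (at x)"
    by (rule has_derivative_transform_within_open[of _ _ _ _ "- closure {x. f x \<noteq> 0}"])
       (use assms closure_subset[of "{x. f x \<noteq> 0}"] in auto)
  then show ?thesis by (rule partial_eqI)
qed

lemma partial_test_function:
  assumes "\<phi> \<in> test_functions \<Omega>" shows "partial i \<phi> \<in> test_functions \<Omega>"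
proof -
  have *: "closure {x. partial i \<phi> x \<noteq> 0} \<subseteq> closure {x. \<phi> x \<noteq> 0}"
    by (intro closure_minimal) (use partial_eq_0_outside[of _ \<phi> i] in auto)
  have "compact (closure {x. \<phi> x \<noteq> 0} \<inter> closure {x. partial i \<phi> x \<noteq> 0})"
    using assms by (intro compact_Int_closed) (auto simp: test_functions_def)
  then have "compact (closure {x. partial i \<phi> x \<noteq> 0})" using * by (simp add: Int_absorb1)
  then show ?thesis using assms smooth_partial[of \<phi> i] *
    by (auto simp: test_functions_def)
qed

lemma sqint_vec_iff:
  fixes u :: "'a \<Rightarrow> 'b::euclidean_space^'n"
  shows "sqint M u \<longleftrightarrow> (\<forall>i. sqint M (\<lambda>x. u x $ i))"
proof
  assume "sqint M u"
  then show "\<forall>i. sqint M (\<lambda>x. u x $ i)"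
    by (auto intro: sqint_bounded_linear[OF _ bounded_linear_vec_nth])
next
  assume a: "\<forall>i. sqint M (\<lambda>x. u x $ i)"
  have "u \<in> borel_measurable M"
    unfolding borel_measurable_euclidean_space[of u]
  proof
    fix e :: "'b^'n" assume "e \<in> Basis"
    then obtain i b where e: "e = axis i b" by (auto simp: Basis_vec_def)
    have "(\<lambda>x. u x $ i) \<in> borel_measurable M" using a by (simp add: sqint_def)
    then show "(\<lambda>x. u x \<bullet> e) \<in> borel_measurable M" by (simp add: e inner_axis)
  qed
  moreover have "(norm (u x))\<^sup>2 = (\<Sum>i\<in>UNIV. (norm (u x $ i))\<^sup>2)" for x
    by (simp add: norm_vec_def L2_set_def sum_nonneg)
  then have "integrable M (\<lambda>x. (norm (u x))\<^sup>2)" using a by (simp add: sqint_def)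
  ultimately show "sqint M u" by (simp add: sqint_def)
qed

text \<open>The product norm is Euclidean, so squared norms add without a constant. Used for the jet
  of a field and for the pair of operator and rotation.\<close>

lemma sqint_Pair:
  assumes "sqint M u" "sqint M v"
  shows "sqint M (\<lambda>x. (u x, v x))" "(l2 M (\<lambda>x. (u x, v x)))\<^sup>2 = (l2 M u)\<^sup>2 + (l2 M v)\<^sup>2"
proof -
  have e: "(norm (u x, v x))\<^sup>2 = (norm (u x))\<^sup>2 + (norm (v x))\<^sup>2" for x
    by (simp add: norm_Pair)
  show "sqint M (\<lambda>x. (u x, v x))" using assms unfolding sqint_def e by (auto intro: borel_measurable_Pair)
  show "(l2 M (\<lambda>x. (u x, v x)))\<^sup>2 = (l2 M u)\<^sup>2 + (l2 M v)\<^sup>2"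
    using assms unfolding l2_sq e by (simp add: sqint_def)
qed

lemma integral_inner_tendsto:
  assumes "\<And>n. sqint M (u n)" "sqint M v" "sqint M w" "(\<lambda>n. l2 M (\<lambda>x. u n x - v x)) \<longlonglongrightarrow> 0"
  shows "(\<lambda>n. \<integral>x. u n x \<bullet> w x \<partial>M) \<longlonglongrightarrow> (\<integral>x. v x \<bullet> w x \<partial>M)"
proof -
  have "(\<lambda>n. (\<integral>x. u n x \<bullet> w x \<partial>M) - (\<integral>x. v x \<bullet> w x \<partial>M)) \<longlonglongrightarrow> 0"
  proof (rule Lim_null_comparison)
    show "(\<lambda>n. l2 M (\<lambda>x. u n x - v x) * l2 M w) \<longlonglongrightarrow> 0"
      using tendsto_mult_left_zero[OF assms(4)] by simp
    have "(\<integral>x. u n x \<bullet> w x \<partial>M) - (\<integral>x. v x \<bullet> w x \<partial>M) = (\<integral>x. (u n x - v x) \<bullet> w x \<partial>M)" for n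
      using sqint_integrable_inner[OF assms(1,3)] sqint_integrable_inner[OF assms(2,3)]
      by (simp add: inner_diff_left)
    then show "\<forall>\<^sub>F n in sequentially. norm ((\<integral>x. u n x \<bullet> w x \<partial>M) - (\<integral>x. v x \<bullet> w x \<partial>M)) \<le> l2 M (\<lambda>x. u n x - v x) * l2 M w"
      using l2_Cauchy_Schwarz[OF sqint_diff[OF assms(1,2)] assms(3)] by simp
  qed
  then show ?thesis by (simp add: LIM_zero_iff)
qed

lemma l2_bounded_linear_tendsto:
  assumes "\<And>n. sqint M (u n)" "sqint M v" "(\<lambda>n. l2 M (\<lambda>x. u n x - v x)) \<longlonglongrightarrow> 0" "bounded_linear T"
  shows "(\<lambda>n. l2 M (\<lambda>x. T (u n x) - T (v x))) \<longlonglongrightarrow> 0"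
proof -
  obtain K where K: "\<And>u. sqint M u \<Longrightarrow> l2 M (\<lambda>x. T (u x)) \<le> K * l2 M u"
    using l2_bounded_linear[OF assms(4), where ?'a='a] by metis
  show ?thesis
  proof (rule Lim_null_comparison)
    show "(\<lambda>n. K * l2 M (\<lambda>x. u n x - v x)) \<longlonglongrightarrow> 0"
      using tendsto_mult_right_zero[OF assms(3)] by simp
    show "\<forall>\<^sub>F n in sequentially. norm (l2 M (\<lambda>x. T (u n x) - T (v x))) \<le> K * l2 M (\<lambda>x. u n x - v x)"
      using K[OF sqint_diff[OF assms(1,2)]] by (simp add: linear_diff[OF bounded_linear.linear[OF assms(4)]])
  qed
qed

subsection \<open>Weak derivatives\<close>

text \<open>Difference quotients of \<open>u\<close> have integral 0 by translation invariance and converge boundedly.\<close>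

lemma integral_partial_eq_0:
  fixes u :: "real^'d \<Rightarrow> real"
  assumes diff: "\<And>x. u differentiable (at x)" and cont: "continuous_on UNIV (partial i u)"
    and supp: "compact (closure {x. u x \<noteq> 0})"
  shows "(\<integral>x. partial i u x \<partial>lborel) = 0"
proof -
  define K where "K = closure {x. u x \<noteq> 0}"
  let ?e = "axis i 1 :: real^'d"
  have u0: "u x = 0" if "x \<notin> K" for x using that closure_subset[of "{x. u x \<noteq> 0}"] unfolding K_def by blast
  have p0: "partial i u x = 0" if "x \<notin> K" for x using that unfolding K_def by (rule partial_eq_0_outside)
  note supp = supp[folded K_def]
  have "compact (partial i u ` K)"
    using supp cont by (intro compact_continuous_image) (auto intro: continuous_on_subset)
  then obtain C0 where C0: "\<And>x. x \<in> K \<Longrightarrow> \<bar>partial i u x\<bar> \<le> C0"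
    by (meson bounded_real compact_imp_bounded image_eqI)
  \<comment> \<open>\<open>C0\<close> may be negative when \<open>K\<close> is empty; the maximum
    with 0 also covers the points outside \<open>K\<close>.\<close>
  define C where "C = max 0 C0"
  have C: "\<bar>partial i u x\<bar> \<le> C" for x
    using C0[of x] p0[of x] unfolding C_def by (cases "x \<in> K") auto
  obtain R where R: "\<And>x. x \<in> K \<Longrightarrow> norm x \<le> R"
    using supp by (meson bounded_iff compact_imp_bounded)
  have line: "((\<lambda>s. u (x + s *\<^sub>R ?e)) has_real_derivative partial i u (x + s *\<^sub>R ?e)) (at s)" for x s
  proof -
    have "((\<lambda>s. x + s *\<^sub>R ?e) has_derivative (\<lambda>s. s *\<^sub>R ?e)) (at s)"
      by (auto intro!: derivative_eq_intros)
    moreover have "(u has_derivative frechet_derivative u (at (x + s *\<^sub>R ?e))) (at (x + s *\<^sub>R ?e))"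
      using diff frechet_derivative_works by blast
    ultimately have "((\<lambda>s. u (x + s *\<^sub>R ?e)) has_derivative (\<lambda>r. frechet_derivative u (at (x + s *\<^sub>R ?e)) (r *\<^sub>R ?e))) (at s)"
      by (rule has_derivative_compose)
    moreover have "linear (frechet_derivative u (at (x + s *\<^sub>R ?e)))"
      using diff linear_frechet_derivative by blast
    ultimately show ?thesis
      by (simp add: has_field_derivative_def partial_def linear_cmul mult_commute_abs)
  qed
  define q where "q = (\<lambda>n x. (u (x + inverse (real (Suc n)) *\<^sub>R ?e) - u x) / inverse (real (Suc n)))"
  \<comment> \<open>By the mean value theorem a difference quotient is a value of the partial
    derivative, which gives a bound uniform in \<open>n\<close>.\<close>
  have qb: "\<bar>q n x\<bar> \<le> C" for n x
  proof -
    let ?h = "inverse (real (Suc n))"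
    have "\<exists>z>0. z < ?h \<and> u (x + ?h *\<^sub>R ?e) - u (x + 0 *\<^sub>R ?e) = (?h - 0) * partial i u (x + z *\<^sub>R ?e)"
      by (rule MVT2[where f="\<lambda>s. u (x + s *\<^sub>R ?e)"]) (auto intro: line)
    then obtain z where "u (x + ?h *\<^sub>R ?e) - u x = ?h * partial i u (x + z *\<^sub>R ?e)" by auto
    then have "q n x = partial i u (x + z *\<^sub>R ?e)" unfolding q_def by simp
    then show ?thesis using C by simp
  qed
  \<comment> \<open>Shifts have length at most 1, so all quotients vanish outside the ball of radius
    \<open>R + 1\<close>; with the uniform bound this yields an integrable dominating
    function.\<close>
  have q0: "q n x = 0" if "norm x > R + 1" for n x
  proof -
    have "inverse (real (Suc n)) \<le> 1" by (rule inverse_le_1_iff[THEN iffD2]) simp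
    then have "norm (inverse (real (Suc n)) *\<^sub>R ?e) \<le> 1" by (simp del: of_nat_Suc)
    then have "norm (x + inverse (real (Suc n)) *\<^sub>R ?e) > R"
      using that norm_triangle_ineq4[of "x + inverse (real (Suc n)) *\<^sub>R ?e" "inverse (real (Suc n)) *\<^sub>R ?e"] by simp
    then have "x + inverse (real (Suc n)) *\<^sub>R ?e \<notin> K" by (metis R not_le)
    moreover have "x \<notin> K"
    proof
      assume "x \<in> K"
      then have "norm x \<le> R" by (rule R)
      then show False using that by simp
    qed
    ultimately have "u (x + inverse (real (Suc n)) *\<^sub>R ?e) = 0" "u x = 0" by (auto intro: u0)
    then show ?thesis unfolding q_def by (metis diff_self div_0)
  qed
  have ucont: "continuous_on UNIV u"
    by (intro continuous_at_imp_continuous_on ballI differentiable_imp_continuous_within diff)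
  have ub[measurable]: "u \<in> borel_measurable borel" by (rule borel_measurable_continuous_onI[OF ucont])
  have pb[measurable]: "partial i u \<in> borel_measurable borel" by (rule borel_measurable_continuous_onI[OF cont])
  have qm[measurable]: "q n \<in> borel_measurable borel" for n unfolding q_def by measurable
  have ui: "integrable lborel u"
  proof -
    have "integrable lborel (\<lambda>x. indicator K x *\<^sub>R u x)"
      by (rule borel_integrable_compact[OF supp continuous_on_subset[OF ucont subset_UNIV]])
    moreover have "(\<lambda>x. indicator K x *\<^sub>R u x) = u" using u0 by (fastforce simp: indicator_def)
    ultimately show ?thesis by metis
  qed
  have "(\<lambda>n. \<integral>x. q n x \<partial>lborel) \<longlonglongrightarrow> (\<integral>x. partial i u x \<partial>lborel)"
  proof (rule integral_dominated_convergence[where w="\<lambda>x. indicator (cball 0 (R+1)) x *\<^sub>R C"])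
    show "integrable lborel (\<lambda>x::real^'d. indicator (cball 0 (R + 1)) x *\<^sub>R C)"
      by (rule borel_integrable_compact) auto
    show "AE x in lborel. (\<lambda>n. q n x) \<longlonglongrightarrow> partial i u x"
    proof (rule AE_I2)
      fix x :: "real^'d"
      have "((\<lambda>h. (u (x + h *\<^sub>R ?e) - u x) / h) \<longlongrightarrow> partial i u x) (at 0)"
        using line[of x 0] by (simp add: DERIV_def)
      moreover have "filterlim (\<lambda>n. inverse (real (Suc n))) (at 0) sequentially"
        using LIMSEQ_inverse_real_of_nat by (simp add: filterlim_at)
      ultimately show "(\<lambda>n. q n x) \<longlonglongrightarrow> partial i u x"
        unfolding q_def by (rule filterlim_compose)
    qed
    show "AE x in lborel. norm (q n x) \<le> indicator (cball 0 (R+1)) x *\<^sub>R C" for n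
      using qb q0 by (intro AE_I2) (auto simp: indicator_def not_le)
  qed simp_all
  moreover have "(\<integral>x. q n x \<partial>lborel) = 0" for n
  proof -
    let ?h = "inverse (real (Suc n)) *\<^sub>R ?e"
    have sh: "lborel = distr lborel borel ((+) ?h)" by (rule lborel_distr_plus[symmetric])
    have "integrable (distr lborel borel ((+) ?h)) u" using ui sh by metis
    then have i2: "integrable lborel (\<lambda>x. u (?h + x))"
      by (subst (asm) integrable_distr_eq) auto
    have "(\<integral>x. u x \<partial>lborel) = (\<integral>x. u x \<partial>distr lborel borel ((+) ?h))" using sh by metis
    also have "\<dots> = (\<integral>x. u (?h + x) \<partial>lborel)" by (rule integral_distr) auto
    finally show ?thesis using ui i2 by (simp add: q_def add.commute)
  qed
  ultimately show ?thesis by (simp add: LIMSEQ_const_iff)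
qed

lemma partial_mult:
  assumes "f differentiable (at x)" "g differentiable (at x)"
  shows "partial i (\<lambda>x. f x * g x) x = f x * partial i g x + partial i f x * g x"
proof -
  have f: "(f has_derivative frechet_derivative f (at x)) (at x)"
    using assms(1) by (simp add: frechet_derivative_works)
  have g: "(g has_derivative frechet_derivative g (at x)) (at x)"
    using assms(2) by (simp add: frechet_derivative_works)
  show ?thesis
    using partial_eqI[OF has_derivative_mult[OF f g], of i] by (simp add: partial_def)
qed

text \<open>Boundedness makes \<open>Leb\<close> a finite measure: square integrable functions are
  integrable, as the fundamental lemma demands, and functions smooth on the whole space restrict to
  square integrable ones.\<close>

locale bounded_open =
  fixes \<Omega> :: "(real^'d) set"
  assumes open_dom: "open \<Omega>" and bounded_dom: "bounded \<Omega>"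
begin

abbreviation "Leb \<equiv> lebesgue_on \<Omega>"

lemma dom_sets: "\<Omega> \<in> sets lebesgue"
  using open_dom by (simp add: borel_open)

lemma finite_Leb: "finite_measure Leb"
  using bounded_dom dom_sets
  by (intro finite_measure_lebesgue_on bounded_set_imp_lmeasurable)

lemma sqint_integrable:
  fixes u :: "real^'d \<Rightarrow> real"
  assumes "sqint Leb u" shows "integrable Leb u"
  using sqint_integrable_inner[OF sqint_const[OF finite_Leb, of 1] assms] by simp

lemma sqint_mult: "sqint Leb u \<Longrightarrow> sqint Leb v \<Longrightarrow> integrable Leb (\<lambda>x. u x * v x :: real)"
  using sqint_integrable_inner[of Leb u v] by simp

lemma sqint_continuous:
  fixes f :: "real^'d \<Rightarrow> 'b::euclidean_space"
  assumes "continuous_on UNIV f" shows "sqint Leb f"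
proof -
  have "compact (f ` closure \<Omega>)"
    using bounded_dom assms by (intro compact_continuous_image) (auto intro: continuous_on_subset)
  then obtain B where B: "\<And>x. x \<in> closure \<Omega> \<Longrightarrow> norm (f x) \<le> B"
    by (meson bounded_iff compact_imp_bounded image_eqI)
  show ?thesis
  proof (rule sqint_bound[OF _ sqint_const[OF finite_Leb, of "1::real"], where C=B])
    show "f \<in> borel_measurable Leb"
      using assms by (intro borel_measurable_lebesgue_onI borel_measurable_continuous_onI)
    show "AE x in Leb. norm (f x) \<le> B * norm (1::real)"
      using B closure_subset by (intro AE_I2) (auto simp: space_restrict_space)
  qed
qed

lemma sqint_smooth: "smooth f \<Longrightarrow> sqint Leb f"
  by (intro sqint_continuous smooth_continuous)

lemma sqint_test: "\<phi> \<in> test_functions \<Omega> \<Longrightarrow> sqint Leb (iter_partial xs \<phi>)"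
  by (intro sqint_smooth smooth_iter_partial) (simp add: test_functions_def)

lemma has_weak_deriv_sqint: "has_weak_deriv \<Omega> xs u g \<Longrightarrow> sqint Leb g"
  by (simp add: has_weak_deriv_def L2_space_iff)

text \<open>The difference of the two candidates integrates to zero against every test function.
  This connects the representative selected by \<open>weak_deriv\<close> with any weak derivative
  found by other means.\<close>

lemma has_weak_deriv_unique:
  assumes "has_weak_deriv \<Omega> xs u g" "has_weak_deriv \<Omega> xs u h"
  shows "AE x in Leb. g x = h x"
proof -
  have s: "sqint Leb g" "sqint Leb h" using assms by (auto simp: has_weak_deriv_sqint)
  have "AE x in Leb. g x - h x = 0"
  proof (rule fundamental_lemma[OF open_dom sqint_integrable[OF sqint_diff[OF s]]])
    fix \<phi> assume \<phi>: "\<phi> \<in> test_functions \<Omega>"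
    have "sqint Leb \<phi>" using sqint_test[OF \<phi>, of "[]"] by simp
    then have "(\<integral>x. (g x - h x) * \<phi> x \<partial>Leb) = (\<integral>x. g x * \<phi> x \<partial>Leb) - (\<integral>x. h x * \<phi> x \<partial>Leb)"
      using s by (simp add: left_diff_distrib sqint_mult)
    moreover have "(- 1) ^ length xs * (\<integral>x. g x * \<phi> x \<partial>Leb) = (- 1) ^ length xs * (\<integral>x. h x * \<phi> x \<partial>Leb)"
      using assms \<phi> by (simp add: has_weak_deriv_def)
    ultimately show "(\<integral>x. (g x - h x) * \<phi> x \<partial>Leb) = 0" by simp
  qed
  then show ?thesis by simp
qed

lemma has_weak_deriv_lincomb:
  assumes "has_weak_deriv \<Omega> xs u g" "has_weak_deriv \<Omega> xs v h" "sqint Leb u" "sqint Leb v"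
  shows "has_weak_deriv \<Omega> xs (\<lambda>x. c * u x + d * v x) (\<lambda>x. c * g x + d * h x)"
  unfolding has_weak_deriv_def L2_space_iff
proof (intro conjI ballI)
  have s: "sqint Leb g" "sqint Leb h" using assms by (auto simp: has_weak_deriv_sqint)
  show "sqint Leb (\<lambda>x. c * g x + d * h x)"
    using sqint_add[OF sqint_scaleR[OF s(1), of c] sqint_scaleR[OF s(2), of d]] by simp
  fix \<phi> assume \<phi>: "\<phi> \<in> test_functions \<Omega>"
  have p: "sqint Leb \<phi>" "sqint Leb (iter_partial xs \<phi>)"
    using sqint_test[OF \<phi>, of "[]"] sqint_test[OF \<phi>, of xs] by simp_all
  have *: "(\<integral>x. (c * a x + d * b x) * w x \<partial>Leb) = c * (\<integral>x. a x * w x \<partial>Leb) + d * (\<integral>x. b x * w x \<partial>Leb)"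
    if "sqint Leb a" "sqint Leb b" "sqint Leb w" for a b w :: "real^'d \<Rightarrow> real"
    using sqint_mult[OF that(1,3)] sqint_mult[OF that(2,3)] by (simp add: distrib_right mult.assoc)
  show "(\<integral>x. (c * u x + d * v x) * iter_partial xs \<phi> x \<partial>Leb) =
      (- 1) ^ length xs * (\<integral>x. (c * g x + d * h x) * \<phi> x \<partial>Leb)"
    using assms(1,2) \<phi> unfolding *[OF assms(3,4) p(2)] *[OF s p(1)] has_weak_deriv_def
    by (simp add: distrib_left mult.left_commute)
qed

lemma has_weak_deriv_cong:
  assumes "has_weak_deriv \<Omega> xs u g" "AE x in Leb. u x = v x" "u \<in> borel_measurable Leb" "v \<in> borel_measurable Leb"
  shows "has_weak_deriv \<Omega> xs v g"
proof -
  have "(\<integral>x. u x * iter_partial xs \<phi> x \<partial>Leb) = (\<integral>x. v x * iter_partial xs \<phi> x \<partial>Leb)"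
    if \<phi>: "\<phi> \<in> test_functions \<Omega>" for \<phi>
  proof (rule integral_cong_AE)
    have "iter_partial xs \<phi> \<in> borel_measurable Leb" using sqint_test[OF \<phi>] by (rule sqintD)
    then show "(\<lambda>x. u x * iter_partial xs \<phi> x) \<in> borel_measurable Leb"
      "(\<lambda>x. v x * iter_partial xs \<phi> x) \<in> borel_measurable Leb"
      using assms(3,4) by (auto intro: borel_measurable_times)
    show "AE x in Leb. u x * iter_partial xs \<phi> x = v x * iter_partial xs \<phi> x"
      using assms(2) by eventually_elim simp
  qed
  then show ?thesis using assms(1) by (simp add: has_weak_deriv_def)
qed

text \<open>Both sides of the defining identity are continuous in the L2 norm, so weak
  differentiation is a closed operator; this identifies the derivative of a limit in
  \<open>H1_complete\<close>.\<close>

lemma has_weak_deriv_tendsto: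
  assumes wd: "\<And>n. has_weak_deriv \<Omega> xs (u n) (g n)" and s: "\<And>n. sqint Leb (u n)" "sqint Leb v" "sqint Leb h"
    and lim: "(\<lambda>n. l2 Leb (\<lambda>x. u n x - v x)) \<longlonglongrightarrow> 0" "(\<lambda>n. l2 Leb (\<lambda>x. g n x - h x)) \<longlonglongrightarrow> 0"
  shows "has_weak_deriv \<Omega> xs v h"
  unfolding has_weak_deriv_def L2_space_iff
proof (intro conjI ballI s(3))
  fix \<phi> assume \<phi>: "\<phi> \<in> test_functions \<Omega>"
  have p: "sqint Leb \<phi>" "sqint Leb (iter_partial xs \<phi>)"
    using sqint_test[OF \<phi>, of "[]"] sqint_test[OF \<phi>, of xs] by simp_all
  have "(\<lambda>n. \<integral>x. u n x * iter_partial xs \<phi> x \<partial>Leb) \<longlonglongrightarrow> (\<integral>x. v x * iter_partial xs \<phi> x \<partial>Leb)"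
    using integral_inner_tendsto[OF s(1,2) p(2) lim(1)] by simp
  moreover have "(\<integral>x. u n x * iter_partial xs \<phi> x \<partial>Leb) = (- 1) ^ length xs * (\<integral>x. g n x * \<phi> x \<partial>Leb)" for n
    using wd[of n] \<phi> by (simp add: has_weak_deriv_def)
  ultimately have "(\<lambda>n. (- 1) ^ length xs * (\<integral>x. g n x * \<phi> x \<partial>Leb)) \<longlonglongrightarrow> (\<integral>x. v x * iter_partial xs \<phi> x \<partial>Leb)"
    by simp
  moreover have "(\<lambda>n. (- 1) ^ length xs * (\<integral>x. g n x * \<phi> x \<partial>Leb)) \<longlonglongrightarrow> (- 1) ^ length xs * (\<integral>x. h x * \<phi> x \<partial>Leb)"
    using integral_inner_tendsto[OF has_weak_deriv_sqint[OF wd] s(3) p(1) lim(2)] by (intro tendsto_mult tendsto_const) simp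
  ultimately show "(\<integral>x. v x * iter_partial xs \<phi> x \<partial>Leb) = (- 1) ^ length xs * (\<integral>x. h x * \<phi> x \<partial>Leb)"
    by (rule LIMSEQ_unique)
qed

text \<open>Only the product with the test function has compact support, so the product rule is
  integrated for \<open>\<psi> x * \<phi> x\<close>, whose partial derivative has integral
  0.\<close>

lemma has_weak_deriv_smooth:
  assumes \<psi>: "smooth \<psi>" shows "has_weak_deriv \<Omega> [i] \<psi> (partial i \<psi>)"
  unfolding has_weak_deriv_def L2_space_iff
proof (intro conjI ballI)
  show "sqint Leb (partial i \<psi>)" by (intro sqint_smooth smooth_partial \<psi>)
  fix \<phi> assume t: "\<phi> \<in> test_functions \<Omega>"
  then have \<phi>: "smooth \<phi>" by (simp add: test_functions_def)
  \<comment> \<open>The factor \<open>b\<close> vanishes off a compact subset of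
    \<open>\<Omega>\<close>, so the integral may be taken over the whole space with respect to
    \<open>lborel\<close>.\<close>
  have *: "(\<integral>x. a x * b x \<partial>Leb) = (\<integral>x. a x * b x \<partial>lborel) \<and> integrable lborel (\<lambda>x. a x * b x)"
    if a: "smooth a" and b: "b \<in> test_functions \<Omega>" for a b
  proof -
    define K where "K = closure {x. b x \<noteq> 0}"
    have K: "compact K" "K \<subseteq> \<Omega>" and sb: "smooth b" using b by (auto simp: test_functions_def K_def)
    have b0: "b x = 0" if "x \<notin> K" for x using that closure_subset[of "{x. b x \<noteq> 0}"] unfolding K_def by blast
    have c: "continuous_on UNIV (\<lambda>x. a x * b x)"
      using a sb by (intro continuous_intros smooth_continuous)
    have "integrable lborel (\<lambda>x. indicator K x *\<^sub>R (a x * b x))"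
      by (rule borel_integrable_compact[OF K(1) continuous_on_subset[OF c subset_UNIV]])
    moreover have "(\<lambda>x. indicator K x *\<^sub>R (a x * b x)) = (\<lambda>x. a x * b x)"
      using b0 by (fastforce simp: indicator_def)
    ultimately have i: "integrable lborel (\<lambda>x. a x * b x)" by metis
    have "(\<integral>x. a x * b x \<partial>Leb) = (\<integral>x. indicator \<Omega> x *\<^sub>R (a x * b x) \<partial>lebesgue)"
      using dom_sets by (simp add: integral_restrict_space)
    also have "(\<lambda>x. indicator \<Omega> x *\<^sub>R (a x * b x)) = (\<lambda>x. a x * b x)"
      using b0 K(2) by (auto simp: indicator_def fun_eq_iff)
    also have "(\<integral>x. a x * b x \<partial>lebesgue) = (\<integral>x. a x * b x \<partial>lborel)"
      using c by (intro integral_completion) (simp add: borel_measurable_continuous_onI)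
    finally show ?thesis using i by simp
  qed
  have pm: "partial i (\<lambda>x. \<psi> x * \<phi> x) = (\<lambda>x. \<psi> x * partial i \<phi> x + partial i \<psi> x * \<phi> x)"
    using \<psi> \<phi> by (intro ext partial_mult smooth_differentiable)
  have "(\<integral>x. partial i (\<lambda>x. \<psi> x * \<phi> x) x \<partial>lborel) = 0"
  proof (rule integral_partial_eq_0)
    show "(\<lambda>x. \<psi> x * \<phi> x) differentiable at x" for x
      using \<psi> \<phi> by (intro differentiable_mult smooth_differentiable)
    show "continuous_on UNIV (partial i (\<lambda>x. \<psi> x * \<phi> x))"
      unfolding pm using \<psi> \<phi> by (intro continuous_intros smooth_continuous smooth_partial)
    have "compact (closure {x. \<phi> x \<noteq> 0} \<inter> closure {x. \<psi> x * \<phi> x \<noteq> 0})"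
      using t by (intro compact_Int_closed) (auto simp: test_functions_def)
    moreover have "closure {x. \<psi> x * \<phi> x \<noteq> 0} \<subseteq> closure {x. \<phi> x \<noteq> 0}"
      by (intro closure_mono) auto
    ultimately show "compact (closure {x. \<psi> x * \<phi> x \<noteq> 0})" by (simp only: Int_absorb1)
  qed
  then have 0: "(\<integral>x. \<psi> x * partial i \<phi> x + partial i \<psi> x * \<phi> x \<partial>lborel) = 0"
    unfolding pm .
  note a = *[OF \<psi> partial_test_function[OF t]] and b = *[OF smooth_partial[OF \<psi>] t]
  have "(\<integral>x. \<psi> x * partial i \<phi> x \<partial>lborel) + (\<integral>x. partial i \<psi> x * \<phi> x \<partial>lborel) = 0"
    using Bochner_Integration.integral_add[OF conjunct2[OF a] conjunct2[OF b]] 0 by (simp only:)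
  then show "(\<integral>x. \<psi> x * iter_partial [i] \<phi> x \<partial>Leb) = (- 1) ^ length [i] * (\<integral>x. partial i \<psi> x * \<phi> x \<partial>Leb)"
    by (simp add: conjunct1[OF a] conjunct1[OF b])
qed

end

text \<open>Field and Jacobian as one function with values in a Euclidean space: the H1 norm becomes
  an \<open>l2\<close> norm, from which the triangle inequality and completeness are
  inherited.\<close>

definition jet :: "(real^'d) set \<Rightarrow> ((real^'d) \<Rightarrow> (real^'d)) \<Rightarrow> (real^'d) \<Rightarrow> (real^'d) \<times> (real^'d^'d)" where
  "jet \<Omega> \<phi> x = (\<phi> x, Jac \<Omega> \<phi> x)"

definition smooth_vec :: "((real^'d) \<Rightarrow> (real^'d)) \<Rightarrow> bool" where
  "smooth_vec \<psi> \<longleftrightarrow> (\<forall>i. smooth (\<lambda>x. \<psi> x $ i))"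

section \<open>The Sobolev space H1 of vector fields\<close>

context bounded_open
begin

lemma has_weak_deriv_Nil: "sqint Leb u \<Longrightarrow> has_weak_deriv \<Omega> [] u u"
  by (simp add: has_weak_deriv_def L2_space_iff)

lemma Hk1_iff:
  "u \<in> Hk_space \<Omega> 1 \<longleftrightarrow> sqint Leb u \<and> (\<forall>j. \<exists>g. has_weak_deriv \<Omega> [j] u g)"
proof
  assume "u \<in> Hk_space \<Omega> 1"
  then show "sqint Leb u \<and> (\<forall>j. \<exists>g. has_weak_deriv \<Omega> [j] u g)"
    by (simp add: Hk_space_def L2_space_iff)
next
  assume u: "sqint Leb u \<and> (\<forall>j. \<exists>g. has_weak_deriv \<Omega> [j] u g)"
  have "\<exists>g. has_weak_deriv \<Omega> xs u g" if "length xs \<le> 1" for xs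
  proof (cases xs)
    case Nil
    then show ?thesis using u has_weak_deriv_Nil by blast
  next
    case (Cons j ys)
    then have "xs = [j]" using that by simp
    then show ?thesis using u by simp
  qed
  then show "u \<in> Hk_space \<Omega> 1" using u by (simp add: Hk_space_def L2_space_iff)
qed

lemma H1_vec_iff:
  "\<phi> \<in> H1_vec \<Omega> \<longleftrightarrow> (\<forall>i. sqint Leb (\<lambda>x. \<phi> x $ i) \<and> (\<forall>j. \<exists>g. has_weak_deriv \<Omega> [j] (\<lambda>x. \<phi> x $ i) g))"
  unfolding H1_vec_def mem_Collect_eq Hk1_iff ..

lemma H1_sqint: "\<phi> \<in> H1_vec \<Omega> \<Longrightarrow> sqint Leb \<phi>"
  unfolding sqint_vec_iff[of Leb \<phi>] H1_vec_iff by simp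

lemma H1_has_weak_deriv_Jac:
  assumes "\<phi> \<in> H1_vec \<Omega>" shows "has_weak_deriv \<Omega> [j] (\<lambda>x. \<phi> x $ i) (\<lambda>x. Jac \<Omega> \<phi> x $ i $ j)"
proof -
  have "\<exists>g. has_weak_deriv \<Omega> [j] (\<lambda>x. \<phi> x $ i) g"
    using assms by (simp add: H1_vec_iff)
  then show ?thesis unfolding Jac_def weak_deriv_def by (simp add: someI_ex)
qed

lemma sqint_Jac:
  assumes "\<phi> \<in> H1_vec \<Omega>" shows "sqint Leb (Jac \<Omega> \<phi>)"
  unfolding sqint_vec_iff[of Leb "Jac \<Omega> \<phi>"]
proof
  fix i
  show "sqint Leb (\<lambda>x. Jac \<Omega> \<phi> x $ i)"
    unfolding sqint_vec_iff[of Leb "\<lambda>x. Jac \<Omega> \<phi> x $ i"]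
    using has_weak_deriv_sqint[OF H1_has_weak_deriv_Jac[OF assms]] by blast
qed

text \<open>The route from explicit derivatives to \<open>Jac\<close>: by uniqueness the chosen
  representatives agree almost everywhere with \<open>D\<close> in each of the finitely many
  entries.\<close>

lemma H1_vecI:
  assumes "sqint Leb \<phi>" "\<And>i j. has_weak_deriv \<Omega> [j] (\<lambda>x. \<phi> x $ i) (\<lambda>x. D x $ i $ j)"
  shows "\<phi> \<in> H1_vec \<Omega>" "AE x in Leb. Jac \<Omega> \<phi> x = D x"
proof -
  have c: "\<forall>i. sqint Leb (\<lambda>x. \<phi> x $ i)" using assms(1) unfolding sqint_vec_iff[of Leb \<phi>] .
  then show 1: "\<phi> \<in> H1_vec \<Omega>"
    using assms(2) unfolding H1_vec_iff by blast
  have "\<forall>i\<in>UNIV. \<forall>j\<in>UNIV. AE x in Leb. Jac \<Omega> \<phi> x $ i $ j = D x $ i $ j"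
    using has_weak_deriv_unique[OF H1_has_weak_deriv_Jac[OF 1] assms(2)] by simp
  then have "AE x in Leb. \<forall>i\<in>UNIV. \<forall>j\<in>UNIV. Jac \<Omega> \<phi> x $ i $ j = D x $ i $ j"
    by (intro AE_finite_allI finite) auto
  then show "AE x in Leb. Jac \<Omega> \<phi> x = D x"
    by eventually_elim (simp add: vec_eq_iff)
qed

lemma sqint_jet: "\<phi> \<in> H1_vec \<Omega> \<Longrightarrow> sqint Leb (jet \<Omega> \<phi>)"
  using sqint_Pair(1)[OF H1_sqint sqint_Jac] by (simp add: jet_def[abs_def])

lemma H1_norm_eq: "\<phi> \<in> H1_vec \<Omega> \<Longrightarrow> H1_norm \<Omega> \<phi> = l2 Leb (jet \<Omega> \<phi>)"
  unfolding H1_norm_def L2_norm_eq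
  using sqint_Pair(2)[OF H1_sqint sqint_Jac] by (metis (no_types, lifting) ext jet_def l2_nonneg real_sqrt_unique)

lemma H1_lincomb:
  assumes "\<phi> \<in> H1_vec \<Omega>" "\<psi> \<in> H1_vec \<Omega>"
  shows "(\<lambda>x. c *\<^sub>R \<phi> x + d *\<^sub>R \<psi> x) \<in> H1_vec \<Omega>"
    "AE x in Leb. jet \<Omega> (\<lambda>x. c *\<^sub>R \<phi> x + d *\<^sub>R \<psi> x) x = c *\<^sub>R jet \<Omega> \<phi> x + d *\<^sub>R jet \<Omega> \<psi> x"
proof -
  have s: "sqint Leb (\<lambda>x. c *\<^sub>R \<phi> x + d *\<^sub>R \<psi> x)"
    using assms by (intro sqint_add sqint_scaleR H1_sqint)
  have c: "sqint Leb (\<lambda>x. \<phi> x $ i)" "sqint Leb (\<lambda>x. \<psi> x $ i)" for i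
    using H1_sqint[OF assms(1)] H1_sqint[OF assms(2)] sqint_vec_iff by blast+
  have w: "has_weak_deriv \<Omega> [j] (\<lambda>x. (c *\<^sub>R \<phi> x + d *\<^sub>R \<psi> x) $ i) (\<lambda>x. (c *\<^sub>R Jac \<Omega> \<phi> x + d *\<^sub>R Jac \<Omega> \<psi> x) $ i $ j)" for i j
    using has_weak_deriv_lincomb[OF H1_has_weak_deriv_Jac[OF assms(1)] H1_has_weak_deriv_Jac[OF assms(2)] c] by simp
  show "(\<lambda>x. c *\<^sub>R \<phi> x + d *\<^sub>R \<psi> x) \<in> H1_vec \<Omega>" by (rule H1_vecI(1)[OF s w])
  have "AE x in Leb. Jac \<Omega> (\<lambda>x. c *\<^sub>R \<phi> x + d *\<^sub>R \<psi> x) x = c *\<^sub>R Jac \<Omega> \<phi> x + d *\<^sub>R Jac \<Omega> \<psi> x"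
    by (rule H1_vecI(2)[OF s w])
  then show "AE x in Leb. jet \<Omega> (\<lambda>x. c *\<^sub>R \<phi> x + d *\<^sub>R \<psi> x) x = c *\<^sub>R jet \<Omega> \<phi> x + d *\<^sub>R jet \<Omega> \<psi> x"
    by eventually_elim (simp add: jet_def)
qed

lemma H1_diff:
  assumes "\<phi> \<in> H1_vec \<Omega>" "\<psi> \<in> H1_vec \<Omega>"
  shows "(\<lambda>x. \<phi> x - \<psi> x) \<in> H1_vec \<Omega>"
    "AE x in Leb. jet \<Omega> (\<lambda>x. \<phi> x - \<psi> x) x = jet \<Omega> \<phi> x - jet \<Omega> \<psi> x"
  using H1_lincomb[OF assms, of 1 "-1"] by simp_all

lemma H1_norm_diff:
  assumes "\<phi> \<in> H1_vec \<Omega>" "\<psi> \<in> H1_vec \<Omega>"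
  shows "H1_norm \<Omega> (\<lambda>x. \<phi> x - \<psi> x) = l2 Leb (\<lambda>x. jet \<Omega> \<phi> x - jet \<Omega> \<psi> x)"
  unfolding H1_norm_eq[OF H1_diff(1)[OF assms]]
  by (rule l2_cong_AE[OF H1_diff(2)[OF assms]])
     (use sqintD(1)[OF sqint_jet[OF H1_diff(1)[OF assms]]] sqintD(1)[OF sqint_diff[OF sqint_jet[OF assms(1)] sqint_jet[OF assms(2)]]] in auto)

lemma H1_norm_nonneg: "0 \<le> H1_norm \<Omega> \<phi>"
  by (simp add: H1_norm_def)

lemma H1_norm_triangle:
  assumes "\<phi> \<in> H1_vec \<Omega>" "\<psi> \<in> H1_vec \<Omega>" "\<theta> \<in> H1_vec \<Omega>"
  shows "H1_norm \<Omega> (\<lambda>x. \<phi> x - \<theta> x) \<le> H1_norm \<Omega> (\<lambda>x. \<phi> x - \<psi> x) + H1_norm \<Omega> (\<lambda>x. \<psi> x - \<theta> x)"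
  unfolding H1_norm_diff[OF assms(1,3)] H1_norm_diff[OF assms(1,2)] H1_norm_diff[OF assms(2,3)]
  by (rule l2_triangle3) (use assms in \<open>auto intro: sqint_jet\<close>)

lemma H1_norm_minus_commute:
  assumes "\<phi> \<in> H1_vec \<Omega>" "\<psi> \<in> H1_vec \<Omega>"
  shows "H1_norm \<Omega> (\<lambda>x. \<phi> x - \<psi> x) = H1_norm \<Omega> (\<lambda>x. \<psi> x - \<phi> x)"
  unfolding H1_norm_diff[OF assms] H1_norm_diff[OF assms(2,1)] by (rule l2_minus_commute)

text \<open>The jets converge in L2; closedness of weak differentiation shows that the second
  component of the limit is the derivative of the first.\<close>

lemma H1_complete:
  assumes \<phi>: "\<And>n. \<phi> n \<in> H1_vec \<Omega>"
    and Cauchy: "\<And>e. e > 0 \<Longrightarrow> \<exists>N. \<forall>m\<ge>N. \<forall>n\<ge>N. H1_norm \<Omega> (\<lambda>x. \<phi> m x - \<phi> n x) < e"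
  shows "\<exists>\<psi>\<in>H1_vec \<Omega>. (\<lambda>n::nat. H1_norm \<Omega> (\<lambda>x. \<phi> n x - \<psi> x)) \<longlonglongrightarrow> 0"
proof -
  have sj: "sqint Leb (jet \<Omega> (\<phi> n))" for n by (rule sqint_jet[OF \<phi>])
  obtain U where U: "sqint Leb U" "(\<lambda>n. l2 Leb (\<lambda>x. jet \<Omega> (\<phi> n) x - U x)) \<longlonglongrightarrow> 0"
    using l2_complete[OF finite_Leb sj Cauchy[unfolded H1_norm_diff[OF \<phi> \<phi>]]] by blast
  define \<psi> where "\<psi> = (\<lambda>x. fst (U x))"
  define D where "D = (\<lambda>x. snd (U x))"
  have s\<psi>: "sqint Leb \<psi>" unfolding \<psi>_def by (rule sqint_bounded_linear[OF U(1) bounded_linear_fst])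
  have w: "has_weak_deriv \<Omega> [j] (\<lambda>x. \<psi> x $ i) (\<lambda>x. D x $ i $ j)" for i j
  proof (rule has_weak_deriv_tendsto[OF H1_has_weak_deriv_Jac[OF \<phi>]])
    have b1: "bounded_linear (\<lambda>p::(real^'d)\<times>(real^'d^'d). fst p $ i)"
      using bounded_linear_compose[OF bounded_linear_vec_nth bounded_linear_fst] .
    have b2: "bounded_linear (\<lambda>p::(real^'d)\<times>(real^'d^'d). snd p $ i $ j)"
      using bounded_linear_compose[OF bounded_linear_vec_nth bounded_linear_compose[OF bounded_linear_vec_nth bounded_linear_snd]] .
    show "sqint Leb (\<lambda>x. \<phi> n x $ i)" for n
      using sqint_bounded_linear[OF sj b1] by (simp add: jet_def)
    show "sqint Leb (\<lambda>x. \<psi> x $ i)" "sqint Leb (\<lambda>x. D x $ i $ j)"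
      unfolding \<psi>_def D_def using sqint_bounded_linear[OF U(1) b1] sqint_bounded_linear[OF U(1) b2] by simp_all
    show "(\<lambda>n. l2 Leb (\<lambda>x. \<phi> n x $ i - \<psi> x $ i)) \<longlonglongrightarrow> 0"
      unfolding \<psi>_def using l2_bounded_linear_tendsto[OF sj U b1] by (simp add: jet_def)
    show "(\<lambda>n. l2 Leb (\<lambda>x. Jac \<Omega> (\<phi> n) x $ i $ j - D x $ i $ j)) \<longlonglongrightarrow> 0"
      unfolding D_def using l2_bounded_linear_tendsto[OF sj U b2] by (simp add: jet_def)
  qed
  note \<psi> = H1_vecI[OF s\<psi> w]
  have "AE x in Leb. jet \<Omega> \<psi> x = U x"
    using \<psi>(2) by eventually_elim (simp add: jet_def \<psi>_def D_def)
  then have "l2 Leb (\<lambda>x. jet \<Omega> (\<phi> n) x - U x) = l2 Leb (\<lambda>x. jet \<Omega> (\<phi> n) x - jet \<Omega> \<psi> x)" for n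
    by (intro l2_cong_AE sqintD(1)[OF sqint_diff] sj U(1) sqint_jet \<psi>(1)) auto
  then have "(\<lambda>n. H1_norm \<Omega> (\<lambda>x. \<phi> n x - \<psi> x)) \<longlonglongrightarrow> 0"
    using U(2) by (simp add: H1_norm_diff[OF \<phi> \<psi>(1)])
  then show ?thesis using \<psi>(1) by blast
qed

lemma smooth_vec_H1:
  assumes "smooth_vec \<psi>"
  shows "\<psi> \<in> H1_vec \<Omega>" "AE x in Leb. Jac \<Omega> \<psi> x = (\<chi> i j. partial j (\<lambda>y. \<psi> y $ i) x)"
proof -
  have "sqint Leb \<psi>" unfolding sqint_vec_iff[of Leb \<psi>]
    using assms sqint_smooth by (auto simp: smooth_vec_def)
  moreover have "has_weak_deriv \<Omega> [j] (\<lambda>x. \<psi> x $ i) (\<lambda>x. (\<chi> i j. partial j (\<lambda>y. \<psi> y $ i) x) $ i $ j)" for i j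
    using has_weak_deriv_smooth[of "\<lambda>x. \<psi> x $ i" j] assms by (simp add: smooth_vec_def)
  ultimately show "\<psi> \<in> H1_vec \<Omega>" "AE x in Leb. Jac \<Omega> \<psi> x = (\<chi> i j. partial j (\<lambda>y. \<psi> y $ i) x)"
    by (rule H1_vecI)+
qed

text \<open>The Jacobians are equal everywhere, not just almost everywhere: the two fields have
  exactly the same weak derivatives, so the choice operator is applied to the same
  predicate.\<close>

lemma Jac_cong_AE:
  assumes "\<phi> \<in> H1_vec \<Omega>" "sqint Leb \<psi>" "AE x in Leb. \<phi> x = \<psi> x"
  shows "Jac \<Omega> \<phi> = Jac \<Omega> \<psi>" "\<psi> \<in> H1_vec \<Omega>"
proof -
  have m: "(\<lambda>x. \<phi> x $ i) \<in> borel_measurable Leb" "(\<lambda>x. \<psi> x $ i) \<in> borel_measurable Leb" for i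
    using sqintD(1) H1_sqint[OF assms(1)] assms(2) sqint_vec_iff by blast+
  have ae: "AE x in Leb. \<phi> x $ i = \<psi> x $ i" for i using assms(3) by eventually_elim simp
  have eq: "has_weak_deriv \<Omega> xs (\<lambda>x. \<phi> x $ i) g = has_weak_deriv \<Omega> xs (\<lambda>x. \<psi> x $ i) g" for xs i g
  proof
    assume "has_weak_deriv \<Omega> xs (\<lambda>x. \<phi> x $ i) g"
    then show "has_weak_deriv \<Omega> xs (\<lambda>x. \<psi> x $ i) g" by (rule has_weak_deriv_cong[OF _ ae m])
  next
    have ae': "AE x in Leb. \<psi> x $ i = \<phi> x $ i" using assms(3) by eventually_elim simp
    assume "has_weak_deriv \<Omega> xs (\<lambda>x. \<psi> x $ i) g"
    then show "has_weak_deriv \<Omega> xs (\<lambda>x. \<phi> x $ i) g" by (rule has_weak_deriv_cong[OF _ ae' m(2) m(1)])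
  qed
  show "Jac \<Omega> \<phi> = Jac \<Omega> \<psi>" unfolding Jac_def[abs_def] weak_deriv_def eq ..
  have "\<forall>i. sqint Leb (\<lambda>x. \<psi> x $ i)" using assms(2) unfolding sqint_vec_iff[of Leb \<psi>] .
  then show "\<psi> \<in> H1_vec \<Omega>"
    using assms(1) unfolding H1_vec_iff eq by blast
qed

end

section \<open>Traces on facets\<close>

lemma nn_integral_lborel_translate:
  fixes g :: "'a::euclidean_space \<Rightarrow> ennreal"
  assumes [measurable]: "g \<in> borel_measurable borel"
  shows "(\<integral>\<^sup>+x. g (x + c) \<partial>lborel) = (\<integral>\<^sup>+x. g x \<partial>lborel)"
proof -
  have "(\<integral>\<^sup>+x. g x \<partial>lborel) = (\<integral>\<^sup>+x. g x \<partial>distr lborel borel ((+) c))"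
    by (simp only: lborel_distr_plus)
  also have "\<dots> = (\<integral>\<^sup>+x. g (c + x) \<partial>lborel)" by (rule nn_integral_distr) simp_all
  finally show ?thesis by (simp add: add.commute)
qed

text \<open>The argument for the uniqueness of Haar measure; the determinant formula of the library is
  restricted to well-ordered index types.\<close>

lemma nn_integral_lborel_linear:
  fixes L L' :: "'a::euclidean_space \<Rightarrow> 'a"
  assumes L: "linear L" and inv: "\<And>x. L' (L x) = x" "\<And>x. L (L' x) = x"
  shows "\<exists>K\<ge>0. \<forall>g\<in>borel_measurable borel. (\<integral>\<^sup>+x. g (L x + c) \<partial>lborel) = ennreal K * (\<integral>\<^sup>+x. g x \<partial>lborel)"
proof -
  define B :: "'a set" where "B = box 0 One"
  define U where "U = {x. - L x \<in> B}"
  have linL': "linear L'" using linear_inverse_left inv L by (metis eq_id_iff linear_injective_left_inverse inj_on_inverseI left_inverse_linear o_def)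
  have contL: "continuous_on UNIV L" using L by (simp add: linear_continuous_on linear_conv_bounded_linear)
  have [measurable]: "L \<in> borel_measurable borel" by (rule borel_measurable_continuous_onI[OF contL])
  have [measurable]: "B \<in> sets borel" by (simp add: B_def)
  have B1: "emeasure lborel B = 1"
    by (simp add: B_def emeasure_lborel_box_eq)
  have [measurable]: "U \<in> sets borel" unfolding U_def by measurable
  have "U \<subseteq> (\<lambda>y. L' (- y)) ` B"
  proof
    fix x assume "x \<in> U"
    then show "x \<in> (\<lambda>y. L' (- y)) ` B" unfolding U_def by (intro image_eqI[of _ _ "- L x"]) (auto simp: inv)
  qed
  moreover have "bounded ((\<lambda>y. L' (- y)) ` B)"
  proof -
    have "linear (\<lambda>y. L' (- y))" using linL' by (simp add: linear_compose[unfolded o_def, OF linear_uminus])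
    then show ?thesis unfolding B_def by (intro bounded_linear_image) (auto simp: linear_conv_bounded_linear)
  qed
  ultimately have "bounded U" by (rule bounded_subset[rotated])
  then have "emeasure lborel U < \<infinity>" by (rule emeasure_bounded_finite)
  then obtain K where K: "0 \<le> K" "emeasure lborel U = ennreal K"
    by (cases "emeasure lborel U") auto
  have "(\<integral>\<^sup>+x. g (L x + c) \<partial>lborel) = ennreal K * (\<integral>\<^sup>+x. g x \<partial>lborel)"
    if g[measurable]: "g \<in> borel_measurable borel" for g :: "'a \<Rightarrow> ennreal"
  proof -
    have tr: "(\<integral>\<^sup>+x. g (L x + c) \<partial>lborel) = (\<integral>\<^sup>+x. g (L x + y) \<partial>lborel)" for y
    proof -
      have "L (x + L' (c - y)) + y = L x + c" for x
        using linear_add[OF L] by (simp add: inv)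
      then show ?thesis
        using nn_integral_lborel_translate[of "\<lambda>x. g (L x + y)" "L' (c - y)"] by simp
    qed
    \<comment> \<open>The unit box has measure 1, so averaging over \<open>y\<close> in it changes
      nothing; by \<open>tr\<close> the shift \<open>c\<close> may then be replaced by the
      integration variable.\<close>
    have "(\<integral>\<^sup>+x. g (L x + c) \<partial>lborel) = (\<integral>\<^sup>+y. indicator B y * (\<integral>\<^sup>+x. g (L x + c) \<partial>lborel) \<partial>lborel)"
      by (simp add: nn_integral_multc B1)
    also have "\<dots> = (\<integral>\<^sup>+y. indicator B y * (\<integral>\<^sup>+x. g (L x + y) \<partial>lborel) \<partial>lborel)"
    proof (rule nn_integral_cong)
      fix y
      show "indicator B y * (\<integral>\<^sup>+x. g (L x + c) \<partial>lborel) = indicator B y * (\<integral>\<^sup>+x. g (L x + y) \<partial>lborel)"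
        by (subst tr[of y]) (rule refl)
    qed
    also have "\<dots> = (\<integral>\<^sup>+y. (\<integral>\<^sup>+x. indicator B y * g (L x + y) \<partial>lborel) \<partial>lborel)"
      by (intro nn_integral_cong nn_integral_cmult[symmetric]) measurable
    also have "\<dots> = (\<integral>\<^sup>+x. (\<integral>\<^sup>+y. indicator B y * g (L x + y) \<partial>lborel) \<partial>lborel)"
      by (rule lborel_pair.Fubini') measurable
    also have "\<dots> = (\<integral>\<^sup>+x. (\<integral>\<^sup>+y. indicator B (y - L x) * g y \<partial>lborel) \<partial>lborel)"
    proof (rule nn_integral_cong)
      fix x
      show "(\<integral>\<^sup>+y. indicator B y * g (L x + y) \<partial>lborel) = (\<integral>\<^sup>+y. indicator B (y - L x) * g y \<partial>lborel)"
        using nn_integral_lborel_translate[of "\<lambda>y. indicator B (y - L x) * g y" "L x"]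
        by (simp add: add.commute)
    qed
    also have "\<dots> = (\<integral>\<^sup>+y. (\<integral>\<^sup>+x. indicator B (y - L x) * g y \<partial>lborel) \<partial>lborel)"
      by (rule lborel_pair.Fubini'[symmetric]) measurable
    also have "\<dots> = (\<integral>\<^sup>+y. ennreal K * g y \<partial>lborel)"
    proof (rule nn_integral_cong)
      fix y
      have "(\<integral>\<^sup>+x. indicator B (y - L x) * g y \<partial>lborel) = (\<integral>\<^sup>+x. indicator B (y - L x) \<partial>lborel) * g y"
        by (rule nn_integral_multc) measurable
      \<comment> \<open>Translating by \<open>L' y\<close> removes \<open>y\<close> from the
        integrand; what remains is the measure of \<open>U\<close>, the same for every
        \<open>y\<close>.\<close>
      also have "(\<integral>\<^sup>+x. indicator B (y - L x) \<partial>lborel) = (\<integral>\<^sup>+x. indicator B (y - L (x + L' y)) \<partial>lborel)"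
        by (rule nn_integral_lborel_translate[symmetric]) measurable
      also have "\<dots> = (\<integral>\<^sup>+x. indicator U x \<partial>lborel)"
        by (rule nn_integral_cong) (auto simp: U_def indicator_def linear_add[OF L] inv)
      also have "\<dots> = ennreal K" using K by simp
      finally show "(\<integral>\<^sup>+x. indicator B (y - L x) * g y \<partial>lborel) = ennreal K * g y" .
    qed
    also have "\<dots> = ennreal K * (\<integral>\<^sup>+x. g x \<partial>lborel)" by (rule nn_integral_cmult) measurable
    finally show ?thesis .
  qed
  then show ?thesis using K(1) by blast
qed

text \<open>Fundamental theorem of calculus and Cauchy-Schwarz on an interval of length at most 1;
  the factors 2 come from squaring a sum. The right side is a nonnegative integral, ready for
  Fubini's theorem.\<close>

lemma sq_le_sq_plus_integral_deriv:
  fixes k k' :: "real \<Rightarrow> real"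
  assumes a: "0 \<le> a" "a \<le> 1" and der: "\<And>t. (k has_real_derivative k' t) (at t)"
    and cont: "continuous_on UNIV k'"
  shows "ennreal ((k a)\<^sup>2) \<le> 2 * ennreal ((k 0)\<^sup>2) + 2 * (\<integral>\<^sup>+t. ennreal ((k' t)\<^sup>2) * indicator {0..a} t \<partial>lborel)"
proof -
  let ?i = "indicator {0..a} :: real \<Rightarrow> real"
  have s1: "sqint lborel ?i" unfolding sqint_def
  proof
    have "(norm (?i x))\<^sup>2 = ?i x" for x by (simp add: indicator_def)
    moreover have "integrable lborel ?i"
      using borel_integrable_compact[of "{0..a}" "\<lambda>x. 1::real"] by simp
    ultimately show "integrable lborel (\<lambda>x. (norm (?i x))\<^sup>2)" by simp
  qed simp
  have l1: "l2 lborel ?i \<le> 1"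
  proof -
    have "(norm (?i x))\<^sup>2 = ?i x" for x by (simp add: indicator_def)
    then show ?thesis using a by (simp add: l2_def)
  qed
  have [measurable]: "k' \<in> borel_measurable borel" by (rule borel_measurable_continuous_onI[OF cont])
  have i2: "integrable lborel (\<lambda>t. indicator {0..a} t *\<^sub>R (k' t)\<^sup>2)"
    by (rule borel_integrable_compact) (auto intro!: continuous_intros continuous_on_subset[OF cont])
  have e2: "(norm (k' t * ?i t))\<^sup>2 = indicator {0..a} t *\<^sub>R (k' t)\<^sup>2" for t
    by (simp add: indicator_def)
  have s2: "sqint lborel (\<lambda>t. k' t * ?i t)" unfolding sqint_def e2 using i2 by simp
  have "(\<integral>t. k' t * indicator {0..a} t \<partial>lborel) = k a - k 0"
    by (rule integral_FTC_Icc_real[OF a(1)])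
       (use der cont in \<open>auto intro: has_field_derivative_at_within simp: continuous_on_eq_continuous_at\<close>)
  moreover have "(\<integral>t. (k' t * ?i t) \<bullet> ?i t \<partial>lborel) = (\<integral>t. k' t * indicator {0..a} t \<partial>lborel)"
    by (rule Bochner_Integration.integral_cong) (auto simp: indicator_def)
  ultimately have "\<bar>k a - k 0\<bar> \<le> l2 lborel (\<lambda>t. k' t * ?i t) * l2 lborel ?i"
    using l2_Cauchy_Schwarz[OF s2 s1] by simp
  also have "\<dots> \<le> l2 lborel (\<lambda>t. k' t * ?i t)"
    using mult_left_mono[OF l1 l2_nonneg] by simp
  finally have "\<bar>k a - k 0\<bar>\<^sup>2 \<le> (l2 lborel (\<lambda>t. k' t * ?i t))\<^sup>2" by (rule power_mono) simp
  moreover have "(k a)\<^sup>2 \<le> 2 * (k 0)\<^sup>2 + 2 * (k a - k 0)\<^sup>2"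
    using norm_add_sq_le[of "k 0" "k a - k 0"] by simp
  ultimately have "(k a)\<^sup>2 \<le> 2 * (k 0)\<^sup>2 + 2 * (l2 lborel (\<lambda>t. k' t * ?i t))\<^sup>2" by simp
  then have "ennreal ((k a)\<^sup>2) \<le> ennreal (2 * (k 0)\<^sup>2 + 2 * (l2 lborel (\<lambda>t. k' t * ?i t))\<^sup>2)"
    by (rule ennreal_leI)
  also have "\<dots> = 2 * ennreal ((k 0)\<^sup>2) + 2 * ennreal ((l2 lborel (\<lambda>t. k' t * ?i t))\<^sup>2)"
    by (simp add: ennreal_plus ennreal_mult)
  also have "ennreal ((l2 lborel (\<lambda>t. k' t * ?i t))\<^sup>2) = (\<integral>\<^sup>+t. ennreal ((k' t)\<^sup>2) * indicator {0..a} t \<partial>lborel)"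
    unfolding nn_integral_l2[OF s2, symmetric]
    by (rule nn_integral_cong) (simp add: indicator_def)
  finally show ?thesis .
qed

subsection \<open>Surface measure\<close>

text \<open>For a unit vector \<open>n\<close> this is the closed form of
  \<open>closest_point\<close> for the hyperplane; as an affine map it is visibly continuous and
  measurable.\<close>

definition hproj :: "real^'d \<Rightarrow> real \<Rightarrow> real^'d \<Rightarrow> real^'d" where
  "hproj n c x = x - (n \<bullet> x - c) *\<^sub>R n"

lemma hproj_hyperplane: "norm n = 1 \<Longrightarrow> n \<bullet> hproj n c x = c"
  by (simp add: hproj_def inner_diff_right dot_square_norm)

lemma closest_point_hyperplane:
  assumes n: "norm n = 1"
  shows "closest_point {x. n \<bullet> x = c} x = hproj n c x" "infdist x {x. n \<bullet> x = c} = \<bar>n \<bullet> x - c\<bar>"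
proof -
  have d: "dist x (hproj n c x) = \<bar>n \<bullet> x - c\<bar>"
    using n by (simp add: hproj_def dist_norm)
  have le: "dist x (hproj n c x) \<le> dist x z" if "n \<bullet> z = c" for z
  proof -
    have "\<bar>n \<bullet> (x - z)\<bar> \<le> norm n * norm (x - z)" by (rule Cauchy_Schwarz_ineq2)
    then show ?thesis using n that unfolding d by (simp add: inner_diff_right dist_norm)
  qed
  have cl: "closed {x. n \<bullet> x = c}" by (rule closed_hyperplane)
  show cp: "closest_point {x. n \<bullet> x = c} x = hproj n c x"
    by (rule closest_point_unique[symmetric])
       (use le hproj_hyperplane[OF n] cl convex_hyperplane in auto)
  have "{x. n \<bullet> x = c} \<noteq> {}" using hproj_hyperplane[OF n] by blast
  from setdist_closest_point[OF cl this, of x]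
  show "infdist x {x. n \<bullet> x = c} = \<bar>n \<bullet> x - c\<bar>"
    unfolding infdist_eq_setdist cp d .
qed

text \<open>\<open>slab n c F\<close> is the cylinder in the definition of \<^const>\<open>surface_measure\<close> when \<open>n \<bullet> x = c\<close> is the
  hyperplane spanned by \<open>F\<close>.\<close>

definition slab :: "real^'d \<Rightarrow> real \<Rightarrow> (real^'d) set \<Rightarrow> (real^'d) set" where
  "slab n c F = {x. hproj n c x \<in> F \<and> \<bar>n \<bullet> x - c\<bar> \<le> 1/2}"

lemma slabD:
  assumes "x \<in> slab n c F"
  shows "hproj n c x \<in> F" "0 \<le> n \<bullet> x - c + 1/2" "n \<bullet> x - c + 1/2 \<le> 1"
proof -
  have "\<bar>n \<bullet> x - c\<bar> \<le> 1/2" and "hproj n c x \<in> F" using assms by (simp_all only: slab_def mem_Collect_eq)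
  then show "hproj n c x \<in> F" "0 \<le> n \<bullet> x - c + 1/2" "n \<bullet> x - c + 1/2 \<le> 1" by linarith+
qed

lemma continuous_hproj: "continuous_on UNIV (hproj n c)"
  unfolding hproj_def by (intro continuous_intros)

lemma measurable_hproj [measurable]: "hproj n c \<in> borel_measurable borel"
  by (rule borel_measurable_continuous_onI[OF continuous_hproj])

lemma slab_sets: "closed F \<Longrightarrow> slab n c F \<in> sets borel"
proof -
  assume "closed F"
  then have [measurable]: "F \<in> sets borel" by simp
  show ?thesis unfolding slab_def by measurable
qed

lemma bounded_slab:
  assumes "bounded F" "norm n = 1" shows "bounded (slab n c F)"
proof -
  obtain R where R: "\<And>x. x \<in> F \<Longrightarrow> norm x \<le> R" using assms(1) by (auto simp: bounded_iff)
  have "norm x \<le> R + 1/2" if "x \<in> slab n c F" for x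
  proof -
    have "norm (x - hproj n c x) \<le> 1/2" using that assms(2) by (simp add: slab_def hproj_def)
    moreover have "norm (hproj n c x) \<le> R" using that R by (simp add: slab_def)
    ultimately show ?thesis using norm_triangle_sub[of x "hproj n c x"] by linarith
  qed
  then show ?thesis by (auto simp: bounded_iff)
qed

lemma sets_surface_measure [simp, measurable_cong]: "sets (surface_measure F) = sets borel"
  by (simp add: surface_measure_def)

text \<open>Unfolds the image measure: facet integrals become volume integrals over the slab, to
  which translation invariance applies.\<close>

lemma nn_integral_surface_measure:
  assumes n: "norm n = 1" and aff: "affine hull F = {x. n \<bullet> x = c}" and F: "closed F"
    and [measurable]: "g \<in> borel_measurable borel"
  shows "(\<integral>\<^sup>+x. g x \<partial>surface_measure F) = (\<integral>\<^sup>+x. g (hproj n c x) * indicator (slab n c F) x \<partial>lborel)"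
proof -
  have cp: "closest_point (affine hull F) = hproj n c"
    unfolding aff using closest_point_hyperplane(1)[OF n] by blast
  have sl: "{x. closest_point (affine hull F) x \<in> F \<and> infdist x (affine hull F) \<le> 1 / 2} = slab n c F"
    unfolding cp slab_def unfolding aff closest_point_hyperplane(2)[OF n] ..
  have [measurable]: "slab n c F \<in> sets borel" by (rule slab_sets[OF F])
  have "(\<integral>\<^sup>+x. g x \<partial>surface_measure F) = (\<integral>\<^sup>+x. g (hproj n c x) \<partial>restrict_space lborel (slab n c F))"
    unfolding surface_measure_def sl unfolding cp
    by (rule nn_integral_distr) (simp_all add: measurable_restrict_space1)
  also have "\<dots> = (\<integral>\<^sup>+x. g (hproj n c x) * indicator (slab n c F) x \<partial>lborel)"
    by (rule nn_integral_restrict_space) simp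
  finally show ?thesis .
qed

lemma facet_hyperplane:
  fixes T :: "(real^'d) set"
  assumes "F facet_of T" "interior T \<noteq> {}"
  shows "\<exists>n c. norm n = 1 \<and> affine hull F = {x. n \<bullet> x = c}"
proof -
  have "aff_dim F = aff_dim T - 1" using assms(1) by (simp add: facet_of_def)
  moreover have "aff_dim T = DIM(real^'d)" using assms(2) by (rule aff_dim_nonempty_interior)
  ultimately obtain a b where ab: "a \<noteq> 0" "affine hull F = {x. a \<bullet> x = b}"
    using aff_dim_eq_hyperplane[of F] by auto
  have "a \<bullet> x = b \<longleftrightarrow> (a /\<^sub>R norm a) \<bullet> x = b / norm a" for x
    using ab(1) by (simp add: field_simps)
  then have "{x. a \<bullet> x = b} = {x. (a /\<^sub>R norm a) \<bullet> x = b / norm a}" by blast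
  moreover have "norm (a /\<^sub>R norm a) = 1" using ab(1) by simp
  ultimately show ?thesis using ab(2) by blast
qed

lemma facet_compact:
  assumes "F facet_of T" "compact T" "convex T"
  shows "compact F" "F \<subseteq> T" "F \<noteq> {}"
  using assms face_of_imp_compact[of T F] by (auto simp: facet_of_def face_of_imp_subset)

lemma finite_surface_measure:
  fixes T :: "(real^'d) set"
  assumes "F facet_of T" "compact T" "convex T" "interior T \<noteq> {}"
  shows "finite_measure (surface_measure F)"
proof
  obtain n c where nc: "norm n = 1" "affine hull F = {x. n \<bullet> x = c}" using facet_hyperplane[OF assms(1,4)] by blast
  have F: "closed F" "bounded F" using facet_compact[OF assms(1-3)] by (auto simp: compact_imp_closed compact_imp_bounded)
  have "emeasure (surface_measure F) (space (surface_measure F)) = (\<integral>\<^sup>+x. 1 \<partial>surface_measure F)"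
    by simp
  also have "\<dots> = emeasure lborel (slab n c F)"
    unfolding nn_integral_surface_measure[OF nc F(1) borel_measurable_const] using slab_sets[OF F(1)] by simp
  also have "\<dots> < \<infinity>" by (rule emeasure_bounded_finite[OF bounded_slab[OF F(2) nc(1)]])
  finally show "emeasure (surface_measure F) (space (surface_measure F)) \<noteq> \<infinity>" by simp
qed


subsection \<open>The trace inequality\<close>

lemma frechet_derivative_eq_sum_partial:
  assumes "smooth \<psi>"
  shows "frechet_derivative \<psi> (at x) w = (\<Sum>i\<in>UNIV. w $ i * partial i \<psi> x)"
proof -
  have lin: "linear (frechet_derivative \<psi> (at x))"
    by (rule linear_frechet_derivative[OF smooth_differentiable[OF assms]])
  have "frechet_derivative \<psi> (at x) w = frechet_derivative \<psi> (at x) (\<Sum>i\<in>UNIV. w $ i *s axis i 1)"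
    by (simp add: basis_expansion)
  also have "\<dots> = (\<Sum>i\<in>UNIV. w $ i * partial i \<psi> x)"
    unfolding scalar_mult_eq_scaleR linear_sum[OF lin] linear_cmul[OF lin] partial_def by simp
  finally show ?thesis .
qed

text \<open>The height \<open>t \<in> [-1/2, 1/2]\<close> of a point of the slab over \<open>y \<in> F\<close> is used as the parameter of the
  segment from \<open>y\<close> to \<open>y + w\<close>: the affine map \<open>\<Phi>\<close> below sends it to \<open>y + (t + 1/2) w \<in> T\<close>. Moving
  down the segment is then a translation of the slab along \<open>n\<close>.\<close>

lemma oblique_trace_inequality:
  fixes T F :: "(real^'d) set" and n w :: "real^'d"
  assumes n: "norm n = 1" and F: "closed F" and T: "closed T" and w: "n \<bullet> w \<noteq> 0"
    and into: "\<And>y \<tau>. y \<in> F \<Longrightarrow> 0 \<le> \<tau> \<Longrightarrow> \<tau> \<le> 1 \<Longrightarrow> y + \<tau> *\<^sub>R w \<in> T"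
  shows "\<exists>K\<ge>0. \<forall>\<psi>. smooth \<psi> \<longrightarrow>
    (\<integral>\<^sup>+x. ennreal ((\<psi> (hproj n c x))\<^sup>2) * indicator (slab n c F) x \<partial>lborel)
      \<le> ennreal K * (\<integral>\<^sup>+x. ennreal ((\<psi> x)\<^sup>2 + (frechet_derivative \<psi> (at x) w)\<^sup>2) * indicator T x \<partial>lborel)"
proof -
  \<comment> \<open>\<open>L\<close> fixes the vectors orthogonal to \<open>n\<close> and sends
    \<open>n\<close> to \<open>w\<close>; since \<open>w\<close> is not parallel to the hyperplane
    it is invertible, with inverse \<open>L'\<close>.\<close>
  define L where "L = (\<lambda>x. x + (n \<bullet> x) *\<^sub>R (w - n))"
  define L' where "L' = (\<lambda>y. y - ((n \<bullet> y) / (n \<bullet> w)) *\<^sub>R (w - n))"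
  \<comment> \<open>The shift is chosen so that \<open>\<Phi>\<close> coincides with the projection
    on the bottom face of the slab and adds \<open>w\<close> to it on the top face.\<close>
  define v where "v = c *\<^sub>R n + (1/2 - c) *\<^sub>R w"
  define \<Phi> where "\<Phi> = (\<lambda>x. L x + v)"
  have nn: "n \<bullet> n = 1" using n by (simp add: dot_square_norm)
  have "linear L" unfolding L_def
    by (rule linearI) (auto simp: inner_add_right algebra_simps)
  moreover have nL: "n \<bullet> L x = (n \<bullet> x) * (n \<bullet> w)" for x
    by (simp add: L_def inner_add_right inner_diff_right nn algebra_simps)
  moreover have nL': "n \<bullet> L' y = (n \<bullet> y) / (n \<bullet> w)" for y
    using w by (simp add: L'_def inner_diff_right inner_add_right nn right_diff_distrib)
  moreover have "L' (L x) = x" for x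
    unfolding L'_def nL using w by (simp add: L_def)
  moreover have "L (L' y) = y" for y
    unfolding L_def nL' by (simp add: L'_def)
  ultimately obtain K where K: "K \<ge> 0" "\<And>g. g \<in> borel_measurable borel \<Longrightarrow>
      (\<integral>\<^sup>+x. g (\<Phi> x) \<partial>lborel) = ennreal K * (\<integral>\<^sup>+x. g x \<partial>lborel)"
    unfolding \<Phi>_def using nn_integral_lborel_linear[of L L' v] by blast
  have \<Phi>_eq: "\<Phi> x = hproj n c x + (n \<bullet> x - c + 1/2) *\<^sub>R w" for x
    by (simp add: \<Phi>_def L_def v_def hproj_def algebra_simps)
  have \<Phi>_shift: "\<Phi> (x - t *\<^sub>R n) = hproj n c x + ((n \<bullet> x - c + 1/2) - t) *\<^sub>R w" for x t
    unfolding \<Phi>_eq by (simp add: hproj_def inner_diff_right nn algebra_simps)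
  have c\<Phi>: "continuous_on UNIV \<Phi>"
    unfolding \<Phi>_def L_def by (intro continuous_intros)
  have [measurable]: "\<Phi> \<in> borel_measurable borel" by (rule borel_measurable_continuous_onI[OF c\<Phi>])
  have Sm[measurable]: "slab n c F \<in> sets borel" by (rule slab_sets[OF F])
  have Tm[measurable]: "T \<in> sets borel" using T by simp
  have slabT: "\<Phi> x \<in> T" if "x \<in> slab n c F" for x
    unfolding \<Phi>_eq by (rule into) (rule slabD[OF that])+
  have "(\<integral>\<^sup>+x. ennreal ((\<psi> (hproj n c x))\<^sup>2) * indicator (slab n c F) x \<partial>lborel)
      \<le> ennreal (2 * K) * (\<integral>\<^sup>+x. ennreal ((\<psi> x)\<^sup>2 + (frechet_derivative \<psi> (at x) w)\<^sup>2) * indicator T x \<partial>lborel)"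
    if \<psi>: "smooth \<psi>" for \<psi>
  proof -
    define D where "D = (\<lambda>x. frechet_derivative \<psi> (at x) w)"
    have cD: "continuous_on UNIV D"
      unfolding D_def frechet_derivative_eq_sum_partial[OF \<psi>]
      by (intro continuous_intros smooth_continuous smooth_partial \<psi>)
    have [measurable]: "D \<in> borel_measurable borel" by (rule borel_measurable_continuous_onI[OF cD])
    have [measurable]: "\<psi> \<in> borel_measurable borel" by (rule smooth_borel_measurable[OF \<psi>])
    define G where "G = (\<lambda>x. ennreal ((D (\<Phi> x))\<^sup>2) * indicator (slab n c F) x)"
    have [measurable]: "G \<in> borel_measurable borel" unfolding G_def by measurable
    \<comment> \<open>For \<open>x\<close> at height \<open>a\<close> above the bottom face,
      \<open>t \<mapsto> \<psi> (\<Phi> (x - t *\<^sub>R n))\<close> runs from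
      \<open>\<psi> (\<Phi> x)\<close> to the value at the projection, reached at
      \<open>t = a\<close>.\<close>
    have pw: "ennreal ((\<psi> (hproj n c x))\<^sup>2) * indicator (slab n c F) x
        \<le> 2 * (ennreal ((\<psi> (\<Phi> x))\<^sup>2) * indicator (slab n c F) x)
          + 2 * (\<integral>\<^sup>+t. G (x - t *\<^sub>R n) * indicator {0..1} t \<partial>lborel)" for x
    proof (cases "x \<in> slab n c F")
      case True
      define a where "a = n \<bullet> x - c + 1/2"
      have a: "0 \<le> a" "a \<le> 1" unfolding a_def by (rule slabD[OF True])+
      have der: "((\<lambda>t. \<psi> (\<Phi> (x - t *\<^sub>R n))) has_real_derivative - D (\<Phi> (x - t *\<^sub>R n))) (at t)" for t
      proof -
        have d\<Phi>: "((\<lambda>t. \<Phi> (x - t *\<^sub>R n)) has_derivative (\<lambda>t. - (t *\<^sub>R w))) (at t)"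
          unfolding \<Phi>_shift by (auto intro!: derivative_eq_intros)
        have lin: "linear (frechet_derivative \<psi> (at (\<Phi> (x - t *\<^sub>R n))))"
          by (rule linear_frechet_derivative[OF smooth_differentiable[OF \<psi>]])
        from has_derivative_compose[OF d\<Phi> smooth_has_derivative[OF \<psi>]]
        have "((\<lambda>t. \<psi> (\<Phi> (x - t *\<^sub>R n))) has_derivative
            (\<lambda>s. frechet_derivative \<psi> (at (\<Phi> (x - t *\<^sub>R n))) (- (s *\<^sub>R w)))) (at t)" .
        moreover have "(\<lambda>s. frechet_derivative \<psi> (at (\<Phi> (x - t *\<^sub>R n))) (- (s *\<^sub>R w))) = (*) (- D (\<Phi> (x - t *\<^sub>R n)))"
          by (simp add: fun_eq_iff D_def linear_neg[OF lin] linear_cmul[OF lin])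
        ultimately show ?thesis
          unfolding has_field_derivative_def by simp
      qed
      have "continuous_on UNIV (\<lambda>t. D (\<Phi> (x - t *\<^sub>R n)))"
        by (intro continuous_on_compose2[OF cD] continuous_on_compose2[OF c\<Phi>] continuous_intros) auto
      then have "continuous_on UNIV (\<lambda>t. - D (\<Phi> (x - t *\<^sub>R n)))" by (intro continuous_intros)
      note main = sq_le_sq_plus_integral_deriv[OF a der this]
      have e1: "\<Phi> (x - a *\<^sub>R n) = hproj n c x" unfolding \<Phi>_shift by (simp add: a_def)
      \<comment> \<open>The upper limit \<open>a\<close> depends on \<open>x\<close>; it can be
        widened to 1 because the points with \<open>t \<le> a\<close> stay in the slab, whose
        indicator is part of \<open>G\<close>, and \<open>a \<le> 1\<close>.\<close>
      have "(\<integral>\<^sup>+t. ennreal ((- D (\<Phi> (x - t *\<^sub>R n)))\<^sup>2) * indicator {0..a} t \<partial>lborel)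
          \<le> (\<integral>\<^sup>+t. G (x - t *\<^sub>R n) * indicator {0..1} t \<partial>lborel)"
      proof (rule nn_integral_mono)
        fix t
        have "x - t *\<^sub>R n \<in> slab n c F" if "0 \<le> t" "t \<le> a"
        proof -
          have "hproj n c (x - t *\<^sub>R n) = hproj n c x"
            by (simp add: hproj_def inner_diff_right nn algebra_simps)
          moreover have "\<bar>n \<bullet> (x - t *\<^sub>R n) - c\<bar> \<le> 1/2"
            using that a unfolding a_def inner_diff_right inner_scaleR_right nn by linarith
          ultimately show ?thesis using slabD(1)[OF True] by (simp only: slab_def mem_Collect_eq simp_thms)
        qed
        then show "ennreal ((- D (\<Phi> (x - t *\<^sub>R n)))\<^sup>2) * indicator {0..a} t \<le> G (x - t *\<^sub>R n) * indicator {0..1} t"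
          using a by (auto simp: indicator_def G_def)
      qed
      then have "2 * (\<integral>\<^sup>+t. ennreal ((- D (\<Phi> (x - t *\<^sub>R n)))\<^sup>2) * indicator {0..a} t \<partial>lborel)
          \<le> 2 * (\<integral>\<^sup>+t. G (x - t *\<^sub>R n) * indicator {0..1} t \<partial>lborel)"
        by (rule mult_left_mono) simp
      with main[unfolded e1] have "ennreal ((\<psi> (hproj n c x))\<^sup>2)
        \<le> 2 * ennreal ((\<psi> (\<Phi> x))\<^sup>2) + 2 * (\<integral>\<^sup>+t. G (x - t *\<^sub>R n) * indicator {0..1} t \<partial>lborel)"
        by (simp only: scaleR_zero_left diff_zero) (meson add_left_mono order_trans)
      then show ?thesis using True by simp
    qed simp
    \<comment> \<open>For each fixed \<open>t\<close> the integral over \<open>x\<close> is that of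
      a translate of \<open>G\<close>, so averaging over the unit interval returns the integral of
      \<open>G\<close>.\<close>
    have fub: "(\<integral>\<^sup>+x. (\<integral>\<^sup>+t. G (x - t *\<^sub>R n) * indicator {0..1::real} t \<partial>lborel) \<partial>lborel) = (\<integral>\<^sup>+x. G x \<partial>lborel)"
    proof -
      have "(\<integral>\<^sup>+x. (\<integral>\<^sup>+t. G (x - t *\<^sub>R n) * indicator {0..1::real} t \<partial>lborel) \<partial>lborel)
          = (\<integral>\<^sup>+t. (\<integral>\<^sup>+x. G (x - t *\<^sub>R n) * indicator {0..1::real} t \<partial>lborel) \<partial>lborel)"
        by (rule lborel_pair.Fubini'[symmetric]) measurable
      also have "\<dots> = (\<integral>\<^sup>+t. (\<integral>\<^sup>+x. G x \<partial>lborel) * indicator {0..1::real} t \<partial>lborel)"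
      proof (rule nn_integral_cong)
        fix t :: real
        have "(\<integral>\<^sup>+x. G (x - t *\<^sub>R n) * indicator {0..1::real} t \<partial>lborel) = (\<integral>\<^sup>+x. G (x - t *\<^sub>R n) \<partial>lborel) * indicator {0..1} t"
          by (rule nn_integral_multc) measurable
        also have "(\<integral>\<^sup>+x. G (x - t *\<^sub>R n) \<partial>lborel) = (\<integral>\<^sup>+x. G x \<partial>lborel)"
          using nn_integral_lborel_translate[of G "- (t *\<^sub>R n)"] by simp
        finally show "(\<integral>\<^sup>+x. G (x - t *\<^sub>R n) * indicator {0..1::real} t \<partial>lborel) = (\<integral>\<^sup>+x. G x \<partial>lborel) * indicator {0..1} t" .
      qed
      also have "\<dots> = (\<integral>\<^sup>+x. G x \<partial>lborel)" by (simp add: nn_integral_cmult)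
      finally show ?thesis .
    qed
    have "(\<integral>\<^sup>+x. ennreal ((\<psi> (hproj n c x))\<^sup>2) * indicator (slab n c F) x \<partial>lborel)
      \<le> (\<integral>\<^sup>+x. 2 * (ennreal ((\<psi> (\<Phi> x))\<^sup>2) * indicator (slab n c F) x)
          + 2 * (\<integral>\<^sup>+t. G (x - t *\<^sub>R n) * indicator {0..1} t \<partial>lborel) \<partial>lborel)"
      by (rule nn_integral_mono) (rule pw)
    also have "\<dots> = 2 * (\<integral>\<^sup>+x. ennreal ((\<psi> (\<Phi> x))\<^sup>2) * indicator (slab n c F) x \<partial>lborel)
          + 2 * (\<integral>\<^sup>+x. (\<integral>\<^sup>+t. G (x - t *\<^sub>R n) * indicator {0..1} t \<partial>lborel) \<partial>lborel)"
      by (subst nn_integral_add) (simp_all add: nn_integral_cmult)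
    also have "\<dots> = 2 * ((\<integral>\<^sup>+x. ennreal ((\<psi> (\<Phi> x))\<^sup>2) * indicator (slab n c F) x \<partial>lborel) + (\<integral>\<^sup>+x. G x \<partial>lborel))"
      unfolding fub by (simp add: distrib_left)
    also have "(\<integral>\<^sup>+x. ennreal ((\<psi> (\<Phi> x))\<^sup>2) * indicator (slab n c F) x \<partial>lborel) + (\<integral>\<^sup>+x. G x \<partial>lborel)
      = (\<integral>\<^sup>+x. ennreal ((\<psi> (\<Phi> x))\<^sup>2) * indicator (slab n c F) x + G x \<partial>lborel)"
      by (rule nn_integral_add[symmetric]) measurable
    \<comment> \<open>\<open>\<Phi>\<close> maps the slab into \<open>T\<close>, so the indicator of
      the slab may be exchanged for that of \<open>T\<close> at \<open>\<Phi> x\<close>; a linear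
      change of variables then removes \<open>\<Phi>\<close>.\<close>
    also have "\<dots> \<le> (\<integral>\<^sup>+x. ennreal ((\<psi> (\<Phi> x))\<^sup>2 + (D (\<Phi> x))\<^sup>2) * indicator T (\<Phi> x) \<partial>lborel)"
      by (rule nn_integral_mono) (auto simp: G_def indicator_def slabT ennreal_plus)
    also have "\<dots> = ennreal K * (\<integral>\<^sup>+x. ennreal ((\<psi> x)\<^sup>2 + (D x)\<^sup>2) * indicator T x \<partial>lborel)"
      by (rule K(2)) measurable
    finally show ?thesis unfolding D_def
      using K(1) by (simp add: ennreal_mult mult.assoc mult_left_mono)
  qed
  then show ?thesis using K(1) by (intro exI[of _ "2 * K"]) auto
qed


lemma frechet_derivative_sq_le:
  fixes w :: "real^'d"
  assumes "smooth \<psi>"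
  shows "(frechet_derivative \<psi> (at x) w)\<^sup>2 \<le> (norm w)\<^sup>2 * (\<Sum>i\<in>UNIV. (partial i \<psi> x)\<^sup>2)"
proof -
  have "(frechet_derivative \<psi> (at x) w)\<^sup>2 = (w \<bullet> (\<chi> i. partial i \<psi> x))\<^sup>2"
    unfolding frechet_derivative_eq_sum_partial[OF assms] by (simp add: inner_vec_def)
  also have "\<dots> \<le> (w \<bullet> w) * ((\<chi> i. partial i \<psi> x) \<bullet> (\<chi> i. partial i \<psi> x))"
    by (rule Cauchy_Schwarz_ineq)
  also have "\<dots> = (norm w)\<^sup>2 * (\<Sum>i\<in>UNIV. (partial i \<psi> x)\<^sup>2)"
    unfolding power2_norm_eq_inner by (simp add: inner_vec_def power2_eq_square)
  finally show ?thesis .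
qed

text \<open>The piece around \<open>y\<close> is moved by the vector from \<open>y\<close> to an
  interior point \<open>x0\<close>. A piece of radius \<open>\<rho>\<close> lands in the ball of
  that radius around \<open>x0\<close>, and convexity of \<open>T\<close> covers the way there.
  Keeping the direction constant on each piece keeps the change of variables affine.\<close>

lemma facet_trace_inequality:
  fixes T F :: "(real^'d) set"
  assumes F: "F facet_of T" and T: "compact T" "convex T" "interior T \<noteq> {}"
  shows "\<exists>C\<ge>0. \<forall>\<psi>. smooth \<psi> \<longrightarrow>
    (\<integral>\<^sup>+x. ennreal ((\<psi> x)\<^sup>2) \<partial>surface_measure F)
      \<le> ennreal C * (\<integral>\<^sup>+x. ennreal ((\<psi> x)\<^sup>2 + (\<Sum>i\<in>UNIV. (partial i \<psi> x)\<^sup>2)) * indicator T x \<partial>lborel)"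
proof -
  obtain n c where n: "norm n = 1" and aff: "affine hull F = {x. n \<bullet> x = c}"
    using facet_hyperplane[OF F T(3)] by blast
  note Fc = facet_compact[OF F T(1,2)]
  have clF: "closed F" using Fc(1) by (rule compact_imp_closed)
  have clT: "closed T" using T(1) by (rule compact_imp_closed)
  obtain x0 where x0: "x0 \<in> interior T" using T(3) by blast
  obtain \<rho> where \<rho>: "\<rho> > 0" "cball x0 \<rho> \<subseteq> T" using x0 by (auto simp: mem_interior_cball)
  \<comment> \<open>\<open>F\<close> is the part of \<open>T\<close> in the affine hull of
    \<open>F\<close>, and a proper face contains no interior point; hence the direction towards
    \<open>x0\<close> is transversal to the facet.\<close>
  have x0c: "n \<bullet> x0 \<noteq> c"
  proof
    assume "n \<bullet> x0 = c"
    then have "x0 \<in> affine hull F" by (simp add: aff)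
    moreover have ff: "F face_of T" using F by (simp add: facet_of_def)
    ultimately have "x0 \<in> F"
      using face_of_imp_eq_affine_Int[OF T(2) ff] x0 interior_subset by blast
    moreover have "F \<noteq> T" using F by (auto simp: facet_of_def)
    ultimately show False using face_of_disjoint_interior[OF ff] x0 by blast
  qed
  have nF: "n \<bullet> y = c" if "y \<in> F" for y
    using hull_subset[of F affine] that unfolding aff by blast
  define w where "w = (\<lambda>y. x0 - y)"
  define Fy where "Fy = (\<lambda>y. F \<inter> cball y \<rho>)"
  define good where "good = (\<lambda>y K. 0 \<le> K \<and> (\<forall>\<psi>. smooth \<psi> \<longrightarrow>
    (\<integral>\<^sup>+x. ennreal ((\<psi> (hproj n c x))\<^sup>2) * indicator (slab n c (Fy y)) x \<partial>lborel)
      \<le> ennreal K * (\<integral>\<^sup>+x. ennreal ((\<psi> x)\<^sup>2 + (frechet_derivative \<psi> (at x) (w y))\<^sup>2) * indicator T x \<partial>lborel)))"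
  have "\<exists>K\<ge>0. \<forall>\<psi>. smooth \<psi> \<longrightarrow>
    (\<integral>\<^sup>+x. ennreal ((\<psi> (hproj n c x))\<^sup>2) * indicator (slab n c (Fy y)) x \<partial>lborel)
      \<le> ennreal K * (\<integral>\<^sup>+x. ennreal ((\<psi> x)\<^sup>2 + (frechet_derivative \<psi> (at x) (w y))\<^sup>2) * indicator T x \<partial>lborel)"
    if y: "y \<in> F" for y
  proof (rule oblique_trace_inequality[OF n _ clT])
    show "closed (Fy y)" unfolding Fy_def using clF by blast
    show "n \<bullet> w y \<noteq> 0" unfolding w_def inner_diff_right nF[OF y] using x0c by simp
    fix z \<tau> :: "_" assume z: "z \<in> Fy y" and \<tau>: "0 \<le> \<tau>" "\<tau> \<le> (1::real)"
    have "dist x0 (x0 + (z - y)) \<le> \<rho>" using z by (simp add: Fy_def dist_norm norm_minus_commute)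
    then have "x0 + (z - y) \<in> T" using \<rho>(2) by auto
    moreover have "z \<in> T" using z Fc(2) by (auto simp: Fy_def)
    ultimately have "(1 - \<tau>) *\<^sub>R z + \<tau> *\<^sub>R (x0 + (z - y)) \<in> T"
      using T(2) \<tau> by (intro convexD_alt)
    then show "z + \<tau> *\<^sub>R w y \<in> T" by (simp add: w_def algebra_simps)
  qed
  then have "\<forall>y\<in>F. \<exists>K. good y K" unfolding good_def by blast
  from bchoice[OF this] obtain K where "\<forall>y\<in>F. good y (K y)" by blast
  then have K: "\<And>y. y \<in> F \<Longrightarrow> K y \<ge> 0" "\<And>y \<psi>. y \<in> F \<Longrightarrow> smooth \<psi> \<Longrightarrow>
    (\<integral>\<^sup>+x. ennreal ((\<psi> (hproj n c x))\<^sup>2) * indicator (slab n c (Fy y)) x \<partial>lborel)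
      \<le> ennreal (K y) * (\<integral>\<^sup>+x. ennreal ((\<psi> x)\<^sup>2 + (frechet_derivative \<psi> (at x) (w y))\<^sup>2) * indicator T x \<partial>lborel)"
    unfolding good_def by blast+
  obtain Y where Y: "finite Y" "Y \<subseteq> F" "F \<subseteq> (\<Union>y\<in>Y. ball y \<rho>)"
  proof (rule compactE_image[OF Fc(1), of F "\<lambda>y. ball y \<rho>"])
    show "F \<subseteq> (\<Union>y\<in>F. ball y \<rho>)" using \<rho>(1) by auto
  qed auto
  \<comment> \<open>The factor \<open>1 + (norm (w y))\<^sup>2\<close> is the cost of bounding the
    derivative in direction \<open>w y\<close> by the full gradient.\<close>
  define C where "C = (\<Sum>y\<in>Y. K y * (1 + (norm (w y))\<^sup>2))"
  have C0: "0 \<le> C" unfolding C_def using K(1) Y(2) by (intro sum_nonneg mult_nonneg_nonneg) auto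
  have "(\<integral>\<^sup>+x. ennreal ((\<psi> x)\<^sup>2) \<partial>surface_measure F)
      \<le> ennreal C * (\<integral>\<^sup>+x. ennreal ((\<psi> x)\<^sup>2 + (\<Sum>i\<in>UNIV. (partial i \<psi> x)\<^sup>2)) * indicator T x \<partial>lborel)"
    if \<psi>: "smooth \<psi>" for \<psi>
  proof -
    have [measurable]: "\<psi> \<in> borel_measurable borel" by (rule smooth_borel_measurable[OF \<psi>])
    have [measurable]: "partial i \<psi> \<in> borel_measurable borel" for i
      by (rule smooth_borel_measurable[OF smooth_partial[OF \<psi>]])
    have [measurable]: "T \<in> sets borel" using clT by simp
    have [measurable]: "slab n c (Fy y) \<in> sets borel" for y
      by (rule slab_sets) (use clF in \<open>auto simp: Fy_def\<close>)
    let ?I = "\<integral>\<^sup>+x. ennreal ((\<psi> x)\<^sup>2 + (\<Sum>i\<in>UNIV. (partial i \<psi> x)\<^sup>2)) * indicator T x \<partial>lborel"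
    have loc: "(\<integral>\<^sup>+x. ennreal ((\<psi> (hproj n c x))\<^sup>2) * indicator (slab n c (Fy y)) x \<partial>lborel)
        \<le> ennreal (K y * (1 + (norm (w y))\<^sup>2)) * ?I" if y: "y \<in> Y" for y
    proof -
      have yF: "y \<in> F" using y Y(2) by blast
      have "(\<integral>\<^sup>+x. ennreal ((\<psi> x)\<^sup>2 + (frechet_derivative \<psi> (at x) (w y))\<^sup>2) * indicator T x \<partial>lborel)
        \<le> (\<integral>\<^sup>+x. ennreal (1 + (norm (w y))\<^sup>2) * (ennreal ((\<psi> x)\<^sup>2 + (\<Sum>i\<in>UNIV. (partial i \<psi> x)\<^sup>2)) * indicator T x) \<partial>lborel)"
      proof (rule nn_integral_mono)
        fix x
        let ?S = "\<Sum>i\<in>UNIV. (partial i \<psi> x)\<^sup>2"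
        have "0 \<le> ?S" by (simp add: sum_nonneg)
        then have "(\<psi> x)\<^sup>2 + (frechet_derivative \<psi> (at x) (w y))\<^sup>2 \<le> (1 + (norm (w y))\<^sup>2) * ((\<psi> x)\<^sup>2 + ?S)"
          using frechet_derivative_sq_le[OF \<psi>, of x "w y"] mult_nonneg_nonneg[OF zero_le_power2[of "norm (w y)"] zero_le_power2[of "\<psi> x"]]
          unfolding distrib_left distrib_right mult_1_left by linarith
        then have "ennreal ((\<psi> x)\<^sup>2 + (frechet_derivative \<psi> (at x) (w y))\<^sup>2)
          \<le> ennreal ((1 + (norm (w y))\<^sup>2) * ((\<psi> x)\<^sup>2 + ?S))" by (rule ennreal_leI)
        also have "\<dots> = ennreal (1 + (norm (w y))\<^sup>2) * ennreal ((\<psi> x)\<^sup>2 + ?S)"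
          using \<open>0 \<le> ?S\<close> by (intro ennreal_mult) auto
        finally show "ennreal ((\<psi> x)\<^sup>2 + (frechet_derivative \<psi> (at x) (w y))\<^sup>2) * indicator T x
          \<le> ennreal (1 + (norm (w y))\<^sup>2) * (ennreal ((\<psi> x)\<^sup>2 + ?S) * indicator T x)"
          by (simp add: indicator_def)
      qed
      also have "\<dots> = ennreal (1 + (norm (w y))\<^sup>2) * ?I" by (rule nn_integral_cmult) measurable
      finally have "ennreal (K y) * (\<integral>\<^sup>+x. ennreal ((\<psi> x)\<^sup>2 + (frechet_derivative \<psi> (at x) (w y))\<^sup>2) * indicator T x \<partial>lborel)
          \<le> ennreal (K y) * (ennreal (1 + (norm (w y))\<^sup>2) * ?I)" by (rule mult_left_mono) simp
      also have "\<dots> = ennreal (K y * (1 + (norm (w y))\<^sup>2)) * ?I"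
        using K(1)[OF yF] by (simp add: ennreal_mult mult.assoc)
      finally show ?thesis using K(2)[OF yF \<psi>] by (rule order_trans[rotated])
    qed
    have "(\<integral>\<^sup>+x. ennreal ((\<psi> x)\<^sup>2) \<partial>surface_measure F) = (\<integral>\<^sup>+x. ennreal ((\<psi> (hproj n c x))\<^sup>2) * indicator (slab n c F) x \<partial>lborel)"
      by (rule nn_integral_surface_measure[OF n aff clF]) measurable
    \<comment> \<open>The pieces may overlap; counting points several times is harmless in an upper
      bound.\<close>
    also have "\<dots> \<le> (\<integral>\<^sup>+x. (\<Sum>y\<in>Y. ennreal ((\<psi> (hproj n c x))\<^sup>2) * indicator (slab n c (Fy y)) x) \<partial>lborel)"
    proof (rule nn_integral_mono)
      fix x
      show "ennreal ((\<psi> (hproj n c x))\<^sup>2) * indicator (slab n c F) x \<le> (\<Sum>y\<in>Y. ennreal ((\<psi> (hproj n c x))\<^sup>2) * indicator (slab n c (Fy y)) x)"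
      proof (cases "x \<in> slab n c F")
        case True
        then obtain y where y: "y \<in> Y" "hproj n c x \<in> ball y \<rho>" using Y(3) by (auto simp: slab_def)
        have "hproj n c x \<in> Fy y" unfolding Fy_def using slabD(1)[OF True] y(2) by auto
        then have "x \<in> slab n c (Fy y)" using True by (simp add: slab_def)
        then have "ennreal ((\<psi> (hproj n c x))\<^sup>2) * indicator (slab n c F) x
          \<le> ennreal ((\<psi> (hproj n c x))\<^sup>2) * indicator (slab n c (Fy y)) x" using True by simp
        also have "\<dots> \<le> (\<Sum>y\<in>Y. ennreal ((\<psi> (hproj n c x))\<^sup>2) * indicator (slab n c (Fy y)) x)"
          using y(1) Y(1) by (intro member_le_sum) auto
        finally show ?thesis .
      qed simp
    qed
    also have "\<dots> = (\<Sum>y\<in>Y. \<integral>\<^sup>+x. ennreal ((\<psi> (hproj n c x))\<^sup>2) * indicator (slab n c (Fy y)) x \<partial>lborel)"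
      by (rule nn_integral_sum) measurable
    also have "\<dots> \<le> (\<Sum>y\<in>Y. ennreal (K y * (1 + (norm (w y))\<^sup>2)) * ?I)"
      by (rule sum_mono) (rule loc)
    also have "\<dots> = (\<Sum>y\<in>Y. ennreal (K y * (1 + (norm (w y))\<^sup>2))) * ?I"
      by (rule sum_distrib_right[symmetric])
    also have "(\<Sum>y\<in>Y. ennreal (K y * (1 + (norm (w y))\<^sup>2))) = ennreal C"
      unfolding C_def using K(1) Y(2) by (intro sum_ennreal mult_nonneg_nonneg) auto
    finally show ?thesis .
  qed
  then show ?thesis using C0 by blast
qed

context bounded_open
begin

text \<open>The frontier of a convex set is a null set, so it suffices that the interior lies in
  \<open>\<Omega>\<close>. This covers \<open>T = closure \<Omega>\<close> as well as cells touching
  the boundary.\<close>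

lemma nn_integral_polytope_le:
  assumes T: "compact T" "convex T" "interior T \<subseteq> \<Omega>" and [measurable]: "g \<in> borel_measurable borel"
  shows "(\<integral>\<^sup>+x. g x * indicator T x \<partial>lborel) \<le> (\<integral>\<^sup>+x. g x \<partial>Leb)"
proof -
  have "AE x in lebesgue. x \<notin> frontier T"
    using negligible_convex_frontier[OF T(2)] unfolding negligible_iff_null_sets by (rule AE_not_in)
  then have ae: "AE x in lborel. x \<notin> frontier T" by (simp add: AE_completion_iff)
  have [measurable]: "\<Omega> \<in> sets borel" using open_dom by simp
  have "(\<integral>\<^sup>+x. g x * indicator T x \<partial>lborel) \<le> (\<integral>\<^sup>+x. g x * indicator \<Omega> x \<partial>lborel)"
  proof (rule nn_integral_mono_AE)
    show "AE x in lborel. g x * indicator T x \<le> g x * indicator \<Omega> x"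
      using ae
    proof eventually_elim
      case (elim x)
      then have "x \<in> T \<Longrightarrow> x \<in> \<Omega>"
        using T(3) closure_subset[of T] by (auto simp: frontier_def)
      then show ?case by (auto simp: indicator_def)
    qed
  qed
  also have "\<dots> = (\<integral>\<^sup>+x. g x * indicator \<Omega> x \<partial>lebesgue)" by (rule nn_integral_completion[symmetric])
  also have "\<dots> = (\<integral>\<^sup>+x. g x \<partial>Leb)" using dom_sets by (simp add: nn_integral_restrict_space)
  finally show ?thesis .
qed

text \<open>The scalar inequality is summed over the components. For a smooth field the classical
  partial derivatives agree with \<open>Jac\<close> almost everywhere, which turns the right side
  into the H1 norm.\<close>

lemma H1_trace_inequality:
  assumes F: "F facet_of T" and T: "compact T" "convex T" "interior T \<noteq> {}" "interior T \<subseteq> \<Omega>"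
  shows "\<exists>C\<ge>0. \<forall>\<psi>. smooth_vec \<psi> \<longrightarrow> sqint (surface_measure F) \<psi> \<and> l2 (surface_measure F) \<psi> \<le> C * H1_norm \<Omega> \<psi>"
proof -
  obtain C where C: "C \<ge> 0" "\<And>\<psi>. smooth \<psi> \<Longrightarrow>
    (\<integral>\<^sup>+x. ennreal ((\<psi> x)\<^sup>2) \<partial>surface_measure F)
      \<le> ennreal C * (\<integral>\<^sup>+x. ennreal ((\<psi> x)\<^sup>2 + (\<Sum>i\<in>UNIV. (partial i \<psi> x)\<^sup>2)) * indicator T x \<partial>lborel)"
    using facet_trace_inequality[OF F T(1-3)] by blast
  have "sqint (surface_measure F) \<psi> \<and> l2 (surface_measure F) \<psi> \<le> sqrt C * H1_norm \<Omega> \<psi>"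
    if \<psi>: "smooth_vec \<psi>" for \<psi>
  proof -
    have sm: "smooth (\<lambda>x. \<psi> x $ i)" for i using \<psi> by (simp add: smooth_vec_def)
    define h where "h = (\<lambda>i x. (\<psi> x $ i)\<^sup>2 + (\<Sum>j\<in>UNIV. (partial j (\<lambda>y. \<psi> y $ i) x)\<^sup>2))"
    have [measurable]: "(\<lambda>x. \<psi> x $ i) \<in> borel_measurable borel" for i
      by (rule smooth_borel_measurable[OF sm])
    have [measurable]: "partial j (\<lambda>x. \<psi> x $ i) \<in> borel_measurable borel" for i j
      by (rule smooth_borel_measurable[OF smooth_partial[OF sm]])
    have hm[measurable]: "(\<lambda>x. ennreal (h i x)) \<in> borel_measurable borel" for i unfolding h_def by measurable
    have h0: "0 \<le> h i x" for i x unfolding h_def by (simp add: sum_nonneg)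
    have "continuous_on UNIV (\<lambda>x. \<chi> i. \<psi> x $ i)"
      by (intro continuous_on_vec_lambda smooth_continuous sm)
    then have m: "\<psi> \<in> borel_measurable borel" by (simp add: borel_measurable_continuous_onI)
    have nv: "(norm (v::real^'d))\<^sup>2 = (\<Sum>i\<in>UNIV. (v $ i)\<^sup>2)" for v
      by (simp add: norm_vec_def L2_set_def sum_nonneg)
    have "(\<integral>\<^sup>+x. ennreal ((norm (\<psi> x))\<^sup>2) \<partial>surface_measure F) = (\<integral>\<^sup>+x. (\<Sum>i\<in>UNIV. ennreal ((\<psi> x $ i)\<^sup>2)) \<partial>surface_measure F)"
      unfolding nv by (intro nn_integral_cong sum_ennreal[symmetric]) simp
    also have "\<dots> = (\<Sum>i\<in>UNIV. \<integral>\<^sup>+x. ennreal ((\<psi> x $ i)\<^sup>2) \<partial>surface_measure F)"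
      by (rule nn_integral_sum) measurable
    also have "\<dots> \<le> (\<Sum>i\<in>UNIV. ennreal C * (\<integral>\<^sup>+x. ennreal (h i x) * indicator T x \<partial>lborel))"
      unfolding h_def by (intro sum_mono C(2) sm)
    also have "\<dots> \<le> (\<Sum>i\<in>UNIV. ennreal C * (\<integral>\<^sup>+x. ennreal (h i x) \<partial>Leb))"
      by (intro sum_mono mult_left_mono nn_integral_polytope_le T hm) simp
    also have "\<dots> = ennreal C * (\<Sum>i\<in>UNIV. \<integral>\<^sup>+x. ennreal (h i x) \<partial>Leb)"
      by (rule sum_distrib_left[symmetric])
    also have "(\<Sum>i\<in>UNIV. \<integral>\<^sup>+x. ennreal (h i x) \<partial>Leb) = (\<integral>\<^sup>+x. (\<Sum>i\<in>UNIV. ennreal (h i x)) \<partial>Leb)"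
      by (rule nn_integral_sum[symmetric]) (rule borel_measurable_lebesgue_onI[OF hm])
    also have "\<dots> = (\<integral>\<^sup>+x. ennreal ((norm (jet \<Omega> \<psi> x))\<^sup>2) \<partial>Leb)"
    proof (rule nn_integral_cong_AE)
      have nm: "(norm (J::real^'d^'d))\<^sup>2 = (\<Sum>i\<in>UNIV. \<Sum>j\<in>UNIV. (J $ i $ j)\<^sup>2)" for J
        unfolding nv[symmetric] by (simp add: norm_vec_def L2_set_def sum_nonneg)
      show "AE x in Leb. (\<Sum>i\<in>UNIV. ennreal (h i x)) = ennreal ((norm (jet \<Omega> \<psi> x))\<^sup>2)"
        using smooth_vec_H1(2)[OF \<psi>]
      proof eventually_elim
        case (elim x)
        have "(norm (jet \<Omega> \<psi> x))\<^sup>2 = (norm (\<psi> x))\<^sup>2 + (norm (Jac \<Omega> \<psi> x))\<^sup>2"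
          by (simp add: jet_def norm_Pair)
        also have "\<dots> = (\<Sum>i\<in>UNIV. h i x)"
          unfolding nv nm elim h_def by (simp add: sum.distrib)
        finally show ?case using h0 by (simp add: sum_ennreal)
      qed
    qed
    also have "\<dots> = ennreal ((H1_norm \<Omega> \<psi>)\<^sup>2)"
      unfolding H1_norm_eq[OF smooth_vec_H1(1)[OF \<psi>]] by (rule nn_integral_l2[OF sqint_jet[OF smooth_vec_H1(1)[OF \<psi>]]])
    also have "ennreal C * \<dots> = ennreal ((sqrt C * H1_norm \<Omega> \<psi>)\<^sup>2)"
      using C(1) by (simp add: ennreal_mult[symmetric] power_mult_distrib)
    finally have "(\<integral>\<^sup>+x. ennreal ((norm (\<psi> x))\<^sup>2) \<partial>surface_measure F) \<le> ennreal ((sqrt C * H1_norm \<Omega> \<psi>)\<^sup>2)" .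
    from sqint_nn_integral[OF _ this] show ?thesis
      using m C(1) H1_norm_nonneg by simp
  qed
  then show ?thesis using C(1) by (intro exI[of _ "sqrt C"]) auto
qed

end

section \<open>Traces of fields that are limits of smooth ones\<close>

lemma smooth_vec_lincomb:
  "smooth_vec \<psi> \<Longrightarrow> smooth_vec \<theta> \<Longrightarrow> smooth_vec (\<lambda>x. c *\<^sub>R \<psi> x + d *\<^sub>R \<theta> x)"
  by (simp add: smooth_vec_def smooth_lincomb)

lemma smooth_vec_diff: "smooth_vec \<psi> \<Longrightarrow> smooth_vec \<theta> \<Longrightarrow> smooth_vec (\<lambda>x. \<psi> x - \<theta> x)"
  using smooth_vec_lincomb[of \<psi> \<theta> 1 "-1"] by simp

lemma tendsto_l2_iff: "(\<lambda>m. (l2 M (u m))\<^sup>2) \<longlonglongrightarrow> 0 \<longleftrightarrow> (\<lambda>m. l2 M (u m)) \<longlonglongrightarrow> 0"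
proof
  assume "(\<lambda>m. (l2 M (u m))\<^sup>2) \<longlonglongrightarrow> 0"
  from tendsto_real_sqrt[OF this] show "(\<lambda>m. l2 M (u m)) \<longlonglongrightarrow> 0" by simp
next
  assume "(\<lambda>m. l2 M (u m)) \<longlonglongrightarrow> 0"
  from tendsto_power[OF this, of 2] show "(\<lambda>m. (l2 M (u m))\<^sup>2) \<longlonglongrightarrow> 0" by simp
qed

text \<open>Every function with a trace on some facet is approximable, and approximability is what yields
  traces on all the others.\<close>

definition approximable :: "(real^'d) set \<Rightarrow> ((real^'d) \<Rightarrow> (real^'d)) \<Rightarrow> bool" where
  "approximable \<Omega> \<phi> \<longleftrightarrow> (\<forall>e>0. \<exists>\<psi>. smooth_vec \<psi> \<and> H1_norm \<Omega> (\<lambda>x. \<psi> x - \<phi> x) < e)"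

lemma has_trace_iff:
  "has_trace \<Omega> F \<phi> g \<longleftrightarrow> sqint (surface_measure F) g \<and>
     (\<exists>\<psi>. (\<forall>m. smooth_vec (\<psi> m)) \<and> (\<lambda>m::nat. H1_norm \<Omega> (\<lambda>x. \<psi> m x - \<phi> x)) \<longlonglongrightarrow> 0 \<and>
       (\<lambda>m. l2 (surface_measure F) (\<lambda>x. \<psi> m x - g x)) \<longlonglongrightarrow> 0)"
  unfolding has_trace_def sqint_def smooth_vec_def tendsto_l2_iff[symmetric] l2_sq conj_assoc ..

lemma has_trace_approximable:
  assumes "has_trace \<Omega> F \<phi> g" shows "approximable \<Omega> \<phi>"
  unfolding approximable_def
proof (intro allI impI)
  fix e :: real assume e: "e > 0"
  obtain \<psi> where \<psi>: "\<And>m. smooth_vec (\<psi> m)" "(\<lambda>m::nat. H1_norm \<Omega> (\<lambda>x. \<psi> m x - \<phi> x)) \<longlonglongrightarrow> 0"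
    using assms unfolding has_trace_iff by blast
  have "\<forall>\<^sub>F m in sequentially. H1_norm \<Omega> (\<lambda>x. \<psi> m x - \<phi> x) < e"
    using order_tendstoD(2)[OF \<psi>(2) e] .
  then obtain m where "H1_norm \<Omega> (\<lambda>x. \<psi> m x - \<phi> x) < e"
    using eventually_happens'[OF sequentially_bot] by blast
  then show "\<exists>\<psi>. smooth_vec \<psi> \<and> H1_norm \<Omega> (\<lambda>x. \<psi> x - \<phi> x) < e" using \<psi>(1) by blast
qed

context bounded_open
begin

lemma approximable_closed:
  assumes \<phi>: "\<phi> \<in> H1_vec \<Omega>"
    and approx: "\<And>e. e > 0 \<Longrightarrow> \<exists>\<theta>\<in>H1_vec \<Omega>. approximable \<Omega> \<theta> \<and> H1_norm \<Omega> (\<lambda>x. \<theta> x - \<phi> x) < e"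
  shows "approximable \<Omega> \<phi>"
  unfolding approximable_def
proof (intro allI impI)
  fix e :: real assume "e > 0"
  then have e: "e / 2 > 0" by simp
  obtain \<theta> where \<theta>: "\<theta> \<in> H1_vec \<Omega>" "approximable \<Omega> \<theta>" "H1_norm \<Omega> (\<lambda>x. \<theta> x - \<phi> x) < e/2"
    using approx[OF e] by blast
  obtain \<psi> where \<psi>: "smooth_vec \<psi>" "H1_norm \<Omega> (\<lambda>x. \<psi> x - \<theta> x) < e/2"
    using \<theta>(2) e unfolding approximable_def by blast
  have "H1_norm \<Omega> (\<lambda>x. \<psi> x - \<phi> x) < e"
    using H1_norm_triangle[OF smooth_vec_H1(1)[OF \<psi>(1)] \<theta>(1) \<phi>] \<theta>(3) \<psi>(2) by simp
  then show "\<exists>\<psi>. smooth_vec \<psi> \<and> H1_norm \<Omega> (\<lambda>x. \<psi> x - \<phi> x) < e" using \<psi>(1) by blast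
qed

text \<open>Both fields have the same H1 distance to every smooth field, so the same smooth
  sequences witness their traces.\<close>

lemma has_trace_cong_AE:
  assumes "sqint Leb \<phi>" "sqint Leb \<theta>" "AE x in Leb. \<phi> x = \<theta> x" "\<phi> \<in> H1_vec \<Omega>"
  shows "has_trace \<Omega> F \<phi> g = has_trace \<Omega> F \<theta> g"
proof -
  have "H1_norm \<Omega> (\<lambda>x. \<psi> x - \<phi> x) = H1_norm \<Omega> (\<lambda>x. \<psi> x - \<theta> x)" if \<psi>: "smooth_vec \<psi>" for \<psi>
  proof -
    note p = smooth_vec_H1(1)[OF \<psi>]
    have ae: "AE x in Leb. \<psi> x - \<phi> x = \<psi> x - \<theta> x" using assms(3) by eventually_elim simp
    have s: "sqint Leb (\<lambda>x. \<psi> x - \<phi> x)" "sqint Leb (\<lambda>x. \<psi> x - \<theta> x)"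
      by (intro sqint_diff H1_sqint p assms)+
    have "Jac \<Omega> (\<lambda>x. \<psi> x - \<phi> x) = Jac \<Omega> (\<lambda>x. \<psi> x - \<theta> x)"
      by (rule Jac_cong_AE(1)[OF H1_diff(1)[OF p assms(4)] s(2) ae])
    moreover have "l2 Leb (\<lambda>x. \<psi> x - \<phi> x) = l2 Leb (\<lambda>x. \<psi> x - \<theta> x)"
      by (rule l2_cong_AE[OF ae sqintD(1)[OF s(1)] sqintD(1)[OF s(2)]])
    ultimately show ?thesis by (simp add: H1_norm_def L2_norm_eq)
  qed
  then have eq: "(\<forall>m. smooth_vec (\<psi> m)) \<and> (\<lambda>m::nat. H1_norm \<Omega> (\<lambda>x. \<psi> m x - \<phi> x)) \<longlonglongrightarrow> 0 \<longleftrightarrow>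
     (\<forall>m. smooth_vec (\<psi> m)) \<and> (\<lambda>m::nat. H1_norm \<Omega> (\<lambda>x. \<psi> m x - \<theta> x)) \<longlonglongrightarrow> 0" for \<psi>
    by auto
  show ?thesis unfolding has_trace_iff conj_assoc[symmetric] eq ..
qed

end

text \<open>What a facet has to provide for a trace operator. Facets of
  \<open>closure \<Omega>\<close> and facets of mesh cells, interior ones included, are both
  instances, each with its own constant \<open>C\<close>.\<close>

locale trace_facet = bounded_open \<Omega> for \<Omega> :: "(real^'d) set" +
  fixes F :: "(real^'d) set" and C :: real
  assumes finite_S: "finite_measure (surface_measure F)" and C0: "0 \<le> C"
    and smooth_sqint_S: "smooth_vec \<psi> \<Longrightarrow> sqint (surface_measure F) \<psi>"
    and smooth_trace_bound: "smooth_vec \<psi> \<Longrightarrow> l2 (surface_measure F) \<psi> \<le> C * H1_norm \<Omega> \<psi>"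
begin

abbreviation "S \<equiv> surface_measure F"

text \<open>Extension by density: the restrictions of an approximating sequence are Cauchy in L2 of
  the facet by the trace inequality, and completeness provides the limit.\<close>

lemma trace_exists:
  assumes \<phi>: "\<phi> \<in> H1_vec \<Omega>" and approx: "approximable \<Omega> \<phi>"
  shows "\<exists>g. has_trace \<Omega> F \<phi> g"
proof -
  have "\<exists>\<psi>. smooth_vec \<psi> \<and> H1_norm \<Omega> (\<lambda>x. \<psi> x - \<phi> x) < inverse (real (Suc m))" for m
    using approx unfolding approximable_def by simp
  then obtain \<psi> where \<psi>: "\<And>m. smooth_vec (\<psi> m)" "\<And>m. H1_norm \<Omega> (\<lambda>x. \<psi> m x - \<phi> x) < inverse (real (Suc m))"
    by metis
  note h = smooth_vec_H1(1)[OF \<psi>(1)]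
  have lim: "(\<lambda>m. H1_norm \<Omega> (\<lambda>x. \<psi> m x - \<phi> x)) \<longlonglongrightarrow> 0"
  proof (rule Lim_null_comparison)
    show "\<forall>\<^sub>F m in sequentially. norm (H1_norm \<Omega> (\<lambda>x. \<psi> m x - \<phi> x)) \<le> inverse (real (Suc m))"
      using \<psi>(2) H1_norm_nonneg by (intro always_eventually allI) (simp add: less_imp_le del: of_nat_Suc)
  qed (rule LIMSEQ_inverse_real_of_nat)
  have "\<exists>g. sqint S g \<and> (\<lambda>n. l2 S (\<lambda>x. \<psi> n x - g x)) \<longlonglongrightarrow> 0"
  proof (rule l2_complete[OF finite_S smooth_sqint_S[OF \<psi>(1)]])
    fix e :: real assume e: "e > 0"
    \<comment> \<open>The summand 1 keeps the quotient meaningful for \<open>C = 0\<close>; the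
      factor 2 splits the tolerance between two members of the sequence.\<close>
    then have "e / (2 * (C + 1)) > 0" using C0 by simp
    from order_tendstoD(2)[OF lim this]
    obtain N where N: "\<And>m. m \<ge> N \<Longrightarrow> H1_norm \<Omega> (\<lambda>x. \<psi> m x - \<phi> x) < e / (2 * (C + 1))"
      by (auto simp: eventually_sequentially)
    have "l2 S (\<lambda>x. \<psi> m x - \<psi> n x) < e" if mn: "m \<ge> N" "n \<ge> N" for m n
    proof -
      have "H1_norm \<Omega> (\<lambda>x. \<psi> m x - \<psi> n x) \<le> H1_norm \<Omega> (\<lambda>x. \<psi> m x - \<phi> x) + H1_norm \<Omega> (\<lambda>x. \<phi> x - \<psi> n x)"
        by (rule H1_norm_triangle[OF h \<phi> h])
      also have "\<dots> < e / (2 * (C + 1)) + e / (2 * (C + 1))"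
        unfolding H1_norm_minus_commute[OF \<phi> h] by (intro add_strict_mono N mn)
      also have "e / (2 * (C + 1)) = e / (C + 1) / 2" by (simp add: mult.commute)
      finally have le: "H1_norm \<Omega> (\<lambda>x. \<psi> m x - \<psi> n x) \<le> e / (C + 1)" by linarith
      have "l2 S (\<lambda>x. \<psi> m x - \<psi> n x) \<le> C * H1_norm \<Omega> (\<lambda>x. \<psi> m x - \<psi> n x)"
        by (rule smooth_trace_bound[OF smooth_vec_diff[OF \<psi>(1) \<psi>(1)]])
      also have "\<dots> \<le> C * (e / (C + 1))" by (rule mult_left_mono[OF le C0])
      also have "\<dots> < e" using e C0 by (simp add: field_simps)
      finally show ?thesis .
    qed
    then show "\<exists>N. \<forall>m\<ge>N. \<forall>n\<ge>N. l2 S (\<lambda>x. \<psi> m x - \<psi> n x) < e" by blast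
  qed
  then show ?thesis unfolding has_trace_iff using \<psi>(1) lim by blast
qed

text \<open>The trace inequality is passed to the limit along the smooth sequences of both traces.
  For equal fields this gives uniqueness, so the approximating sequence is immaterial.\<close>

lemma trace_bound:
  assumes "\<phi> \<in> H1_vec \<Omega>" "\<theta> \<in> H1_vec \<Omega>" "has_trace \<Omega> F \<phi> g" "has_trace \<Omega> F \<theta> h"
  shows "l2 S (\<lambda>x. g x - h x) \<le> C * H1_norm \<Omega> (\<lambda>x. \<phi> x - \<theta> x)"
proof -
  obtain \<psi> where \<psi>: "sqint S g" "\<And>m. smooth_vec (\<psi> m)" "(\<lambda>m::nat. H1_norm \<Omega> (\<lambda>x. \<psi> m x - \<phi> x)) \<longlonglongrightarrow> 0"
       "(\<lambda>m. l2 S (\<lambda>x. \<psi> m x - g x)) \<longlonglongrightarrow> 0"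
    using assms(3) unfolding has_trace_iff by blast
  obtain \<omega> where \<omega>: "sqint S h" "\<And>m. smooth_vec (\<omega> m)" "(\<lambda>m::nat. H1_norm \<Omega> (\<lambda>x. \<omega> m x - \<theta> x)) \<longlonglongrightarrow> 0"
       "(\<lambda>m. l2 S (\<lambda>x. \<omega> m x - h x)) \<longlonglongrightarrow> 0"
    using assms(4) unfolding has_trace_iff by blast
  note hp = smooth_vec_H1(1)[OF \<psi>(2)] and ho = smooth_vec_H1(1)[OF \<omega>(2)]
  note sp = smooth_sqint_S[OF \<psi>(2)] and so = smooth_sqint_S[OF \<omega>(2)]
  have le: "l2 S (\<lambda>x. g x - h x) \<le> l2 S (\<lambda>x. \<psi> m x - g x) + (C * (H1_norm \<Omega> (\<lambda>x. \<psi> m x - \<phi> x) +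
     (H1_norm \<Omega> (\<lambda>x. \<phi> x - \<theta> x) + H1_norm \<Omega> (\<lambda>x. \<omega> m x - \<theta> x))) + l2 S (\<lambda>x. \<omega> m x - h x))" for m
  proof -
    have "H1_norm \<Omega> (\<lambda>x. \<psi> m x - \<omega> m x) \<le> H1_norm \<Omega> (\<lambda>x. \<psi> m x - \<phi> x) +
     (H1_norm \<Omega> (\<lambda>x. \<phi> x - \<theta> x) + H1_norm \<Omega> (\<lambda>x. \<omega> m x - \<theta> x))"
      using H1_norm_triangle[OF hp assms(1) ho, of m m] H1_norm_triangle[OF assms(1,2) ho, of m]
        H1_norm_minus_commute[OF assms(2) ho, of m] by linarith
    then have "C * H1_norm \<Omega> (\<lambda>x. \<psi> m x - \<omega> m x) \<le> C * (H1_norm \<Omega> (\<lambda>x. \<psi> m x - \<phi> x) +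
     (H1_norm \<Omega> (\<lambda>x. \<phi> x - \<theta> x) + H1_norm \<Omega> (\<lambda>x. \<omega> m x - \<theta> x)))" by (rule mult_left_mono[OF _ C0])
    moreover have "l2 S (\<lambda>x. \<psi> m x - \<omega> m x) \<le> C * H1_norm \<Omega> (\<lambda>x. \<psi> m x - \<omega> m x)"
      by (rule smooth_trace_bound[OF smooth_vec_diff[OF \<psi>(2) \<omega>(2)]])
    moreover have "l2 S (\<lambda>x. g x - h x) \<le> l2 S (\<lambda>x. g x - \<psi> m x) + l2 S (\<lambda>x. \<psi> m x - h x)"
      by (rule l2_triangle3[OF \<psi>(1) sp \<omega>(1)])
    moreover have "l2 S (\<lambda>x. \<psi> m x - h x) \<le> l2 S (\<lambda>x. \<psi> m x - \<omega> m x) + l2 S (\<lambda>x. \<omega> m x - h x)"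
      by (rule l2_triangle3[OF sp so \<omega>(1)])
    ultimately show ?thesis using l2_minus_commute[of S g "\<psi> m"] by linarith
  qed
  have lim: "(\<lambda>m. l2 S (\<lambda>x. \<psi> m x - g x) + (C * (H1_norm \<Omega> (\<lambda>x. \<psi> m x - \<phi> x) +
     (H1_norm \<Omega> (\<lambda>x. \<phi> x - \<theta> x) + H1_norm \<Omega> (\<lambda>x. \<omega> m x - \<theta> x))) + l2 S (\<lambda>x. \<omega> m x - h x)))
     \<longlonglongrightarrow> 0 + (C * (0 + (H1_norm \<Omega> (\<lambda>x. \<phi> x - \<theta> x) + 0)) + 0)"
    by (intro tendsto_add tendsto_mult tendsto_const \<psi> \<omega>)
  show ?thesis
    using LIMSEQ_le_const[OF lim] le by simp
qed

lemma trace_unique: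
  assumes "\<phi> \<in> H1_vec \<Omega>" "has_trace \<Omega> F \<phi> g" "has_trace \<Omega> F \<phi> h"
  shows "AE x in S. g x = h x"
proof -
  have "H1_norm \<Omega> (\<lambda>x. \<phi> x - \<phi> x) = 0"
    unfolding H1_norm_diff[OF assms(1,1)] by simp
  then have "l2 S (\<lambda>x. g x - h x) = 0"
    using trace_bound[OF assms(1,1,2,3)] l2_nonneg[of S "\<lambda>x. g x - h x"] by simp
  moreover have "sqint S (\<lambda>x. g x - h x)"
    using assms(2,3) unfolding has_trace_iff by (blast intro: sqint_diff)
  ultimately have "AE x in S. g x - h x = 0" by (rule l2_eq_0[rotated])
  then show ?thesis by simp
qed

lemma trace_lincomb:
  assumes "\<phi> \<in> H1_vec \<Omega>" "\<theta> \<in> H1_vec \<Omega>" "has_trace \<Omega> F \<phi> g" "has_trace \<Omega> F \<theta> h"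
  shows "has_trace \<Omega> F (\<lambda>x. c *\<^sub>R \<phi> x + d *\<^sub>R \<theta> x) (\<lambda>x. c *\<^sub>R g x + d *\<^sub>R h x)"
proof -
  obtain \<psi> where \<psi>: "sqint S g" "\<And>m. smooth_vec (\<psi> m)" "(\<lambda>m::nat. H1_norm \<Omega> (\<lambda>x. \<psi> m x - \<phi> x)) \<longlonglongrightarrow> 0"
       "(\<lambda>m. l2 S (\<lambda>x. \<psi> m x - g x)) \<longlonglongrightarrow> 0"
    using assms(3) unfolding has_trace_iff by blast
  obtain \<omega> where \<omega>: "sqint S h" "\<And>m. smooth_vec (\<omega> m)" "(\<lambda>m::nat. H1_norm \<Omega> (\<lambda>x. \<omega> m x - \<theta> x)) \<longlonglongrightarrow> 0"
       "(\<lambda>m. l2 S (\<lambda>x. \<omega> m x - h x)) \<longlonglongrightarrow> 0"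
    using assms(4) unfolding has_trace_iff by blast
  note hp = smooth_vec_H1(1)[OF \<psi>(2)] and ho = smooth_vec_H1(1)[OF \<omega>(2)]
  note sp = smooth_sqint_S[OF \<psi>(2)] and so = smooth_sqint_S[OF \<omega>(2)]
  \<comment> \<open>Polymorphic in the values and general in the measure: applied to the traces on
    \<open>F\<close> and again to the jets on \<open>\<Omega>\<close>.\<close>
  have l2le: "l2 M (\<lambda>x. (c *\<^sub>R u x + d *\<^sub>R v x) - (c *\<^sub>R u' x + d *\<^sub>R v' x))
      \<le> \<bar>c\<bar> * l2 M (\<lambda>x. u x - u' x) + \<bar>d\<bar> * l2 M (\<lambda>x. v x - v' x)"
    if "sqint M u" "sqint M v" "sqint M u'" "sqint M v'"
    for M :: "(real^'d) measure" and u u' v v' :: "real^'d \<Rightarrow> 'b::euclidean_space"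
  proof -
    have "l2 M (\<lambda>x. c *\<^sub>R (u x - u' x) + d *\<^sub>R (v x - v' x)) \<le> \<bar>c\<bar> * l2 M (\<lambda>x. u x - u' x) + \<bar>d\<bar> * l2 M (\<lambda>x. v x - v' x)"
      unfolding l2_scaleR[symmetric] using that by (intro l2_triangle sqint_scaleR sqint_diff)
    then show ?thesis by (simp add: algebra_simps)
  qed
  have "(\<lambda>m. l2 S (\<lambda>x. (c *\<^sub>R \<psi> m x + d *\<^sub>R \<omega> m x) - (c *\<^sub>R g x + d *\<^sub>R h x))) \<longlonglongrightarrow> 0"
  proof (rule Lim_null_comparison)
    show "(\<lambda>m. \<bar>c\<bar> * l2 S (\<lambda>x. \<psi> m x - g x) + \<bar>d\<bar> * l2 S (\<lambda>x. \<omega> m x - h x)) \<longlonglongrightarrow> 0"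
      using tendsto_add[OF tendsto_mult_right_zero[OF \<psi>(4)] tendsto_mult_right_zero[OF \<omega>(4)]] by simp
    show "\<forall>\<^sub>F m in sequentially. norm (l2 S (\<lambda>x. (c *\<^sub>R \<psi> m x + d *\<^sub>R \<omega> m x) - (c *\<^sub>R g x + d *\<^sub>R h x)))
       \<le> \<bar>c\<bar> * l2 S (\<lambda>x. \<psi> m x - g x) + \<bar>d\<bar> * l2 S (\<lambda>x. \<omega> m x - h x)"
      using l2le[OF sp so \<psi>(1) \<omega>(1)] by simp
  qed
  moreover have "(\<lambda>m. H1_norm \<Omega> (\<lambda>x. (c *\<^sub>R \<psi> m x + d *\<^sub>R \<omega> m x) - (c *\<^sub>R \<phi> x + d *\<^sub>R \<theta> x))) \<longlonglongrightarrow> 0"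
  proof (rule Lim_null_comparison)
    show "(\<lambda>m. \<bar>c\<bar> * H1_norm \<Omega> (\<lambda>x. \<psi> m x - \<phi> x) + \<bar>d\<bar> * H1_norm \<Omega> (\<lambda>x. \<omega> m x - \<theta> x)) \<longlonglongrightarrow> 0"
      using tendsto_add[OF tendsto_mult_right_zero[OF \<psi>(3)] tendsto_mult_right_zero[OF \<omega>(3)]] by simp
    have "H1_norm \<Omega> (\<lambda>x. (c *\<^sub>R \<psi> m x + d *\<^sub>R \<omega> m x) - (c *\<^sub>R \<phi> x + d *\<^sub>R \<theta> x))
       \<le> \<bar>c\<bar> * H1_norm \<Omega> (\<lambda>x. \<psi> m x - \<phi> x) + \<bar>d\<bar> * H1_norm \<Omega> (\<lambda>x. \<omega> m x - \<theta> x)" for m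
    proof -
      note l1 = H1_lincomb[OF hp ho, of c m d m] and l2 = H1_lincomb[OF assms(1,2), of c d]
      have "H1_norm \<Omega> (\<lambda>x. (c *\<^sub>R \<psi> m x + d *\<^sub>R \<omega> m x) - (c *\<^sub>R \<phi> x + d *\<^sub>R \<theta> x)) =
        l2 Leb (\<lambda>x. (c *\<^sub>R jet \<Omega> (\<psi> m) x + d *\<^sub>R jet \<Omega> (\<omega> m) x) - (c *\<^sub>R jet \<Omega> \<phi> x + d *\<^sub>R jet \<Omega> \<theta> x))"
        unfolding H1_norm_diff[OF l1(1) l2(1)]
      proof (rule l2_cong_AE)
        show "AE x in Leb. jet \<Omega> (\<lambda>x. c *\<^sub>R \<psi> m x + d *\<^sub>R \<omega> m x) x - jet \<Omega> (\<lambda>x. c *\<^sub>R \<phi> x + d *\<^sub>R \<theta> x) x =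
           c *\<^sub>R jet \<Omega> (\<psi> m) x + d *\<^sub>R jet \<Omega> (\<omega> m) x - (c *\<^sub>R jet \<Omega> \<phi> x + d *\<^sub>R jet \<Omega> \<theta> x)"
          using l1(2) l2(2) by eventually_elim simp
      qed (intro sqintD(1) sqint_diff sqint_add sqint_scaleR sqint_jet l1 l2 hp ho assms)+
      also have "\<dots> \<le> \<bar>c\<bar> * l2 Leb (\<lambda>x. jet \<Omega> (\<psi> m) x - jet \<Omega> \<phi> x) + \<bar>d\<bar> * l2 Leb (\<lambda>x. jet \<Omega> (\<omega> m) x - jet \<Omega> \<theta> x)"
        by (intro l2le sqint_jet hp ho assms)
      finally show ?thesis unfolding H1_norm_diff[OF hp assms(1)] H1_norm_diff[OF ho assms(2)] .
    qed
    then show "\<forall>\<^sub>F m in sequentially. norm (H1_norm \<Omega> (\<lambda>x. (c *\<^sub>R \<psi> m x + d *\<^sub>R \<omega> m x) - (c *\<^sub>R \<phi> x + d *\<^sub>R \<theta> x)))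
       \<le> \<bar>c\<bar> * H1_norm \<Omega> (\<lambda>x. \<psi> m x - \<phi> x) + \<bar>d\<bar> * H1_norm \<Omega> (\<lambda>x. \<omega> m x - \<theta> x)"
      using H1_norm_nonneg by simp
  qed
  moreover have "sqint S (\<lambda>x. c *\<^sub>R g x + d *\<^sub>R h x)" by (intro sqint_add sqint_scaleR \<psi> \<omega>)
  moreover have "\<forall>m. smooth_vec (\<lambda>x. c *\<^sub>R \<psi> m x + d *\<^sub>R \<omega> m x)"
    using \<psi>(2) \<omega>(2) smooth_vec_lincomb by blast
  ultimately show ?thesis unfolding has_trace_iff by (intro conjI exI[of _ "\<lambda>m x. c *\<^sub>R \<psi> m x + d *\<^sub>R \<omega> m x"])
qed

end

section \<open>The spaces V and W\<close>

locale poly_domain =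
  fixes \<Omega> :: "(real^'d) set" assumes dom: "convex_polyhedral_domain \<Omega>"

sublocale poly_domain \<subseteq> bounded_open
proof
  show "open \<Omega>" using dom by (simp add: convex_polyhedral_domain_def)
  have "bounded (closure \<Omega>)" using dom by (simp add: convex_polyhedral_domain_def polytope_imp_bounded)
  then show "bounded \<Omega>" using closure_subset by (rule bounded_subset)
qed

context poly_domain
begin

lemma interior_closure_dom: "interior (closure \<Omega>) = \<Omega>"
  using dom by (simp add: convex_polyhedral_domain_def convex_interior_closure interior_open)

lemma facet_imp_trace_facet:
  assumes F: "F facet_of T" and T: "compact T" "convex T" "interior T \<noteq> {}" "interior T \<subseteq> \<Omega>"
  shows "\<exists>C. trace_facet \<Omega> F C"
proof -
  obtain C where C: "C \<ge> 0" "\<forall>\<psi>. smooth_vec \<psi> \<longrightarrow>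
      sqint (surface_measure F) \<psi> \<and> l2 (surface_measure F) \<psi> \<le> C * H1_norm \<Omega> \<psi>"
    using H1_trace_inequality[OF assms] by (elim exE conjE)
  have "trace_facet \<Omega> F C"
    by (intro trace_facet.intro trace_facet_axioms.intro bounded_open_axioms
        finite_surface_measure[OF F T(1-3)] C(1)) (simp_all add: C(2))
  then show ?thesis ..
qed

lemma boundary_trace_facet: "G facet_of closure \<Omega> \<Longrightarrow> \<exists>C. trace_facet \<Omega> G C"
  by (rule facet_imp_trace_facet[of G "closure \<Omega>"])
     (use dom interior_closure_dom bounded_dom in \<open>auto simp: convex_polyhedral_domain_def polytope_imp_compact convex_closure\<close>)

text \<open>Without facets the closure would have empty relative boundary and so coincide with its
  interior \<open>\<Omega>\<close>; a nonempty set that is open and closed is the whole space, which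
  is unbounded.\<close>

lemma boundary_facet_exists: "\<exists>G. G facet_of closure \<Omega>"
proof (rule ccontr)
  assume "\<not> ?thesis"
  then have "closure \<Omega> - rel_interior (closure \<Omega>) = {}"
    using rel_boundary_of_polyhedron[OF polytope_imp_polyhedron, of "closure \<Omega>"] dom
    by (auto simp: convex_polyhedral_domain_def)
  moreover have "rel_interior (closure \<Omega>) = interior (closure \<Omega>)"
    using interior_closure_dom dom by (intro rel_interior_nonempty_interior) (simp add: convex_polyhedral_domain_def)
  ultimately have "closure \<Omega> \<subseteq> \<Omega>" using interior_closure_dom by auto
  then have "closed \<Omega>" using closure_subset_eq by blast
  then have "\<Omega> = UNIV" using dom clopen[of \<Omega>] by (simp add: convex_polyhedral_domain_def)
  then show False using bounded_dom not_bounded_UNIV by auto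
qed

definition tang :: "(real^'d) set \<Rightarrow> real^'d \<Rightarrow> real^'d" where
  "tang G v = v - (v \<bullet> outer_normal \<Omega> G) *\<^sub>R outer_normal \<Omega> G"

lemma bounded_linear_tang: "bounded_linear (tang G)"
  unfolding tang_def[abs_def]
  by (intro bounded_linear_sub bounded_linear_ident bounded_linear_scaleR_const bounded_linear_inner_left)

lemma V_space_iff:
  "\<phi> \<in> V_space \<Omega> \<longleftrightarrow> \<phi> \<in> H1_vec \<Omega> \<and> (\<forall>G. G facet_of closure \<Omega> \<longrightarrow>
     (\<exists>g. has_trace \<Omega> G \<phi> g \<and> (AE x in surface_measure G. tang G (g x) = 0)))"
  by (simp add: V_space_def tang_def)

lemma V_H1: "\<phi> \<in> V_space \<Omega> \<Longrightarrow> \<phi> \<in> H1_vec \<Omega>"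
  by (simp add: V_space_iff)

lemma V_approximable: "\<phi> \<in> V_space \<Omega> \<Longrightarrow> approximable \<Omega> \<phi>"
  using boundary_facet_exists has_trace_approximable unfolding V_space_iff by blast

lemma V_lincomb:
  assumes "\<phi> \<in> V_space \<Omega>" "\<theta> \<in> V_space \<Omega>"
  shows "(\<lambda>x. c *\<^sub>R \<phi> x + d *\<^sub>R \<theta> x) \<in> V_space \<Omega>"
  unfolding V_space_iff
proof (intro conjI allI impI)
  note h = V_H1[OF assms(1)] V_H1[OF assms(2)]
  show "(\<lambda>x. c *\<^sub>R \<phi> x + d *\<^sub>R \<theta> x) \<in> H1_vec \<Omega>" by (rule H1_lincomb[OF h])
  fix G assume G: "G facet_of closure \<Omega>"
  then obtain C where "trace_facet \<Omega> G C" using boundary_trace_facet by blast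
  then interpret trace_facet \<Omega> G C .
  obtain g k where g: "has_trace \<Omega> G \<phi> g" "AE x in S. tang G (g x) = 0"
    and k: "has_trace \<Omega> G \<theta> k" "AE x in S. tang G (k x) = 0"
    using assms G unfolding V_space_iff by blast
  have "AE x in S. tang G (c *\<^sub>R g x + d *\<^sub>R k x) = 0"
    using g(2) k(2)
    by eventually_elim
      (simp add: linear_add[OF bounded_linear.linear[OF bounded_linear_tang]] linear_cmul[OF bounded_linear.linear[OF bounded_linear_tang]])
  then show "\<exists>g. has_trace \<Omega> G (\<lambda>x. c *\<^sub>R \<phi> x + d *\<^sub>R \<theta> x) g \<and> (AE x in S. tang G (g x) = 0)"
    using trace_lincomb[OF h g(1) k(1)] by blast
qed

lemma V_cong_AE:
  assumes "\<phi> \<in> V_space \<Omega>" "sqint Leb \<theta>" "AE x in Leb. \<phi> x = \<theta> x"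
  shows "\<theta> \<in> V_space \<Omega>"
proof -
  note h = V_H1[OF assms(1)]
  show ?thesis using assms(1) Jac_cong_AE(2)[OF h assms(2,3)]
      has_trace_cong_AE[OF H1_sqint[OF h] assms(2,3) h]
    unfolding V_space_iff by simp
qed

text \<open>For \<open>\<theta>\<close> in V the tangential trace of \<open>\<phi>\<close> is that
  of \<open>\<phi> - \<theta>\<close>, hence bounded by the H1 distance. Approximability, which
  guarantees that \<open>\<phi>\<close> has a trace at all, is preserved under H1 limits as
  well.\<close>

lemma V_closed:
  assumes \<phi>: "\<phi> \<in> H1_vec \<Omega>"
    and approx: "\<And>e. e > 0 \<Longrightarrow> \<exists>\<theta>\<in>V_space \<Omega>. H1_norm \<Omega> (\<lambda>x. \<theta> x - \<phi> x) < e"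
  shows "\<phi> \<in> V_space \<Omega>"
  unfolding V_space_iff
proof (intro conjI allI impI \<phi>)
  have ap: "approximable \<Omega> \<phi>"
    by (rule approximable_closed[OF \<phi>]) (use approx V_H1 V_approximable in blast)
  fix G assume G: "G facet_of closure \<Omega>"
  then obtain C where "trace_facet \<Omega> G C" using boundary_trace_facet by blast
  then interpret trace_facet \<Omega> G C .
  obtain g where g: "has_trace \<Omega> G \<phi> g" using trace_exists[OF \<phi> ap] by blast
  have sg: "sqint S g" using g unfolding has_trace_iff by blast
  obtain K where K: "K \<ge> 0" "\<And>u. sqint S u \<Longrightarrow> l2 S (\<lambda>x. tang G (u x)) \<le> K * l2 S u"
    using l2_bounded_linear[OF bounded_linear_tang] by metis
  have le: "l2 S (\<lambda>x. tang G (g x)) \<le> K * C * e" if e: "e > 0" for e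
  proof -
    obtain \<theta> where \<theta>: "\<theta> \<in> V_space \<Omega>" "H1_norm \<Omega> (\<lambda>x. \<theta> x - \<phi> x) < e" using approx[OF e] by blast
    obtain k where k: "has_trace \<Omega> G \<theta> k" "AE x in S. tang G (k x) = 0"
      using \<theta>(1) G unfolding V_space_iff by blast
    have sk: "sqint S k" using k(1) unfolding has_trace_iff by blast
    have "l2 S (\<lambda>x. tang G (g x)) = l2 S (\<lambda>x. tang G (g x - k x))"
    proof (rule l2_cong_AE)
      show "AE x in S. tang G (g x) = tang G (g x - k x)"
        using k(2) by eventually_elim (simp add: linear_diff[OF bounded_linear.linear[OF bounded_linear_tang]])
    qed (intro sqintD(1) sqint_bounded_linear[OF _ bounded_linear_tang] sg sqint_diff sk)+
    also have "\<dots> \<le> K * l2 S (\<lambda>x. g x - k x)" by (rule K(2)[OF sqint_diff[OF sg sk]])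
    also have "\<dots> \<le> K * (C * H1_norm \<Omega> (\<lambda>x. \<phi> x - \<theta> x))"
      by (rule mult_left_mono[OF trace_bound[OF \<phi> V_H1[OF \<theta>(1)] g k(1)] K(1)])
    also have "\<dots> \<le> K * (C * e)"
      using \<theta>(2) H1_norm_minus_commute[OF \<phi> V_H1[OF \<theta>(1)]] C0 K(1) by (intro mult_left_mono) auto
    finally show ?thesis by (simp add: mult.assoc)
  qed
  have "l2 S (\<lambda>x. tang G (g x)) \<le> 0"
  proof (rule field_le_epsilon)
    fix e :: real assume e: "e > 0"
    \<comment> \<open>The tolerance is divided by \<open>K * C + 1\<close> because
      \<open>K * C\<close> may be 0.\<close>
    have KC: "0 \<le> K * C" using K(1) C0 by simp
    have "K * C * (e / (K * C + 1)) = (K * C / (K * C + 1)) * e" by simp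
    also have "\<dots> \<le> 1 * e" using KC e by (intro mult_right_mono) (auto simp: divide_le_eq_1)
    finally show "l2 S (\<lambda>x. tang G (g x)) \<le> 0 + e"
      using le[of "e / (K * C + 1)"] e KC by simp
  qed
  then have "l2 S (\<lambda>x. tang G (g x)) = 0" using l2_nonneg by (rule order_antisym)
  then have "AE x in S. tang G (g x) = 0"
    by (rule l2_eq_0[OF sqint_bounded_linear[OF sg bounded_linear_tang]])
  then show "\<exists>g. has_trace \<Omega> G \<phi> g \<and> (AE x in S. tang G (g x) = 0)" using g by blast
qed

subsection \<open>Mesh cells\<close>

text \<open>Simplices and cuboid cells share compactness, convexity and full affine dimension, and
  the last yields interior points. A convex open set is the interior of its closure, so the
  interiors of cells lie in \<open>\<Omega>\<close>.\<close>

lemma mesh_cell: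
  assumes "conforming_mesh \<Omega> \<T>" "T \<in> \<T>"
  shows "compact T" "convex T" "interior T \<noteq> {}" "T \<subseteq> closure \<Omega>" "interior T \<subseteq> \<Omega>"
proof -
  have "int CARD('d) simplex T \<or> (\<exists>v. cuboid_cell v T)"
    using assms by (simp add: conforming_mesh_def)
  then have T: "compact T \<and> convex T \<and> aff_dim T = int CARD('d)"
  proof
    assume "int CARD('d) simplex T"
    then show ?thesis
      using simplex_imp_polytope polytope_imp_compact polytope_imp_convex aff_dim_simplex by blast
  next
    assume "\<exists>v. cuboid_cell v T"
    then obtain v :: "bool^'d \<Rightarrow> real^'d" where "T = convex hull (range v)" "aff_dim T = int CARD('d)"
      by (auto simp: cuboid_cell_def)
    then show ?thesis by (auto intro: finite_imp_compact_convex_hull)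
  qed
  then show "compact T" "convex T" by auto
  have "affine hull T = UNIV" using T aff_dim_eq_full[of T] by simp
  then have "rel_interior T = interior T" by (rule rel_interior_interior)
  moreover have "T \<noteq> {}"
  proof
    assume "T = {}"
    then show False using T by simp
  qed
  ultimately show "interior T \<noteq> {}" using rel_interior_eq_empty[of T] T by auto
  show "T \<subseteq> closure \<Omega>" using assms by (auto simp: conforming_mesh_def)
  then have "interior T \<subseteq> interior (closure \<Omega>)" by (rule interior_mono)
  then show "interior T \<subseteq> \<Omega>" by (simp add: interior_closure_dom)
qed

lemma mesh_trace_facet:
  assumes "conforming_mesh \<Omega> \<T>" "F \<in> mesh_facets \<T>" shows "\<exists>C. trace_facet \<Omega> F C"
proof -
  obtain T where T: "T \<in> \<T>" "F facet_of T" using assms(2) by (auto simp: mesh_facets_def)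
  show ?thesis by (rule facet_imp_trace_facet[OF T(2) mesh_cell(1,2,3,5)[OF assms(1) T(1)]])
qed

end

section \<open>The facet functionals\<close>

context trace_facet
begin

lemma has_trace_trace_on:
  "\<phi> \<in> H1_vec \<Omega> \<Longrightarrow> approximable \<Omega> \<phi> \<Longrightarrow> has_trace \<Omega> F \<phi> (trace_on \<Omega> F \<phi>)"
  unfolding trace_on_def by (rule someI_ex[OF trace_exists])

text \<open>\<open>trace_on\<close> is a choice; uniqueness allows any trace in its place, in
  particular a linear combination of traces.\<close>

lemma q_facet_eq:
  assumes "\<phi> \<in> H1_vec \<Omega>" "has_trace \<Omega> F \<phi> g"
  shows "q_facet \<Omega> nF F \<phi> = (\<integral>x. g x \<bullet> nF F \<partial>S)"
  unfolding q_facet_def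
proof (rule integral_cong_AE)
  have t: "has_trace \<Omega> F \<phi> (trace_on \<Omega> F \<phi>)" unfolding trace_on_def by (rule someI[of "has_trace \<Omega> F \<phi>"]) (rule assms(2))
  show "AE x in S. trace_on \<Omega> F \<phi> x \<bullet> nF F = g x \<bullet> nF F"
    using trace_unique[OF assms(1) t assms(2)] by eventually_elim simp
  have "sqint S (trace_on \<Omega> F \<phi>)" "sqint S g" using t assms(2) unfolding has_trace_iff by blast+
  then have m: "trace_on \<Omega> F \<phi> \<in> borel_measurable S" "g \<in> borel_measurable S"
    by (simp_all only: sqintD(1))
  show "(\<lambda>x. trace_on \<Omega> F \<phi> x \<bullet> nF F) \<in> borel_measurable S"
    by (rule borel_measurable_inner[OF m(1) borel_measurable_const])
  show "(\<lambda>x. g x \<bullet> nF F) \<in> borel_measurable S"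
    by (rule borel_measurable_inner[OF m(2) borel_measurable_const])
qed

lemma q_facet_lincomb:
  assumes "\<phi> \<in> H1_vec \<Omega>" "\<theta> \<in> H1_vec \<Omega>" "approximable \<Omega> \<phi>" "approximable \<Omega> \<theta>"
  shows "q_facet \<Omega> nF F (\<lambda>x. c *\<^sub>R \<phi> x + d *\<^sub>R \<theta> x) = c * q_facet \<Omega> nF F \<phi> + d * q_facet \<Omega> nF F \<theta>"
proof -
  note t = has_trace_trace_on[OF assms(1,3)] has_trace_trace_on[OF assms(2,4)]
  have s: "sqint S (trace_on \<Omega> F \<phi>)" "sqint S (trace_on \<Omega> F \<theta>)" using t unfolding has_trace_iff by blast+
  have "integrable S (\<lambda>x. trace_on \<Omega> F \<phi> x \<bullet> nF F)" "integrable S (\<lambda>x. trace_on \<Omega> F \<theta> x \<bullet> nF F)"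
    by (intro sqint_integrable_inner s sqint_const finite_S)+
  moreover have "q_facet \<Omega> nF F (\<lambda>x. c *\<^sub>R \<phi> x + d *\<^sub>R \<theta> x)
      = (\<integral>x. (c *\<^sub>R trace_on \<Omega> F \<phi> x + d *\<^sub>R trace_on \<Omega> F \<theta> x) \<bullet> nF F \<partial>S)"
    by (rule q_facet_eq[OF H1_lincomb(1)[OF assms(1,2)] trace_lincomb[OF assms(1,2) t]])
  ultimately show ?thesis by (simp add: inner_add_left q_facet_def)
qed

text \<open>Cauchy-Schwarz on the facet against the constant field \<open>nF F\<close>, combined
  with the trace bound. This continuity makes W closed.\<close>

lemma q_facet_bound:
  "\<exists>K\<ge>0. \<forall>\<phi>\<in>H1_vec \<Omega>. \<forall>\<theta>\<in>H1_vec \<Omega>. approximable \<Omega> \<phi> \<longrightarrow> approximable \<Omega> \<theta> \<longrightarrow>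
    \<bar>q_facet \<Omega> nF F \<phi> - q_facet \<Omega> nF F \<theta>\<bar> \<le> K * H1_norm \<Omega> (\<lambda>x. \<phi> x - \<theta> x)"
proof (intro exI[of _ "l2 S (\<lambda>x. nF F) * C"] conjI ballI impI)
  show "0 \<le> l2 S (\<lambda>x. nF F) * C" using C0 by simp
  fix \<phi> \<theta> assume a: "\<phi> \<in> H1_vec \<Omega>" "\<theta> \<in> H1_vec \<Omega>" "approximable \<Omega> \<phi>" "approximable \<Omega> \<theta>"
  note t = has_trace_trace_on[OF a(1,3)] has_trace_trace_on[OF a(2,4)]
  have s: "sqint S (trace_on \<Omega> F \<phi>)" "sqint S (trace_on \<Omega> F \<theta>)" using t unfolding has_trace_iff by blast+
  note sn = sqint_const[OF finite_S, of "nF F"]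
  have "q_facet \<Omega> nF F \<phi> - q_facet \<Omega> nF F \<theta> = (\<integral>x. (trace_on \<Omega> F \<phi> x - trace_on \<Omega> F \<theta> x) \<bullet> nF F \<partial>S)"
    unfolding q_facet_def inner_diff_left
    by (rule Bochner_Integration.integral_diff[symmetric]) (intro sqint_integrable_inner s sn)+
  then have "\<bar>q_facet \<Omega> nF F \<phi> - q_facet \<Omega> nF F \<theta>\<bar> \<le> l2 S (\<lambda>x. trace_on \<Omega> F \<phi> x - trace_on \<Omega> F \<theta> x) * l2 S (\<lambda>x. nF F)"
    using l2_Cauchy_Schwarz[OF sqint_diff[OF s] sn] by simp
  also have "\<dots> \<le> (C * H1_norm \<Omega> (\<lambda>x. \<phi> x - \<theta> x)) * l2 S (\<lambda>x. nF F)"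
    by (rule mult_right_mono[OF trace_bound[OF a(1,2) t] l2_nonneg])
  finally show "\<bar>q_facet \<Omega> nF F \<phi> - q_facet \<Omega> nF F \<theta>\<bar> \<le> l2 S (\<lambda>x. nF F) * C * H1_norm \<Omega> (\<lambda>x. \<phi> x - \<theta> x)"
    by (simp add: mult_ac)
qed

end

section \<open>The fine-scale space W\<close>

context poly_domain
begin

lemma W_V: "w \<in> W_space \<Omega> \<T> nF \<Longrightarrow> w \<in> V_space \<Omega>"
  by (simp add: W_space_def)

lemma W_lincomb:
  assumes mesh: "conforming_mesh \<Omega> \<T>" and w: "w \<in> W_space \<Omega> \<T> nF" "w' \<in> W_space \<Omega> \<T> nF"
  shows "(\<lambda>x. c *\<^sub>R w x + d *\<^sub>R w' x) \<in> W_space \<Omega> \<T> nF"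
  unfolding W_space_def mem_Collect_eq
proof (intro conjI ballI)
  note V = W_V[OF w(1)] W_V[OF w(2)]
  show "(\<lambda>x. c *\<^sub>R w x + d *\<^sub>R w' x) \<in> V_space \<Omega>" by (rule V_lincomb[OF V])
  fix F assume F: "F \<in> mesh_facets \<T>"
  obtain C where "trace_facet \<Omega> F C" using mesh_trace_facet[OF mesh F] by blast
  then interpret trace_facet \<Omega> F C .
  show "q_facet \<Omega> nF F (\<lambda>x. c *\<^sub>R w x + d *\<^sub>R w' x) = 0"
    using q_facet_lincomb[OF V_H1[OF V(1)] V_H1[OF V(2)] V_approximable[OF V(1)] V_approximable[OF V(2)]] w F
    by (simp add: W_space_def)
qed

text \<open>W is a set of functions, and the final argument produces an element of W that equals the
  error only almost everywhere.\<close>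

lemma W_cong_AE:
  assumes "w \<in> W_space \<Omega> \<T> nF" "sqint Leb \<theta>" "AE x in Leb. w x = \<theta> x"
  shows "\<theta> \<in> W_space \<Omega> \<T> nF"
proof -
  note V = W_V[OF assms(1)]
  note h = V_H1[OF V]
  have "has_trace \<Omega> F w = has_trace \<Omega> F \<theta>" for F
    using has_trace_cong_AE[OF H1_sqint[OF h] assms(2,3) h] by blast
  then have "q_facet \<Omega> nF F w = q_facet \<Omega> nF F \<theta>" for F
    by (simp add: q_facet_def trace_on_def)
  then show ?thesis using V_cong_AE[OF V assms(2,3)] assms(1) by (simp add: W_space_def)
qed

lemma W_closed:
  assumes mesh: "conforming_mesh \<Omega> \<T>" and \<phi>: "\<phi> \<in> H1_vec \<Omega>"
    and approx: "\<And>e. e > 0 \<Longrightarrow> \<exists>w\<in>W_space \<Omega> \<T> nF. H1_norm \<Omega> (\<lambda>x. w x - \<phi> x) < e"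
  shows "\<phi> \<in> W_space \<Omega> \<T> nF"
  unfolding W_space_def mem_Collect_eq
proof (intro conjI ballI)
  show V: "\<phi> \<in> V_space \<Omega>" by (rule V_closed[OF \<phi>]) (use approx W_V in blast)
  fix F assume F: "F \<in> mesh_facets \<T>"
  obtain C where "trace_facet \<Omega> F C" using mesh_trace_facet[OF mesh F] by blast
  then interpret trace_facet \<Omega> F C .
  obtain K where K: "K \<ge> 0" "\<And>\<phi> \<theta>. \<phi> \<in> H1_vec \<Omega> \<Longrightarrow> \<theta> \<in> H1_vec \<Omega> \<Longrightarrow> approximable \<Omega> \<phi> \<Longrightarrow> approximable \<Omega> \<theta> \<Longrightarrow>
    \<bar>q_facet \<Omega> nF F \<phi> - q_facet \<Omega> nF F \<theta>\<bar> \<le> K * H1_norm \<Omega> (\<lambda>x. \<phi> x - \<theta> x)"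
    using q_facet_bound[of nF] by blast
  have "\<bar>q_facet \<Omega> nF F \<phi>\<bar> \<le> 0"
  proof (rule field_le_epsilon)
    fix e :: real assume e: "e > 0"
    then have "e / (K + 1) > 0" using K(1) by simp
    then obtain w where w: "w \<in> W_space \<Omega> \<T> nF" "H1_norm \<Omega> (\<lambda>x. w x - \<phi> x) < e / (K + 1)" using approx by blast
    have "\<bar>q_facet \<Omega> nF F w - q_facet \<Omega> nF F \<phi>\<bar> \<le> K * H1_norm \<Omega> (\<lambda>x. w x - \<phi> x)"
      using W_V[OF w(1)] V by (intro K(2) V_H1 V_approximable)
    also have "\<dots> \<le> K * (e / (K + 1))" using w(2) K(1) by (intro mult_left_mono) auto
    also have "\<dots> = (K / (K + 1)) * e" by simp
    also have "\<dots> \<le> 1 * e" using K(1) e by (intro mult_right_mono) (auto simp: divide_le_eq_1)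
    finally show "\<bar>q_facet \<Omega> nF F \<phi>\<bar> \<le> 0 + e" using w(1) F by (simp add: W_space_def)
  qed
  then show "q_facet \<Omega> nF F \<phi> = 0" by simp
qed

end

section \<open>The error estimate\<close>

subsection \<open>Essentially bounded coefficients\<close>

lemma Linf_norm_AE:
  assumes "u \<in> Linf_space S"
  shows "0 \<le> Linf_norm S u" "AE x in lebesgue_on S. norm (u x) \<le> Linf_norm S u"
proof -
  let ?M = "lebesgue_on S"
  let ?f = "\<lambda>x. ereal (norm (u x))"
  have "u \<in> borel_measurable ?M \<and> (\<exists>c. AE x in ?M. norm (u x) \<le> c)"
    using assms unfolding Linf_space_def mem_Collect_eq .
  note u = conjunct1[OF this] conjunct2[OF this]
  have m: "?f \<in> borel_measurable ?M" using u(1) by measurable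
  obtain c where "AE x in ?M. norm (u x) \<le> c" using u(2) by (elim exE)
  then have "AE x in ?M. ?f x \<le> ereal c" by simp
  then have le: "esssup ?M ?f \<le> ereal c" by (rule esssup_I[OF m])
  have ae: "AE x in ?M. ?f x \<le> esssup ?M ?f" by (rule esssup_AE)
  have "0 \<le> Linf_norm S u \<and> (AE x in ?M. norm (u x) \<le> Linf_norm S u)"
  proof (cases "esssup ?M ?f")
    case (real r)
    have r: "AE x in ?M. norm (u x) \<le> r" using ae unfolding real by simp
    have "0 \<le> r"
    proof (rule ccontr)
      assume "\<not> 0 \<le> r"
      \<comment> \<open>For negative \<open>r\<close> the bound \<open>r\<close> on a norm is
        contradictory at every point where it holds, so \<open>r - 1\<close> is an essential bound
        too, below the essential supremum.\<close>
      have "AE x in ?M. ?f x \<le> ereal (r - 1)"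
        using r
      proof eventually_elim
        case (elim x)
        then show ?case using \<open>\<not> 0 \<le> r\<close> norm_ge_zero[of "u x"] by linarith
      qed
      then have "esssup ?M ?f \<le> ereal (r - 1)" by (rule esssup_I[OF m])
      then show False unfolding real by simp
    qed
    then show ?thesis using r unfolding Linf_norm_def real by simp
  next
    case PInf
    then show ?thesis using le by simp
  next
    \<comment> \<open>This occurs only when the measure vanishes; \<open>real_of_ereal\<close> then
      returns 0 and every almost-everywhere statement holds.\<close>
    case MInf
    have "AE x in ?M. norm (u x) \<le> 0" using ae unfolding MInf by eventually_elim simp
    then show ?thesis unfolding Linf_norm_def MInf by simp
  qed
  then show "0 \<le> Linf_norm S u" "AE x in lebesgue_on S. norm (u x) \<le> Linf_norm S u" by auto
qed

lemma frob_eq_inner: "frob X Y = X \<bullet> Y"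
proof -
  have "frob X Y = (\<Sum>i\<in>UNIV. \<Sum>k\<in>UNIV. X $ k $ i * Y $ k $ i)"
    by (simp add: frob_def trace_def matrix_matrix_mult_def transpose_def)
  also have "\<dots> = (\<Sum>k\<in>UNIV. \<Sum>i\<in>UNIV. X $ k $ i * Y $ k $ i)" by (rule sum.swap)
  finally show ?thesis by (simp add: inner_vec_def)
qed

text \<open>The rotation is a fixed linear image of the Jacobian, so linearity and boundedness carry
  over to the rotation term.\<close>

lemma rot_inner_rep:
  "\<exists>\<rho> :: ((real,'d::{finite,comm_ring_1}) vec, 'd) vec \<Rightarrow> real^3. bounded_linear \<rho> \<and>
     (\<forall>\<Omega> \<psi> \<phi>. rot_inner \<Omega> \<psi> \<phi> = (\<integral>x. \<rho> (Jac \<Omega> \<psi> x) \<bullet> \<rho> (Jac \<Omega> \<phi> x) \<partial>lebesgue_on \<Omega>))"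
proof (cases "CARD('d) = 2")
  case True
  let ?\<rho> = "\<lambda>J::((real,'d) vec,'d) vec. vector [J $ 1 $ 2 - J $ 2 $ 1, 0, 0] :: real^3"
  have "linear ?\<rho>" by (rule linearI) (auto simp: vec_eq_iff forall_3 vector_3 algebra_simps)
  then have "bounded_linear ?\<rho>" by (simp add: linear_conv_bounded_linear)
  moreover have "rot_inner \<Omega> \<psi> \<phi> = (\<integral>x. ?\<rho> (Jac \<Omega> \<psi> x) \<bullet> ?\<rho> (Jac \<Omega> \<phi> x) \<partial>lebesgue_on \<Omega>)"
    for \<Omega> and \<psi> \<phi> :: "'d vector_field"
    using True by (simp add: rot_inner_def L2_inner_def rot2_def inner_vec_def sum_3 vector_3)
  ultimately show ?thesis by blast
next
  case False
  let ?\<rho> = "\<lambda>J::((real,'d) vec,'d) vec. vector [J $ 3 $ 2 - J $ 2 $ 3, J $ 1 $ 3 - J $ 3 $ 1, J $ 2 $ 1 - J $ 1 $ 2] :: real^3"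
  have "linear ?\<rho>" by (rule linearI) (auto simp: vec_eq_iff forall_3 vector_3 algebra_simps)
  then have "bounded_linear ?\<rho>" by (simp add: linear_conv_bounded_linear)
  moreover have "rot_inner \<Omega> \<psi> \<phi> = (\<integral>x. ?\<rho> (Jac \<Omega> \<psi> x) \<bullet> ?\<rho> (Jac \<Omega> \<phi> x) \<partial>lebesgue_on \<Omega>)"
    for \<Omega> and \<psi> \<phi> :: "'d vector_field"
    using False by (simp add: rot_inner_def L2_inner_def rot3_def)
  ultimately show ?thesis by blast
qed

subsection \<open>Orthogonal projection\<close>

lemma l2_parallelogram:
  assumes "sqint M u" "sqint M v"
  shows "(l2 M (\<lambda>x. u x - v x))\<^sup>2 = 2 * (l2 M u)\<^sup>2 + 2 * (l2 M v)\<^sup>2 - (l2 M (\<lambda>x. u x + v x))\<^sup>2"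
  using l2_add_scaleR_sq[OF assms, of 1] l2_add_scaleR_sq[OF assms, of "-1"] by simp

context bounded_open
begin

text \<open>The minimiser is obtained as the \<open>H\<^sup>1\<close>-limit of a minimising sequence, which is Cauchy by the
  parallelogram law and coercivity.\<close>

lemma projection_exists:
  fixes B :: "((real^'d) \<Rightarrow> (real^'d)) \<Rightarrow> (real^'d) \<Rightarrow> 'b::euclidean_space"
  assumes Bs: "\<And>\<phi>. \<phi> \<in> H1_vec \<Omega> \<Longrightarrow> sqint Leb (B \<phi>)"
    and Blin: "\<And>\<phi> \<theta> c d. \<phi> \<in> H1_vec \<Omega> \<Longrightarrow> \<theta> \<in> H1_vec \<Omega> \<Longrightarrow>
       AE x in Leb. B (\<lambda>x. c *\<^sub>R \<phi> x + d *\<^sub>R \<theta> x) x = c *\<^sub>R B \<phi> x + d *\<^sub>R B \<theta> x"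
    and Bbd: "\<And>\<phi>. \<phi> \<in> H1_vec \<Omega> \<Longrightarrow> l2 Leb (B \<phi>) \<le> K * H1_norm \<Omega> \<phi>" and K: "0 \<le> K"
    and coercive: "\<And>\<phi>. \<phi> \<in> W \<Longrightarrow> H1_norm \<Omega> \<phi> \<le> k * l2 Leb (B \<phi>)" and k: "0 \<le> k"
    and WH: "W \<subseteq> H1_vec \<Omega>" and W0: "W \<noteq> {}"
    and Wlin: "\<And>w w' c d. w \<in> W \<Longrightarrow> w' \<in> W \<Longrightarrow> (\<lambda>x. c *\<^sub>R w x + d *\<^sub>R w' x) \<in> W"
    and Wcl: "\<And>\<phi>. \<phi> \<in> H1_vec \<Omega> \<Longrightarrow> (\<And>e. e > 0 \<Longrightarrow> \<exists>w\<in>W. H1_norm \<Omega> (\<lambda>x. w x - \<phi> x) < e) \<Longrightarrow> \<phi> \<in> W"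
    and e: "e \<in> H1_vec \<Omega>"
  shows "\<exists>w\<in>W. \<forall>w'\<in>W. (\<integral>x. (B e x - B w x) \<bullet> B w' x \<partial>Leb) = 0"
proof -
  have WH': "w \<in> H1_vec \<Omega>" if "w \<in> W" for w using that WH by blast
  have Bdiff: "l2 Leb (\<lambda>x. B \<phi> x - B \<theta> x) = l2 Leb (B (\<lambda>x. \<phi> x - \<theta> x))"
    if "\<phi> \<in> H1_vec \<Omega>" "\<theta> \<in> H1_vec \<Omega>" for \<phi> \<theta>
  proof (rule l2_cong_AE)
    show "AE x in Leb. B \<phi> x - B \<theta> x = B (\<lambda>x. \<phi> x - \<theta> x) x"
      using Blin[OF that, of 1 "-1"] by eventually_elim simp
  qed (intro sqintD(1) sqint_diff Bs that H1_diff)+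
  define J where "J = (\<lambda>w. (l2 Leb (\<lambda>x. B e x - B w x))\<^sup>2)"
  define \<delta> where "\<delta> = Inf (J ` W)"
  have bb: "bdd_below (J ` W)" by (rule bdd_belowI[of _ 0]) (auto simp: J_def)
  have \<delta>_le: "\<delta> \<le> J w" if "w \<in> W" for w
    unfolding \<delta>_def using bb that by (intro cInf_lower) auto
  have \<delta>0: "0 \<le> \<delta>" unfolding \<delta>_def using W0 by (intro cInf_greatest) (auto simp: J_def)
  have "\<exists>w\<in>W. J w < \<delta> + inverse (real (Suc n))" for n
  proof -
    have "Inf (J ` W) < \<delta> + inverse (real (Suc n))" unfolding \<delta>_def by simp
    then show ?thesis using cInf_lessD[of "J ` W"] W0 by blast
  qed
  then obtain w where w: "\<And>n. w n \<in> W" "\<And>n. J (w n) < \<delta> + inverse (real (Suc n))" by metis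
  note wH = WH'[OF w(1)]
  have inv0: "(\<lambda>n. inverse (real (Suc n))) \<longlonglongrightarrow> 0" by (rule LIMSEQ_inverse_real_of_nat)
  have par: "(l2 Leb (\<lambda>x. B (w m) x - B (w n) x))\<^sup>2 \<le> 2 * inverse (real (Suc m)) + 2 * inverse (real (Suc n))" for m n
  proof -
    \<comment> \<open>The midpoint competes in the minimisation: \<open>J ?h\<close> is at least
      \<open>\<delta>\<close>, so the parallelogram law bounds the difference by the excess of
      \<open>J (w m)\<close> and \<open>J (w n)\<close> over \<open>\<delta>\<close>.\<close>
    let ?h = "\<lambda>x. (1/2) *\<^sub>R w m x + (1/2) *\<^sub>R w n x"
    have hW: "?h \<in> W" by (rule Wlin[OF w(1) w(1)])
    have s: "sqint Leb (\<lambda>x. B e x - B (w m) x)" "sqint Leb (\<lambda>x. B e x - B (w n) x)"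
      by (intro sqint_diff Bs e wH)+
    have "l2 Leb (\<lambda>x. (B e x - B (w m) x) + (B e x - B (w n) x)) = l2 Leb (\<lambda>x. 2 *\<^sub>R (B e x - B ?h x))"
    proof (rule l2_cong_AE)
      show "AE x in Leb. (B e x - B (w m) x) + (B e x - B (w n) x) = 2 *\<^sub>R (B e x - B ?h x)"
        using Blin[OF wH wH, of "1/2" m "1/2" n] by eventually_elim (simp add: algebra_simps scaleR_2)
    qed (intro sqintD(1) sqint_add sqint_scaleR s sqint_diff Bs e WH'[OF hW])+
    also have "\<dots> = 2 * l2 Leb (\<lambda>x. B e x - B ?h x)" by (simp add: l2_scaleR)
    finally have "(l2 Leb (\<lambda>x. (B e x - B (w m) x) + (B e x - B (w n) x)))\<^sup>2 = 4 * J ?h"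
      by (simp add: J_def power_mult_distrib)
    moreover have "l2 Leb (\<lambda>x. (B e x - B (w m) x) - (B e x - B (w n) x)) = l2 Leb (\<lambda>x. B (w m) x - B (w n) x)"
      using l2_minus_commute[of Leb "B (w n)" "B (w m)"] by simp
    ultimately have "(l2 Leb (\<lambda>x. B (w m) x - B (w n) x))\<^sup>2 = 2 * J (w m) + 2 * J (w n) - 4 * J ?h"
      using l2_parallelogram[OF s] by (simp add: J_def)
    then show ?thesis using \<delta>_le[OF hW] w(2)[of m] w(2)[of n] by linarith
  qed
  have "\<exists>\<psi>\<in>H1_vec \<Omega>. (\<lambda>n. H1_norm \<Omega> (\<lambda>x. w n x - \<psi> x)) \<longlonglongrightarrow> 0"
  proof (rule H1_complete[OF wH])
    fix r :: real assume r: "r > 0"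
    \<comment> \<open>The quarter compensates the two terms with factor 2 in \<open>par\<close>;
      \<open>k + 1\<close> avoids a division by 0.\<close>
    then have "(r / (k + 1))\<^sup>2 / 4 > 0" using k by simp
    from order_tendstoD(2)[OF inv0 this]
    obtain N where N: "\<And>n. n \<ge> N \<Longrightarrow> inverse (real (Suc n)) < (r / (k + 1))\<^sup>2 / 4"
      by (auto simp: eventually_sequentially)
    have "H1_norm \<Omega> (\<lambda>x. w m x - w n x) < r" if mn: "m \<ge> N" "n \<ge> N" for m n
    proof -
      have "(l2 Leb (\<lambda>x. B (w m) x - B (w n) x))\<^sup>2 \<le> (r / (k + 1))\<^sup>2"
        using par[of m n] N[OF mn(1)] N[OF mn(2)] by linarith
      then have le: "l2 Leb (\<lambda>x. B (w m) x - B (w n) x) \<le> r / (k + 1)"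
        by (rule power2_le_imp_le) (use r k in simp)
      have "(\<lambda>x. w m x - w n x) \<in> W" using Wlin[OF w(1) w(1), of 1 m "-1" n] by simp
      then have "H1_norm \<Omega> (\<lambda>x. w m x - w n x) \<le> k * l2 Leb (\<lambda>x. B (w m) x - B (w n) x)"
        unfolding Bdiff[OF wH wH] by (rule coercive)
      also have "\<dots> \<le> k * (r / (k + 1))" by (rule mult_left_mono[OF le k])
      also have "\<dots> < r" using r k by (simp add: field_simps)
      finally show ?thesis .
    qed
    then show "\<exists>N. \<forall>m\<ge>N. \<forall>n\<ge>N. H1_norm \<Omega> (\<lambda>x. w m x - w n x) < r" by blast
  qed
  then obtain \<psi> where \<psi>: "\<psi> \<in> H1_vec \<Omega>" "(\<lambda>n. H1_norm \<Omega> (\<lambda>x. w n x - \<psi> x)) \<longlonglongrightarrow> 0" by blast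
  have \<psi>W: "\<psi> \<in> W"
  proof (rule Wcl[OF \<psi>(1)])
    fix r :: real assume "r > 0"
    from order_tendstoD(2)[OF \<psi>(2) this] obtain n where "H1_norm \<Omega> (\<lambda>x. w n x - \<psi> x) < r"
      using eventually_happens'[OF sequentially_bot] by blast
    then show "\<exists>w\<in>W. H1_norm \<Omega> (\<lambda>x. w x - \<psi> x) < r" using w(1) by blast
  qed
  \<comment> \<open>Each \<open>w n\<close> nearly attains the infimum and \<open>B\<close> is
    continuous in the H1 norm, so the limit attains it.\<close>
  have "l2 Leb (\<lambda>x. B e x - B \<psi> x) \<le> sqrt \<delta>"
  proof (rule LIMSEQ_le_const)
    show "(\<lambda>n. sqrt (\<delta> + inverse (real (Suc n))) + K * H1_norm \<Omega> (\<lambda>x. w n x - \<psi> x)) \<longlonglongrightarrow> sqrt \<delta>"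
      using tendsto_add[OF tendsto_real_sqrt[OF tendsto_add[OF tendsto_const inv0]] tendsto_mult[OF tendsto_const \<psi>(2)], of \<delta> K]
      by simp
    have "l2 Leb (\<lambda>x. B e x - B \<psi> x) \<le> sqrt (\<delta> + inverse (real (Suc n))) + K * H1_norm \<Omega> (\<lambda>x. w n x - \<psi> x)" for n
    proof -
      have "l2 Leb (\<lambda>x. B e x - B \<psi> x) \<le> l2 Leb (\<lambda>x. B e x - B (w n) x) + l2 Leb (\<lambda>x. B (w n) x - B \<psi> x)"
        by (rule l2_triangle3[OF Bs[OF e] Bs[OF wH] Bs[OF \<psi>(1)]])
      also have "l2 Leb (\<lambda>x. B e x - B (w n) x) \<le> sqrt (\<delta> + inverse (real (Suc n)))"
        using w(2)[of n] unfolding J_def by (intro real_le_rsqrt) simp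
      also have "l2 Leb (\<lambda>x. B (w n) x - B \<psi> x) \<le> K * H1_norm \<Omega> (\<lambda>x. w n x - \<psi> x)"
        unfolding Bdiff[OF wH \<psi>(1)] by (rule Bbd[OF H1_diff(1)[OF wH \<psi>(1)]])
      finally show ?thesis by simp
    qed
    then show "\<exists>N. \<forall>n\<ge>N. l2 Leb (\<lambda>x. B e x - B \<psi> x) \<le> sqrt (\<delta> + inverse (real (Suc n))) + K * H1_norm \<Omega> (\<lambda>x. w n x - \<psi> x)"
      by blast
  qed
  then have "(l2 Leb (\<lambda>x. B e x - B \<psi> x))\<^sup>2 \<le> (sqrt \<delta>)\<^sup>2" by (rule power_mono) simp
  then have min: "J \<psi> = \<delta>" using \<delta>0 \<delta>_le[OF \<psi>W] by (simp add: J_def)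
  have "(\<integral>x. (B e x - B \<psi> x) \<bullet> B w' x \<partial>Leb) = 0" if w': "w' \<in> W" for w'
  proof -
    have s: "sqint Leb (\<lambda>x. B e x - B \<psi> x)" "sqint Leb (B w')"
      by (intro sqint_diff Bs e \<psi> WH'[OF w'])+
    \<comment> \<open>The increment of \<open>J\<close> when the minimiser is varied in direction
      \<open>w'\<close>; nonnegativity for all \<open>t\<close> kills the linear
      coefficient.\<close>
    have "0 \<le> 0 + 2 * t * (\<integral>x. (B e x - B \<psi> x) \<bullet> B w' x \<partial>Leb) + t\<^sup>2 * (l2 Leb (B w'))\<^sup>2" for t
    proof -
      let ?h = "\<lambda>x. 1 *\<^sub>R \<psi> x + (-t) *\<^sub>R w' x"
      have hW: "?h \<in> W" by (rule Wlin[OF \<psi>W w'])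
      have "l2 Leb (\<lambda>x. B e x - B ?h x) = l2 Leb (\<lambda>x. (B e x - B \<psi> x) + t *\<^sub>R B w' x)"
      proof (rule l2_cong_AE)
        show "AE x in Leb. B e x - B ?h x = (B e x - B \<psi> x) + t *\<^sub>R B w' x"
          using Blin[OF \<psi>(1) WH'[OF w'], of 1 "-t"] by eventually_elim (simp only: scaleR_one scaleR_minus_left, simp)
      qed (intro sqintD(1) sqint_add sqint_scaleR s sqint_diff Bs e WH'[OF hW])+
      then have "J ?h = \<delta> + 2 * t * (\<integral>x. (B e x - B \<psi> x) \<bullet> B w' x \<partial>Leb) + t\<^sup>2 * (l2 Leb (B w'))\<^sup>2"
        using l2_add_scaleR_sq[OF s, of t] min by (simp add: J_def)
      then show ?thesis using \<delta>_le[OF hW] by simp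
    qed
    from discriminant_nonpos[OF this] show ?thesis by simp
  qed
  then show ?thesis using \<psi>W by blast
qed

end

text \<open>Cells may touch the boundary of the domain, where a field known only on
  \<open>\<Omega>\<close> is arbitrary. Completeness of Lebesgue measure makes every subset of that
  null set measurable.\<close>

lemma borel_measurable_lebesgue_on_null_extension:
  assumes u: "u \<in> borel_measurable (lebesgue_on S)" and S: "S \<in> sets lebesgue" and T: "T \<in> sets lebesgue"
    and null: "negligible (T - S)"
  shows "u \<in> borel_measurable (lebesgue_on T)"
proof (rule measurableI)
  fix B :: "'b set" assume "B \<in> sets borel"
  then have "u -` B \<inter> S \<in> sets (lebesgue_on S)"
    using measurable_sets[OF u, of B] by (simp add: space_restrict_space)
  then have 1: "u -` B \<inter> S \<in> sets lebesgue" using S by (simp add: sets_restrict_space_iff)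
  have "negligible (u -` B \<inter> (T - S))" by (rule negligible_subset[OF null]) auto
  then have 2: "u -` B \<inter> (T - S) \<in> sets lebesgue" by (rule negligible_imp_sets)
  have "u -` B \<inter> T = (u -` B \<inter> S) \<inter> T \<union> u -` B \<inter> (T - S)" by blast
  also have "\<dots> \<in> sets lebesgue" by (rule sets.Un[OF sets.Int[OF 1 T] 2])
  finally have "u -` B \<inter> T \<in> sets lebesgue" .
  then show "u -` B \<inter> space (lebesgue_on T) \<in> sets (lebesgue_on T)"
    using T by (simp add: space_restrict_space sets_restrict_space_iff)
qed simp

section \<open>From single cells to the whole domain\<close>

context poly_domain
begin

lemma mesh_cell_null:
  assumes "conforming_mesh \<Omega> \<T>" "T \<in> \<T>"
  shows "negligible (T - \<Omega>)" "T \<in> sets lebesgue"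
proof -
  note c = mesh_cell[OF assms]
  have cv: "convex (closure \<Omega>)" using dom by (simp add: convex_polyhedral_domain_def convex_closure)
  have "T - \<Omega> \<subseteq> frontier (closure \<Omega>)"
    using c(4) by (auto simp: frontier_def interior_closure_dom)
  then show "negligible (T - \<Omega>)" using negligible_subset[OF negligible_convex_frontier[OF cv]] by blast
  show "T \<in> sets lebesgue" using compact_imp_closed[OF c(1)] by (simp add: borel_closed)
qed

text \<open>Off the null set of cell boundaries a point of a cell is interior to it. A face
  containing an interior point of a cell is the whole cell, so by conformity two cells sharing such
  a point coincide. The quantifier over \<open>r\<close> stands inside because \<open>r\<close> will
  depend on \<open>x\<close>.\<close>

lemma mesh_sum_indicator_AE:
  assumes mesh: "conforming_mesh \<Omega> \<T>"
  shows "AE x in lebesgue. \<forall>r::ennreal. (\<Sum>T\<in>\<T>. r * indicator T x) = r * indicator \<Omega> x"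
proof -
  have fin: "finite \<T>" and un: "\<Union>\<T> = closure \<Omega>"
    and faces: "\<And>T T'. T \<in> \<T> \<Longrightarrow> T' \<in> \<T> \<Longrightarrow> T \<inter> T' face_of T"
    using mesh by (auto simp: conforming_mesh_def)
  have "AE x in lebesgue. \<forall>T\<in>\<T>. x \<notin> frontier T"
  proof (rule AE_finite_allI[OF fin])
    fix T assume "T \<in> \<T>"
    then show "AE x in lebesgue. x \<notin> frontier T"
      using negligible_convex_frontier[OF mesh_cell(2)[OF mesh]] unfolding negligible_iff_null_sets
      by (blast intro: AE_not_in)
  qed
  then show ?thesis
  proof eventually_elim
    case (elim x)
    have int: "x \<in> interior T" if "T \<in> \<T>" "x \<in> T" for T
      using elim that closure_subset[of T] by (auto simp: frontier_def)
    have uniq: "T = T'" if T: "T \<in> \<T>" "x \<in> T" and T': "T' \<in> \<T>" "x \<in> T'" for T T'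
    proof -
      have "T \<inter> T' = T" using face_of_disjoint_interior[OF faces[OF T(1) T'(1)]] int[OF T] T T' by blast
      moreover have "T' \<inter> T = T'" using face_of_disjoint_interior[OF faces[OF T'(1) T(1)]] int[OF T'] T T' by blast
      ultimately show ?thesis by blast
    qed
    show ?case
    proof
      fix r :: ennreal
      show "(\<Sum>T\<in>\<T>. r * indicator T x) = r * indicator \<Omega> x"
      proof (cases "x \<in> \<Omega>")
        case True
        then have "x \<in> \<Union>\<T>" using un closure_subset by auto
        then obtain T where T: "T \<in> \<T>" "x \<in> T" by blast
        have "(\<Sum>T'\<in>\<T>. r * indicator T' x) = (\<Sum>T'\<in>\<T>. if T' = T then r else 0)"
        proof (rule sum.cong)
          fix T' assume T': "T' \<in> \<T>"
          have "x \<in> T' \<longleftrightarrow> T' = T" using uniq[OF T T'] T(2) by blast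
          then show "r * indicator T' x = (if T' = T then r else 0)" by (simp add: indicator_def)
        qed simp
        then show ?thesis using fin T True by simp
      next
        case False
        have "x \<notin> T" if "T \<in> \<T>" for T using int[OF that] mesh_cell(5)[OF mesh that] False by blast
        then have "(\<Sum>T\<in>\<T>. r * indicator T x) = 0" by (intro sum.neutral) simp
        then show ?thesis using False by simp
      qed
    qed
  qed
qed

text \<open>Computed with nonnegative integrals: integrability over a single cell is read off from
  the total.\<close>

lemma mesh_sum_l2:
  fixes u :: "real^'d \<Rightarrow> 'b::euclidean_space"
  assumes mesh: "conforming_mesh \<Omega> \<T>" and u: "sqint Leb u"
  shows "(\<Sum>T\<in>\<T>. (l2 (lebesgue_on T) u)\<^sup>2) = (l2 Leb u)\<^sup>2"
proof -
  have fin: "finite \<T>" using mesh by (simp add: conforming_mesh_def)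
  let ?U = "\<lambda>x. ennreal ((norm (u x))\<^sup>2)"
  have m: "u \<in> borel_measurable (lebesgue_on T)" if "T \<in> \<T>" for T
    by (rule borel_measurable_lebesgue_on_null_extension[OF sqintD(1)[OF u] dom_sets])
       (use mesh_cell_null[OF mesh that] in auto)
  have mT: "(\<lambda>x. ?U x * indicator T x) \<in> borel_measurable lebesgue" if "T \<in> \<T>" for T
  proof -
    have "?U \<in> borel_measurable (lebesgue_on T)" using m[OF that] by measurable
    then show ?thesis
      using borel_measurable_restrict_space_iff_ennreal[of T lebesgue ?U] mesh_cell_null(2)[OF mesh that] by simp
  qed
  have nT: "(\<integral>\<^sup>+x. ?U x * indicator T x \<partial>lebesgue) = (\<integral>\<^sup>+x. ?U x \<partial>lebesgue_on T)" if "T \<in> \<T>" for T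
    using mesh_cell_null(2)[OF mesh that] by (simp add: nn_integral_restrict_space)
  have "(\<Sum>T\<in>\<T>. \<integral>\<^sup>+x. ?U x \<partial>lebesgue_on T) = (\<Sum>T\<in>\<T>. \<integral>\<^sup>+x. ?U x * indicator T x \<partial>lebesgue)"
    by (rule sum.cong) (simp_all add: nT)
  also have "\<dots> = (\<integral>\<^sup>+x. (\<Sum>T\<in>\<T>. ?U x * indicator T x) \<partial>lebesgue)"
    by (rule nn_integral_sum[symmetric]) (rule mT)
  also have "\<dots> = (\<integral>\<^sup>+x. ?U x * indicator \<Omega> x \<partial>lebesgue)"
    by (rule nn_integral_cong_AE) (use mesh_sum_indicator_AE[OF mesh] in \<open>eventually_elim, blast\<close>)
  also have "\<dots> = (\<integral>\<^sup>+x. ?U x \<partial>Leb)" using dom_sets by (simp add: nn_integral_restrict_space)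
  finally have sum: "(\<Sum>T\<in>\<T>. \<integral>\<^sup>+x. ?U x \<partial>lebesgue_on T) = ennreal ((l2 Leb u)\<^sup>2)"
    by (simp add: nn_integral_l2[OF u])
  have s: "sqint (lebesgue_on T) u" if T: "T \<in> \<T>" for T
  proof (rule sqint_nn_integral(1)[OF m[OF T]])
    have "(\<integral>\<^sup>+x. ?U x \<partial>lebesgue_on T) \<le> (\<Sum>T\<in>\<T>. \<integral>\<^sup>+x. ?U x \<partial>lebesgue_on T)"
      by (rule member_le_sum[OF T]) (simp_all add: fin)
    then show "(\<integral>\<^sup>+x. ?U x \<partial>lebesgue_on T) \<le> ennreal ((l2 Leb u)\<^sup>2)" unfolding sum .
  qed simp
  have "ennreal (\<Sum>T\<in>\<T>. (l2 (lebesgue_on T) u)\<^sup>2) = (\<Sum>T\<in>\<T>. ennreal ((l2 (lebesgue_on T) u)\<^sup>2))"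
    by (rule sum_ennreal[symmetric]) simp
  also have "\<dots> = (\<Sum>T\<in>\<T>. \<integral>\<^sup>+x. ?U x \<partial>lebesgue_on T)"
    by (rule sum.cong) (simp_all add: nn_integral_l2[OF s])
  finally have "ennreal (\<Sum>T\<in>\<T>. (l2 (lebesgue_on T) u)\<^sup>2) = ennreal ((l2 Leb u)\<^sup>2)" unfolding sum .
  then show ?thesis by (simp add: sum_nonneg)
qed

lemma mesh_size_nonneg:
  assumes mesh: "conforming_mesh \<Omega> \<T>" shows "0 \<le> mesh_size \<T>"
proof -
  obtain x where "x \<in> \<Omega>" using dom by (auto simp: convex_polyhedral_domain_def)
  then have "x \<in> \<Union>\<T>" using mesh closure_subset by (auto simp: conforming_mesh_def)
  then obtain T where T: "T \<in> \<T>" by blast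
  have "0 \<le> diameter T" using mesh_cell(1)[OF mesh T] by (simp add: diameter_ge_0 compact_imp_bounded)
  also have "\<dots> \<le> mesh_size \<T>" unfolding mesh_size_def
    using T mesh by (intro Max_ge) (auto simp: conforming_mesh_def)
  finally show ?thesis .
qed

text \<open>Squared norms add up over the cells, so the local constant survives unchanged.\<close>

lemma mesh_local_to_global:
  fixes u :: "real^'d \<Rightarrow> 'b::euclidean_space" and v :: "real^'d \<Rightarrow> 'c::euclidean_space"
  assumes mesh: "conforming_mesh \<Omega> \<T>" and s: "sqint Leb u" "sqint Leb v" and c: "0 \<le> c"
    and loc: "\<And>T. T \<in> \<T> \<Longrightarrow> l2 (lebesgue_on T) u \<le> c * l2 (lebesgue_on T) v"
  shows "l2 Leb u \<le> c * l2 Leb v"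
proof -
  have "(l2 Leb u)\<^sup>2 = (\<Sum>T\<in>\<T>. (l2 (lebesgue_on T) u)\<^sup>2)" by (rule mesh_sum_l2[OF mesh s(1), symmetric])
  also have "\<dots> \<le> (\<Sum>T\<in>\<T>. (c * l2 (lebesgue_on T) v)\<^sup>2)"
    by (intro sum_mono power_mono loc) simp_all
  also have "\<dots> = (c * l2 Leb v)\<^sup>2"
    by (simp add: power_mult_distrib sum_distrib_left[symmetric] mesh_sum_l2[OF mesh s(2)])
  finally show ?thesis by (rule power2_le_imp_le) (simp add: c)
qed

lemma Poincare:
  assumes "C_P \<Omega> > 0" "\<phi> \<in> V_space \<Omega>"
  shows "l2 Leb \<phi> \<le> inverse (C_P \<Omega>) * l2 Leb (Jac \<Omega> \<phi>)"
proof (cases "AE x in Leb. \<phi> x = 0")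
  \<comment> \<open>The infimum in \<open>C_P\<close> excludes these fields, for which the left side
    is 0.\<close>
  case True
  have "l2 Leb \<phi> = l2 Leb (\<lambda>x. 0 :: real^'d)"
    by (rule l2_cong_AE[OF True sqintD(1)[OF H1_sqint[OF V_H1[OF assms(2)]]]]) simp
  then show ?thesis using assms(1) by simp
next
  case False
  note s = H1_sqint[OF V_H1[OF assms(2)]]
  have pos: "l2 Leb \<phi> > 0"
    using l2_eq_0[OF s] False l2_nonneg[of Leb \<phi>] by (auto simp: less_le)
  have "C_P \<Omega> \<le> L2_norm \<Omega> (Jac \<Omega> \<phi>) / L2_norm \<Omega> \<phi>"
    unfolding C_P_def
  proof (rule cINF_lower)
    show "bdd_below ((\<lambda>\<phi>. L2_norm \<Omega> (Jac \<Omega> \<phi>) / L2_norm \<Omega> \<phi>) ` {\<phi> \<in> V_space \<Omega>. \<not> (AE x in Leb. \<phi> x = 0)})"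
      by (rule bdd_belowI[of _ 0]) (auto simp: L2_norm_eq)
  qed (use assms(2) False in simp)
  then have "C_P \<Omega> * l2 Leb \<phi> \<le> l2 Leb (Jac \<Omega> \<phi>)" using pos by (simp add: L2_norm_eq field_simps)
  then show ?thesis using assms(1) by (simp add: field_simps)
qed

end

context bounded_open
begin

lemma L_op_bound:
  assumes A: "A \<in> Linf_space \<Omega>" and b: "b \<in> Linf_space \<Omega>" and \<phi>: "\<phi> \<in> H1_vec \<Omega>"
  shows "sqint Leb (L_op \<Omega> A b \<phi>)"
    "l2 Leb (L_op \<Omega> A b \<phi>) \<le> Linf_norm \<Omega> A * l2 Leb (Jac \<Omega> \<phi>) + Linf_norm \<Omega> b * l2 Leb \<phi>"
proof -
  \<comment> \<open>Covers matrix and vector coefficients at once, since \<open>frob\<close> is the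
    inner product on the Euclidean space of matrices.\<close>
  have prod: "sqint Leb (\<lambda>x. a x \<bullet> u x) \<and> l2 Leb (\<lambda>x. a x \<bullet> u x) \<le> Linf_norm \<Omega> a * l2 Leb u"
    if a: "a \<in> Linf_space \<Omega>" and u: "sqint Leb u" for a u :: "real^'d \<Rightarrow> 'c::euclidean_space"
  proof -
    have ma: "a \<in> borel_measurable Leb" using a by (simp add: Linf_space_def)
    have m: "(\<lambda>x. a x \<bullet> u x) \<in> borel_measurable Leb"
      by (rule borel_measurable_inner[OF ma sqintD(1)[OF u]])
    have le: "AE x in Leb. norm (a x \<bullet> u x) \<le> Linf_norm \<Omega> a * norm (u x)"
      using Linf_norm_AE(2)[OF a]
    proof eventually_elim
      case (elim x)
      have "norm (a x \<bullet> u x) \<le> norm (a x) * norm (u x)" by (simp add: Cauchy_Schwarz_ineq2)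
      also have "\<dots> \<le> Linf_norm \<Omega> a * norm (u x)" by (rule mult_right_mono[OF elim norm_ge_zero])
      finally show ?case .
    qed
    show ?thesis using sqint_bound[OF m u le] l2_mono[OF m u le Linf_norm_AE(1)[OF a]] by blast
  qed
  note p1 = prod[OF A sqint_Jac[OF \<phi>]] and p2 = prod[OF b H1_sqint[OF \<phi>]]
  have eq: "L_op \<Omega> A b \<phi> = (\<lambda>x. A x \<bullet> Jac \<Omega> \<phi> x + b x \<bullet> \<phi> x)"
    by (simp add: fun_eq_iff L_op_def frob_eq_inner)
  show "sqint Leb (L_op \<Omega> A b \<phi>)" unfolding eq by (rule sqint_add[OF conjunct1[OF p1] conjunct1[OF p2]])
  have "l2 Leb (L_op \<Omega> A b \<phi>) \<le> l2 Leb (\<lambda>x. A x \<bullet> Jac \<Omega> \<phi> x) + l2 Leb (\<lambda>x. b x \<bullet> \<phi> x)"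
    unfolding eq by (rule l2_triangle[OF conjunct1[OF p1] conjunct1[OF p2]])
  then show "l2 Leb (L_op \<Omega> A b \<phi>) \<le> Linf_norm \<Omega> A * l2 Leb (Jac \<Omega> \<phi>) + Linf_norm \<Omega> b * l2 Leb \<phi>"
    using conjunct2[OF p1] conjunct2[OF p2] by linarith
qed

lemma jet_components_le_H1_norm:
  assumes "\<phi> \<in> H1_vec \<Omega>"
  shows "l2 Leb \<phi> \<le> H1_norm \<Omega> \<phi>" "l2 Leb (Jac \<Omega> \<phi>) \<le> H1_norm \<Omega> \<phi>"
    "H1_norm \<Omega> \<phi> \<le> l2 Leb \<phi> + l2 Leb (Jac \<Omega> \<phi>)"
  unfolding H1_norm_def L2_norm_eq
  by (auto intro: real_le_rsqrt sqrt_sum_squares_le_sum)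

end

lemma (in bounded_open) L_op_lincomb_AE:
  assumes "\<phi> \<in> H1_vec \<Omega>" "\<theta> \<in> H1_vec \<Omega>"
  shows "AE x in Leb. L_op \<Omega> A b (\<lambda>x. c *\<^sub>R \<phi> x + d *\<^sub>R \<theta> x) x = c * L_op \<Omega> A b \<phi> x + d * L_op \<Omega> A b \<theta> x"
  using H1_lincomb(2)[OF assms, of c d]
  by eventually_elim (simp add: jet_def L_op_def frob_eq_inner inner_add_right distrib_left)

section \<open>The bilinear form and the decomposition it induces\<close>

locale cordes_form = poly_domain \<Omega> for \<Omega> :: "'d::{finite,comm_ring_1} region" +
  fixes A :: "'d matrix_field" and b :: "'d vector_field" and \<sigma> :: real
  assumes A_Linf: "A \<in> Linf_space \<Omega>" and b_Linf: "b \<in> Linf_space \<Omega>" and \<sigma>_pos: "\<sigma> > 0"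
begin

text \<open>The scalar rotation in dimension 2 is padded with zeros so that both dimensions share the type
  \<^typ>\<open>real^3\<close>.\<close>

lemma a_form_factorization:
  "\<exists>B :: 'd vector_field \<Rightarrow> (real,'d) vec \<Rightarrow> real \<times> (real^3). \<exists>K\<ge>0.
     (\<forall>\<phi>\<in>H1_vec \<Omega>. sqint Leb (B \<phi>) \<and> l2 Leb (B \<phi>) \<le> K * H1_norm \<Omega> \<phi>) \<and>
     (\<forall>\<phi>\<in>H1_vec \<Omega>. \<forall>\<theta>\<in>H1_vec \<Omega>. \<forall>c d.
        AE x in Leb. B (\<lambda>x. c *\<^sub>R \<phi> x + d *\<^sub>R \<theta> x) x = c *\<^sub>R B \<phi> x + d *\<^sub>R B \<theta> x) \<and>
     (\<forall>\<phi>\<in>H1_vec \<Omega>. \<forall>\<theta>\<in>H1_vec \<Omega>. a_form \<Omega> A b \<sigma> \<phi> \<theta> = (\<integral>x. B \<phi> x \<bullet> B \<theta> x \<partial>Leb))"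
proof -
  obtain \<rho> :: "((real,'d) vec, 'd) vec \<Rightarrow> real^3" where \<rho>: "bounded_linear \<rho>"
    "\<forall>\<Omega> \<psi> \<phi>. rot_inner \<Omega> \<psi> \<phi> = (\<integral>x. \<rho> (Jac \<Omega> \<psi> x) \<bullet> \<rho> (Jac \<Omega> \<phi> x) \<partial>lebesgue_on \<Omega>)"
    using rot_inner_rep by blast
  obtain R where R: "R \<ge> 0" "\<forall>M. \<forall>u::(real,'d) vec \<Rightarrow> _. sqint M u \<longrightarrow> l2 M (\<lambda>x. \<rho> (u x)) \<le> R * l2 M u"
    using l2_bounded_linear[OF \<rho>(1)] by blast
  \<comment> \<open>The square root moves the weight \<open>\<sigma>\<close> into both arguments of
    the inner product.\<close>
  define B :: "'d vector_field \<Rightarrow> (real,'d) vec \<Rightarrow> real \<times> (real^3)"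
    where "B = (\<lambda>\<phi> x. (L_op \<Omega> A b \<phi> x, sqrt \<sigma> *\<^sub>R \<rho> (Jac \<Omega> \<phi> x)))"
  define K where "K = Linf_norm \<Omega> A + Linf_norm \<Omega> b + sqrt \<sigma> * R"
  note nn = Linf_norm_AE(1)[OF A_Linf] Linf_norm_AE(1)[OF b_Linf]
  have sr: "sqint Leb (\<lambda>x. \<rho> (Jac \<Omega> \<phi> x))" if "\<phi> \<in> H1_vec \<Omega>" for \<phi>
    by (rule sqint_bounded_linear[OF sqint_Jac[OF that] \<rho>(1)])
  have "sqint Leb (B \<phi>) \<and> l2 Leb (B \<phi>) \<le> K * H1_norm \<Omega> \<phi>" if \<phi>: "\<phi> \<in> H1_vec \<Omega>" for \<phi>
  proof
    note s = L_op_bound(1)[OF A_Linf b_Linf \<phi>] sqint_scaleR[OF sr[OF \<phi>], of "sqrt \<sigma>"]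
    show "sqint Leb (B \<phi>)" unfolding B_def by (rule sqint_Pair(1)[OF s])
    have "(l2 Leb (B \<phi>))\<^sup>2 = (l2 Leb (L_op \<Omega> A b \<phi>))\<^sup>2 + (l2 Leb (\<lambda>x. sqrt \<sigma> *\<^sub>R \<rho> (Jac \<Omega> \<phi> x)))\<^sup>2"
      unfolding B_def by (rule sqint_Pair(2)[OF s])
    also have "\<dots> \<le> (l2 Leb (L_op \<Omega> A b \<phi>) + l2 Leb (\<lambda>x. sqrt \<sigma> *\<^sub>R \<rho> (Jac \<Omega> \<phi> x)))\<^sup>2"
      by (simp add: power2_sum)
    finally have "l2 Leb (B \<phi>) \<le> l2 Leb (L_op \<Omega> A b \<phi>) + l2 Leb (\<lambda>x. sqrt \<sigma> *\<^sub>R \<rho> (Jac \<Omega> \<phi> x))"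
      by (rule power2_le_imp_le) simp
    also have "l2 Leb (L_op \<Omega> A b \<phi>) \<le> Linf_norm \<Omega> A * l2 Leb (Jac \<Omega> \<phi>) + Linf_norm \<Omega> b * l2 Leb \<phi>"
      by (rule L_op_bound(2)[OF A_Linf b_Linf \<phi>])
    also have "\<dots> \<le> Linf_norm \<Omega> A * H1_norm \<Omega> \<phi> + Linf_norm \<Omega> b * H1_norm \<Omega> \<phi>"
      by (intro add_mono mult_left_mono jet_components_le_H1_norm[OF \<phi>] nn)
    also have "l2 Leb (\<lambda>x. sqrt \<sigma> *\<^sub>R \<rho> (Jac \<Omega> \<phi> x)) \<le> sqrt \<sigma> * (R * H1_norm \<Omega> \<phi>)"
    proof -
      have "l2 Leb (\<lambda>x. \<rho> (Jac \<Omega> \<phi> x)) \<le> R * l2 Leb (Jac \<Omega> \<phi>)" using R(2) sqint_Jac[OF \<phi>] by simp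
      also have "\<dots> \<le> R * H1_norm \<Omega> \<phi>" by (rule mult_left_mono[OF jet_components_le_H1_norm(2)[OF \<phi>] R(1)])
      finally show ?thesis unfolding l2_scaleR using \<sigma>_pos by (simp add: mult_left_mono)
    qed
    finally show "l2 Leb (B \<phi>) \<le> K * H1_norm \<Omega> \<phi>" by (simp add: K_def distrib_right)
  qed
  moreover have "AE x in Leb. B (\<lambda>x. c *\<^sub>R \<phi> x + d *\<^sub>R \<theta> x) x = c *\<^sub>R B \<phi> x + d *\<^sub>R B \<theta> x"
    if "\<phi> \<in> H1_vec \<Omega>" "\<theta> \<in> H1_vec \<Omega>" for \<phi> \<theta> c d
    using L_op_lincomb_AE[OF that, of A b c d] H1_lincomb(2)[OF that, of c d]
  proof eventually_elim
    case (elim x)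
    have "Jac \<Omega> (\<lambda>x. c *\<^sub>R \<phi> x + d *\<^sub>R \<theta> x) x = c *\<^sub>R Jac \<Omega> \<phi> x + d *\<^sub>R Jac \<Omega> \<theta> x"
      using elim(2) by (simp add: jet_def)
    then show ?case using elim(1)
      by (simp add: B_def linear_add[OF bounded_linear.linear[OF \<rho>(1)]] linear_cmul[OF bounded_linear.linear[OF \<rho>(1)]]
          scaleR_add_right mult.commute)
  qed
  moreover have "a_form \<Omega> A b \<sigma> \<phi> \<theta> = (\<integral>x. B \<phi> x \<bullet> B \<theta> x \<partial>Leb)"
    if h: "\<phi> \<in> H1_vec \<Omega>" "\<theta> \<in> H1_vec \<Omega>" for \<phi> \<theta>
  proof -
    have i1: "integrable Leb (\<lambda>x. L_op \<Omega> A b \<phi> x \<bullet> L_op \<Omega> A b \<theta> x)"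
      by (intro sqint_integrable_inner L_op_bound(1) A_Linf b_Linf h)
    have i2: "integrable Leb (\<lambda>x. \<rho> (Jac \<Omega> \<phi> x) \<bullet> \<rho> (Jac \<Omega> \<theta> x))"
      by (intro sqint_integrable_inner sr h)
    have "B \<phi> x \<bullet> B \<theta> x = L_op \<Omega> A b \<phi> x \<bullet> L_op \<Omega> A b \<theta> x + \<sigma> * (\<rho> (Jac \<Omega> \<phi> x) \<bullet> \<rho> (Jac \<Omega> \<theta> x))" for x
      using \<sigma>_pos by (simp add: B_def mult.assoc[symmetric])
    then have "(\<integral>x. B \<phi> x \<bullet> B \<theta> x \<partial>Leb) = (\<integral>x. L_op \<Omega> A b \<phi> x \<bullet> L_op \<Omega> A b \<theta> x \<partial>Leb)
        + \<sigma> * (\<integral>x. \<rho> (Jac \<Omega> \<phi> x) \<bullet> \<rho> (Jac \<Omega> \<theta> x) \<partial>Leb)"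
      using i1 i2 by (simp del: inner_real_def)
    then show ?thesis by (simp add: a_form_def L2_inner_def \<rho>(2))
  qed
  moreover have "0 \<le> K" unfolding K_def using nn R(1) \<sigma>_pos by simp
  ultimately show ?thesis by blast
qed

lemma a_form_sym:
  "\<phi> \<in> H1_vec \<Omega> \<Longrightarrow> \<theta> \<in> H1_vec \<Omega> \<Longrightarrow> a_form \<Omega> A b \<sigma> \<phi> \<theta> = a_form \<Omega> A b \<sigma> \<theta> \<phi>"
  by (simp add: a_form_def rot_inner_def L2_inner_def inner_commute mult.commute)

text \<open>\<open>Jac\<close>, picked by choice, respects linear combinations only almost
  everywhere, so linearity is obtained under the integral of the factorised form.\<close>

lemma a_form_lincomb:
  assumes "\<phi> \<in> H1_vec \<Omega>" "\<theta> \<in> H1_vec \<Omega>" "\<omega> \<in> H1_vec \<Omega>"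
  shows "a_form \<Omega> A b \<sigma> (\<lambda>x. c *\<^sub>R \<phi> x + d *\<^sub>R \<theta> x) \<omega> = c * a_form \<Omega> A b \<sigma> \<phi> \<omega> + d * a_form \<Omega> A b \<sigma> \<theta> \<omega>"
proof -
  obtain B :: "'d vector_field \<Rightarrow> (real,'d) vec \<Rightarrow> real \<times> (real^3)" and K where B:
     "\<forall>\<phi>\<in>H1_vec \<Omega>. sqint Leb (B \<phi>) \<and> l2 Leb (B \<phi>) \<le> K * H1_norm \<Omega> \<phi>"
     "\<forall>\<phi>\<in>H1_vec \<Omega>. \<forall>\<theta>\<in>H1_vec \<Omega>. \<forall>c d.
        AE x in Leb. B (\<lambda>x. c *\<^sub>R \<phi> x + d *\<^sub>R \<theta> x) x = c *\<^sub>R B \<phi> x + d *\<^sub>R B \<theta> x"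
     "\<forall>\<phi>\<in>H1_vec \<Omega>. \<forall>\<theta>\<in>H1_vec \<Omega>. a_form \<Omega> A b \<sigma> \<phi> \<theta> = (\<integral>x. B \<phi> x \<bullet> B \<theta> x \<partial>Leb)"
    using a_form_factorization by (elim exE conjE)
  have s: "sqint Leb (B u)" if "u \<in> H1_vec \<Omega>" for u using B(1) that by simp
  note l = H1_lincomb(1)[OF assms(1,2), of c d]
  have "a_form \<Omega> A b \<sigma> (\<lambda>x. c *\<^sub>R \<phi> x + d *\<^sub>R \<theta> x) \<omega> = (\<integral>x. B (\<lambda>x. c *\<^sub>R \<phi> x + d *\<^sub>R \<theta> x) x \<bullet> B \<omega> x \<partial>Leb)"
    using B(3) l assms(3) by simp
  also have "\<dots> = (\<integral>x. (c *\<^sub>R B \<phi> x + d *\<^sub>R B \<theta> x) \<bullet> B \<omega> x \<partial>Leb)"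
  proof (rule integral_cong_AE)
    have "AE x in Leb. B (\<lambda>x. c *\<^sub>R \<phi> x + d *\<^sub>R \<theta> x) x = c *\<^sub>R B \<phi> x + d *\<^sub>R B \<theta> x"
      using B(2) assms(1,2) by simp
    then show "AE x in Leb. B (\<lambda>x. c *\<^sub>R \<phi> x + d *\<^sub>R \<theta> x) x \<bullet> B \<omega> x = (c *\<^sub>R B \<phi> x + d *\<^sub>R B \<theta> x) \<bullet> B \<omega> x"
      by eventually_elim simp
  qed (intro borel_measurable_inner sqintD(1) sqint_add sqint_scaleR s l assms)+
  also have "\<dots> = c * (\<integral>x. B \<phi> x \<bullet> B \<omega> x \<partial>Leb) + d * (\<integral>x. B \<theta> x \<bullet> B \<omega> x \<partial>Leb)"
    using sqint_integrable_inner[OF s[OF assms(1)] s[OF assms(3)]] sqint_integrable_inner[OF s[OF assms(2)] s[OF assms(3)]]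
    by (simp add: inner_add_left)
  finally show ?thesis using B(3) assms by simp
qed

text \<open>Best approximation of \<open>e\<close> from W in the norm of the form: the residual is
  orthogonal to W, which is membership in the multiscale space. Coercivity and the Poincare
  inequality on V supply the lower bound for \<open>B\<close> that the projection needs.\<close>

lemma W_decomposition:
  assumes mesh: "conforming_mesh \<Omega> \<T>" and CP: "C_P \<Omega> > 0" and \<alpha>: "\<alpha> > 0"
    and coercive: "\<And>\<phi>. \<phi> \<in> V_space \<Omega> \<Longrightarrow> \<alpha> * (l2 Leb (Jac \<Omega> \<phi>))\<^sup>2 \<le> a_form \<Omega> A b \<sigma> \<phi> \<phi>"
    and e: "e \<in> V_space \<Omega>"
  shows "\<exists>w\<in>W_space \<Omega> \<T> nF. (\<lambda>x. e x - w x) \<in> Vms_space \<Omega> A b \<sigma> \<T> nF"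
proof -
  obtain B :: "'d vector_field \<Rightarrow> (real,'d) vec \<Rightarrow> real \<times> (real^3)" and K where K: "K \<ge> 0" and B:
     "\<forall>\<phi>\<in>H1_vec \<Omega>. sqint Leb (B \<phi>) \<and> l2 Leb (B \<phi>) \<le> K * H1_norm \<Omega> \<phi>"
     "\<forall>\<phi>\<in>H1_vec \<Omega>. \<forall>\<theta>\<in>H1_vec \<Omega>. \<forall>c d.
        AE x in Leb. B (\<lambda>x. c *\<^sub>R \<phi> x + d *\<^sub>R \<theta> x) x = c *\<^sub>R B \<phi> x + d *\<^sub>R B \<theta> x"
     "\<forall>\<phi>\<in>H1_vec \<Omega>. \<forall>\<theta>\<in>H1_vec \<Omega>. a_form \<Omega> A b \<sigma> \<phi> \<theta> = (\<integral>x. B \<phi> x \<bullet> B \<theta> x \<partial>Leb)"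
    using a_form_factorization by (elim exE conjE)
  let ?W = "W_space \<Omega> \<T> nF"
  \<comment> \<open>Coercivity controls the Jacobian with factor
    \<open>inverse (sqrt \<alpha>)\<close>; the Poincare inequality adds
    \<open>inverse (C_P \<Omega>)\<close> for the field itself.\<close>
  define k where "k = (inverse (C_P \<Omega>) + 1) * inverse (sqrt \<alpha>)"
  have k0: "0 \<le> k" unfolding k_def using CP \<alpha> by simp
  have coer: "H1_norm \<Omega> \<phi> \<le> k * l2 Leb (B \<phi>)" if \<phi>: "\<phi> \<in> V_space \<Omega>" for \<phi>
  proof -
    note h = V_H1[OF \<phi>]
    have "(sqrt \<alpha> * l2 Leb (Jac \<Omega> \<phi>))\<^sup>2 \<le> a_form \<Omega> A b \<sigma> \<phi> \<phi>"
      using coercive[OF \<phi>] \<alpha> by (simp add: power_mult_distrib)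
    also have "\<dots> = (l2 Leb (B \<phi>))\<^sup>2" using B(3) h by (simp add: l2_sq power2_norm_eq_inner)
    finally have "sqrt \<alpha> * l2 Leb (Jac \<Omega> \<phi>) \<le> l2 Leb (B \<phi>)" by (rule power2_le_imp_le) simp
    then have J: "l2 Leb (Jac \<Omega> \<phi>) \<le> inverse (sqrt \<alpha>) * l2 Leb (B \<phi>)"
      using \<alpha> by (simp add: field_simps)
    have "H1_norm \<Omega> \<phi> \<le> l2 Leb \<phi> + l2 Leb (Jac \<Omega> \<phi>)" by (rule jet_components_le_H1_norm(3)[OF h])
    also have "\<dots> \<le> (inverse (C_P \<Omega>) + 1) * l2 Leb (Jac \<Omega> \<phi>)"
      using Poincare[OF CP \<phi>] by (simp add: distrib_right)
    also have "\<dots> \<le> (inverse (C_P \<Omega>) + 1) * (inverse (sqrt \<alpha>) * l2 Leb (B \<phi>))"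
      by (rule mult_left_mono[OF J]) (use CP in simp)
    finally show ?thesis by (simp add: k_def mult.assoc)
  qed
  show ?thesis
  proof (cases "?W = {}")
    case True
    \<comment> \<open>W cannot be empty because it contains the zero field, written here as a
      trivial combination of \<open>e\<close> so that the linearity lemmas apply.\<close>
    then have "(\<lambda>x. 0 *\<^sub>R e x + 0 *\<^sub>R e x) \<notin> ?W" by simp
    then obtain F where F: "F \<in> mesh_facets \<T>" "q_facet \<Omega> nF F (\<lambda>x. 0 *\<^sub>R e x + 0 *\<^sub>R e x) \<noteq> 0"
      using V_lincomb[OF e e, of 0 0] unfolding W_space_def by blast
    obtain C where "trace_facet \<Omega> F C" using mesh_trace_facet[OF mesh F(1)] by blast
    then interpret trace_facet \<Omega> F C .
    show ?thesis using F(2) q_facet_lincomb[OF V_H1[OF e] V_H1[OF e] V_approximable[OF e] V_approximable[OF e], of nF 0 0] by simp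
  next
    case False
    have "\<exists>w\<in>?W. \<forall>w'\<in>?W. (\<integral>x. (B e x - B w x) \<bullet> B w' x \<partial>Leb) = 0"
    proof (rule projection_exists[where K=K and k=k])
      show "?W \<subseteq> H1_vec \<Omega>" using W_V V_H1 by blast
      show "\<And>\<phi>. \<phi> \<in> ?W \<Longrightarrow> H1_norm \<Omega> \<phi> \<le> k * l2 Leb (B \<phi>)" by (rule coer[OF W_V])
      show "\<And>w w' c d. w \<in> ?W \<Longrightarrow> w' \<in> ?W \<Longrightarrow> (\<lambda>x. c *\<^sub>R w x + d *\<^sub>R w' x) \<in> ?W" by (rule W_lincomb[OF mesh])
      show "\<And>\<phi>. \<phi> \<in> H1_vec \<Omega> \<Longrightarrow> (\<And>e. e > 0 \<Longrightarrow> \<exists>w\<in>?W. H1_norm \<Omega> (\<lambda>x. w x - \<phi> x) < e) \<Longrightarrow> \<phi> \<in> ?W"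
        by (rule W_closed[OF mesh])
    qed (use B(1,2) K k0 False V_H1[OF e] in simp_all)
    then obtain w where w: "w \<in> ?W" "\<And>w'. w' \<in> ?W \<Longrightarrow> (\<integral>x. (B e x - B w x) \<bullet> B w' x \<partial>Leb) = 0" by blast
    have s: "sqint Leb (B u)" if "u \<in> V_space \<Omega>" for u using B(1) V_H1[OF that] by simp
    have "a_form \<Omega> A b \<sigma> (\<lambda>x. e x - w x) w' = 0" if w': "w' \<in> ?W" for w'
    proof -
      note v = W_V[OF w(1)] W_V[OF w']
      have "a_form \<Omega> A b \<sigma> (\<lambda>x. e x - w x) w' = a_form \<Omega> A b \<sigma> e w' - a_form \<Omega> A b \<sigma> w w'"
        using a_form_lincomb[OF V_H1[OF e] V_H1[OF v(1)] V_H1[OF v(2)], of 1 "-1"] by simp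
      also have "\<dots> = (\<integral>x. B e x \<bullet> B w' x \<partial>Leb) - (\<integral>x. B w x \<bullet> B w' x \<partial>Leb)"
        using B(3) V_H1[OF e] V_H1[OF v(1)] V_H1[OF v(2)] by simp
      also have "\<dots> = (\<integral>x. (B e x - B w x) \<bullet> B w' x \<partial>Leb)"
        unfolding inner_diff_left
        by (rule Bochner_Integration.integral_diff[symmetric]) (intro sqint_integrable_inner s e v)+
      finally show ?thesis using w(2)[OF w'] by simp
    qed
    moreover have "(\<lambda>x. e x - w x) \<in> V_space \<Omega>"
      using V_lincomb[OF e W_V[OF w(1)], of 1 "-1"] by simp
    ultimately show ?thesis using w(1) by (auto simp: Vms_space_def)
  qed
qed

end

theorem theorem3p2:
  fixes \<Omega> :: "'d::{finite,comm_ring_1} region"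
    and A :: "'d matrix_field" and b :: "'d vector_field"
    and \<sigma> \<alpha> c\<^sub>p C_Pi :: real and p :: nat
    and \<TT> :: "'d mesh set"
    and nF :: "'d mesh \<Rightarrow> 'd region \<Rightarrow> (real,'d) vec"
    and Y :: "'d mesh \<Rightarrow> 'd scalar_field set"
    and PiH :: "'d mesh \<Rightarrow> 'd scalar_field \<Rightarrow> 'd scalar_field"
    and Q :: "'d mesh \<Rightarrow> 'd scalar_field \<Rightarrow> 'd vector_field"
    and f :: "'d scalar_field"
    and z zt zh :: "'d vector_field"
    and \<T> :: "'d mesh"
  assumes dim: "CARD('d) = 2 \<or> CARD('d) = 3"
    and domain: "convex_polyhedral_domain \<Omega>"
    and C_P_pos: "C_P \<Omega> > 0"
    and coeffs: "admissible_coeffs \<Omega> A b"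
    and sigma: "\<sigma> > 0"
    and alpha: "\<alpha> > 0"
      "\<And>\<phi>. \<phi> \<in> V_space \<Omega> \<Longrightarrow> a_form \<Omega> A b \<sigma> \<phi> \<phi> \<ge> \<alpha> * (L2_norm \<Omega> (Jac \<Omega> \<phi>))\<^sup>2"
    and meshes: "\<And>\<S>. \<S> \<in> \<TT> \<Longrightarrow> conforming_mesh \<Omega> \<S>"
      "shape_regular_family \<TT>" "quasi_uniform_family \<TT>"
    and normals: "\<And>\<S> F. \<S> \<in> \<TT> \<Longrightarrow> F \<in> mesh_facets \<S> \<Longrightarrow> unit_normal_to F (nF \<S> F)"
    and c_p: "c\<^sub>p > 0"
      "\<And>\<S> w T. \<S> \<in> \<TT> \<Longrightarrow> w \<in> W_space \<Omega> \<S> (nF \<S>) \<Longrightarrow> T \<in> \<S> \<Longrightarrow>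
         L2_norm T w \<le> c\<^sub>p * mesh_size \<S> * L2_norm T (Jac \<Omega> w)"
    and fe: "\<And>\<S>. \<S> \<in> \<TT> \<Longrightarrow> fe_space \<Omega> \<S> (Y \<S>)"
    and interp: "C_Pi > 0"
      "\<And>\<S>. \<S> \<in> \<TT> \<Longrightarrow> respects_AE \<Omega> (PiH \<S>)"
      "\<And>\<S> v. \<S> \<in> \<TT> \<Longrightarrow> v \<in> Hk_space \<Omega> 1 \<Longrightarrow> PiH \<S> v \<in> Y \<S>"
      "\<And>\<S> k v. \<S> \<in> \<TT> \<Longrightarrow> k \<le> p + 1 \<Longrightarrow> v \<in> Hk_space \<Omega> k \<Longrightarrow> (k = 0 \<Longrightarrow> v \<in> Hk_space \<Omega> 1) \<Longrightarrow>
         L2_norm \<Omega> (\<lambda>x. v x - PiH \<S> v x) \<le> C_Pi * mesh_size \<S> ^ k * Hk_seminorm \<Omega> k v"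
    and Q: "\<And>\<S> y. \<S> \<in> \<TT> \<Longrightarrow> y \<in> Y \<S> \<Longrightarrow> Q \<S> y \<in> W_space \<Omega> \<S> (nF \<S>)"
      "\<And>\<S> y w. \<S> \<in> \<TT> \<Longrightarrow> y \<in> Y \<S> \<Longrightarrow> w \<in> W_space \<Omega> \<S> (nF \<S>) \<Longrightarrow>
         a_form \<Omega> A b \<sigma> (Q \<S> y) w = L2_inner \<Omega> y (L_op \<Omega> A b w)"
    and f: "f \<in> Hk_space \<Omega> (p + 1)"
    and z: "z \<in> V_space \<Omega>"
      "\<And>\<phi>. \<phi> \<in> V_space \<Omega> \<Longrightarrow> a_form \<Omega> A b \<sigma> z \<phi> = L2_inner \<Omega> f (L_op \<Omega> A b \<phi>)"
    and \<T>: "\<T> \<in> \<TT>"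
    and zt: "zt \<in> Vms_space \<Omega> A b \<sigma> \<T> (nF \<T>)"
      "\<And>v. v \<in> Vms_space \<Omega> A b \<sigma> \<T> (nF \<T>) \<Longrightarrow>
         a_form \<Omega> A b \<sigma> zt v = L2_inner \<Omega> f (L_op \<Omega> A b v)"
    and zh: "zh = (\<lambda>x. zt x + Q \<T> (PiH \<T> f) x)"
  shows "L2_norm \<Omega> (Jac \<Omega> (\<lambda>x. z x - zh x))
           \<le> inverse \<alpha> * (Linf_norm \<Omega> A + inverse (C_P \<Omega>) * Linf_norm \<Omega> b)
              * C_Pi * mesh_size \<T> ^ (p + 1) * Hk_seminorm \<Omega> (p + 1) f
       \<and> L2_norm \<Omega> (\<lambda>x. z x - zh x)
           \<le> c\<^sub>p * mesh_size \<T> * L2_norm \<Omega> (Jac \<Omega> (\<lambda>x. z x - zh x))"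
proof -
  have A: "A \<in> Linf_space \<Omega>" and b: "b \<in> Linf_space \<Omega>"
    using coeffs by (auto simp: admissible_coeffs_def)
  interpret cordes_form \<Omega> A b \<sigma>
    by (intro cordes_form.intro cordes_form_axioms.intro poly_domain.intro domain A b sigma)
  note mesh = meshes(1)[OF \<T>]
  let ?a = "a_form \<Omega> A b \<sigma>" and ?L = "L_op \<Omega> A b" and ?W = "W_space \<Omega> \<T> (nF \<T>)"
  define y where "y = PiH \<T> f"
  define q where "q = Q \<T> y"
  define e where "e = (\<lambda>x. z x - zh x)"
  have f1: "f \<in> Hk_space \<Omega> 1" using f by (auto simp: Hk_space_def)
  have y: "y \<in> Y \<T>" unfolding y_def by (rule interp(3)[OF \<T> f1])
  have sf: "sqint Leb f" using f1 by (simp add: Hk_space_def L2_space_iff)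
  have sy: "sqint Leb y" using fe[OF \<T>] y by (auto simp: fe_space_def L2_space_iff)
  have qW: "q \<in> ?W" unfolding q_def by (rule Q(1)[OF \<T> y])
  have ztV: "zt \<in> V_space \<Omega>" and zt_orth: "\<And>w. w \<in> ?W \<Longrightarrow> ?a zt w = 0"
    using zt(1) by (auto simp: Vms_space_def)
  note h = V_H1[OF z(1)] V_H1[OF ztV] V_H1[OF W_V[OF qW]]
  \<comment> \<open>The unit coefficients give the error the shape required by
    \<open>V_lincomb\<close> and \<open>a_form_lincomb\<close>.\<close>
  have e_eq: "e = (\<lambda>x. 1 *\<^sub>R z x + (-1) *\<^sub>R (1 *\<^sub>R zt x + 1 *\<^sub>R q x))"
    by (simp add: e_def zh q_def y_def fun_eq_iff)
  have eV: "e \<in> V_space \<Omega>" unfolding e_eq by (intro V_lincomb z(1) ztV W_V[OF qW])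
  have a_e: "?a e \<phi> = ?a z \<phi> - ?a zt \<phi> - ?a q \<phi>" if "\<phi> \<in> V_space \<Omega>" for \<phi>
    unfolding e_eq a_form_lincomb[OF h(1) H1_lincomb(1)[OF h(2,3)] V_H1[OF that]]
      a_form_lincomb[OF h(2,3) V_H1[OF that]] by simp
  have eW: "e \<in> ?W"
  proof -
    obtain w where w: "w \<in> ?W" "(\<lambda>x. e x - w x) \<in> Vms_space \<Omega> A b \<sigma> \<T> (nF \<T>)"
      using W_decomposition[OF mesh C_P_pos alpha(1) alpha(2)[unfolded L2_norm_eq] eV] by blast
    \<comment> \<open>\<open>v\<close> is the component of the error in the multiscale space;
      testing it with itself will show that it vanishes.\<close>
    define v where "v = (\<lambda>x. e x - w x)"
    have vms: "v \<in> Vms_space \<Omega> A b \<sigma> \<T> (nF \<T>)" unfolding v_def by (rule w(2))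
    then have vV: "v \<in> V_space \<Omega>" and v_orth: "\<And>w. w \<in> ?W \<Longrightarrow> ?a v w = 0"
      by (auto simp: Vms_space_def)
    note hv = V_H1[OF vV] and he = V_H1[OF eV] and hw = V_H1[OF W_V[OF w(1)]]
    \<comment> \<open>The correction lies in W, to which \<open>v\<close> is orthogonal, so adding
      it does not disturb Galerkin orthogonality.\<close>
    have "?a q v = 0" using v_orth[OF qW] a_form_sym[OF h(3) hv] by simp
    then have "?a e v = 0" using a_e[OF vV] z(2)[OF vV] zt(2)[OF vms] by simp
    moreover have "?a w v = 0" using v_orth[OF w(1)] a_form_sym[OF hw hv] by simp
    moreover have "?a v v = ?a e v - ?a w v"
      using a_form_lincomb[OF he hw hv, of 1 "-1"] by (simp add: v_def)
    ultimately have "\<alpha> * (l2 Leb (Jac \<Omega> v))\<^sup>2 \<le> 0" using alpha(2)[OF vV] by (simp add: L2_norm_eq)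
    then have "l2 Leb (Jac \<Omega> v) = 0" using alpha(1) by (simp add: mult_le_0_iff)
    then have "l2 Leb v \<le> 0" using Poincare[OF C_P_pos vV] by simp
    then have "l2 Leb v = 0" using l2_nonneg by (rule order_antisym)
    then have "AE x in Leb. v x = 0" by (rule l2_eq_0[OF H1_sqint[OF hv]])
    then have "AE x in Leb. w x = e x" by eventually_elim (simp add: v_def)
    then show ?thesis by (rule W_cong_AE[OF w(1) H1_sqint[OF he]])
  qed
  note he = V_H1[OF eV]
  have sL: "sqint Leb (?L e)" by (rule L_op_bound(1)[OF A b he])
  define M where "M = Linf_norm \<Omega> A + inverse (C_P \<Omega>) * Linf_norm \<Omega> b"
  have M0: "0 \<le> M" unfolding M_def using Linf_norm_AE(1)[OF A] Linf_norm_AE(1)[OF b] C_P_pos by simp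
  \<comment> \<open>As \<open>e\<close> lies in W, \<open>zt\<close> contributes nothing and the
    correction contributes \<open>y\<close> as its right-hand side, which leaves the interpolation
    error of \<open>f\<close>.\<close>
  have "?a e e = L2_inner \<Omega> f (?L e) - L2_inner \<Omega> y (?L e)"
    using a_e[OF eV] z(2)[OF eV] zt_orth[OF eW] Q(2)[OF \<T> y eW] by (simp add: q_def)
  also have "\<dots> = (\<integral>x. (f x - y x) \<bullet> ?L e x \<partial>Leb)"
    unfolding L2_inner_def inner_diff_left
    by (rule Bochner_Integration.integral_diff[symmetric]) (intro sqint_integrable_inner sf sy sL)+
  also have "\<dots> \<le> l2 Leb (\<lambda>x. f x - y x) * l2 Leb (?L e)"
    using l2_Cauchy_Schwarz[OF sqint_diff[OF sf sy] sL] by linarith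
  also have "\<dots> \<le> l2 Leb (\<lambda>x. f x - y x) * (M * l2 Leb (Jac \<Omega> e))"
  proof (rule mult_left_mono[OF _ l2_nonneg])
    have "l2 Leb (?L e) \<le> Linf_norm \<Omega> A * l2 Leb (Jac \<Omega> e) + Linf_norm \<Omega> b * l2 Leb e"
      by (rule L_op_bound(2)[OF A b he])
    also have "Linf_norm \<Omega> b * l2 Leb e \<le> Linf_norm \<Omega> b * (inverse (C_P \<Omega>) * l2 Leb (Jac \<Omega> e))"
      by (rule mult_left_mono[OF Poincare[OF C_P_pos eV] Linf_norm_AE(1)[OF b]])
    finally show "l2 Leb (?L e) \<le> M * l2 Leb (Jac \<Omega> e)" by (simp add: M_def algebra_simps)
  qed
  finally have est: "\<alpha> * (l2 Leb (Jac \<Omega> e))\<^sup>2 \<le> l2 Leb (\<lambda>x. f x - y x) * (M * l2 Leb (Jac \<Omega> e))"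
    using alpha(2)[OF eV] by (simp add: L2_norm_eq)
  define E where "E = C_Pi * mesh_size \<T> ^ (p + 1) * Hk_seminorm \<Omega> (p + 1) f"
  \<comment> \<open>The interpolation estimate at its top order \<open>k = p + 1\<close>, where the
    extra condition for \<open>k = 0\<close> is void.\<close>
  have fy: "l2 Leb (\<lambda>x. f x - y x) \<le> E"
    using interp(4)[OF \<T> order_refl f] by (simp add: L2_norm_eq y_def E_def)
  have E0: "0 \<le> E" using fy l2_nonneg by (rule order_trans[rotated])
  have bound: "l2 Leb (Jac \<Omega> e) \<le> inverse \<alpha> * M * E"
  \<comment> \<open>The estimate is quadratic in this norm on the left and linear on the right; one
    factor is cancelled, which needs it to be nonzero.\<close>
  proof (cases "l2 Leb (Jac \<Omega> e) = 0")
    case True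
    then show ?thesis using M0 E0 alpha(1) by simp
  next
    case False
    then have pos: "l2 Leb (Jac \<Omega> e) > 0" using l2_nonneg[of Leb "Jac \<Omega> e"] by linarith
    have "(\<alpha> * l2 Leb (Jac \<Omega> e)) * l2 Leb (Jac \<Omega> e) \<le> (M * l2 Leb (\<lambda>x. f x - y x)) * l2 Leb (Jac \<Omega> e)"
      using est by (simp add: power2_eq_square mult_ac)
    then have "\<alpha> * l2 Leb (Jac \<Omega> e) \<le> M * l2 Leb (\<lambda>x. f x - y x)"
      using pos by (rule mult_right_le_imp_le)
    also have "\<dots> \<le> M * E" by (rule mult_left_mono[OF fy M0])
    finally have "l2 Leb (Jac \<Omega> e) \<le> M * E / \<alpha>" using alpha(1) by (simp add: pos_le_divide_eq mult.commute)
    then show ?thesis by (simp add: divide_inverse mult_ac)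
  qed
  have "l2 Leb e \<le> c\<^sub>p * mesh_size \<T> * l2 Leb (Jac \<Omega> e)"
  proof (rule mesh_local_to_global[OF mesh H1_sqint[OF he] sqint_Jac[OF he]])
    show "0 \<le> c\<^sub>p * mesh_size \<T>" using c_p(1) mesh_size_nonneg[OF mesh] by simp
    show "l2 (lebesgue_on T) e \<le> c\<^sub>p * mesh_size \<T> * l2 (lebesgue_on T) (Jac \<Omega> e)" if "T \<in> \<T>" for T
      using c_p(2)[OF \<T> eW that] by (simp add: L2_norm_eq)
  qed
  with bound show ?thesis by (simp add: L2_norm_eq e_def M_def E_def mult.assoc)
qed

end
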